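(* There exists an injection $$\Theta_K\colon\mathfrak{C}_K^-\hookrightarrow(\Lambda_N^\star)^-$$ of $\Lambda_N$-modules, canonical up to the choice of $\iota$, such that $$\Theta_K(\phi)\otimes\zeta=\varprojlim_r\sum_{i=1}^{Np^r-1}\phi(1-\zeta_{Np^r}^i)\otimes[i]_r$$ for all $\phi\in\mathfrak{C}_K^-$.
   Context: Let $p\ge5$ be prime and $N\ge1$ an integer prime to $p$ with $p\nmid\varphi(N)$. Put $\mathbf{Z}_{p,N}=\varprojlim_r\mathbf{Z}/Np^r\mathbf{Z}$, $\Lambda_N=\mathbf{Z}_p[[\mathbf{Z}_{p,N}^\times]]$ and $K=\mathbf{Q}(\mu_{Np^\infty})$, so that $\mathrm{Gal}(K/\mathbf{Q})$ is canonically identified with $\mathbf{Z}_{p,N}^\times$. Unless stated otherwise, the $\Lambda_N$-action on a $\Lambda_N$-module is the one arising from the action of $\mathrm{Gal}(K/\mathbf{Q})$. Fix a complex embedding $\iota\colon\overline{\mathbf{Q}}\hookrightarrow\mathbf{C}$ and put $\zeta_d=\iota^{-1}(e^{2\pi i/d})$ for $d\ge1$; then $\zeta=(\zeta_{p^r})_r$ is a generator of the Tate module of $K^\times$, which is identified with $\mathbf{Z}_p(1)$. $\mathcal{C}_K$ denotes the pro-$p$ completion of the group of cyclotomic $S$-units of $K$ ($S$ being the set of primes dividing $Np$ and any real places), i.e. the pro-$p$ completion of the group generated by the $1-\xi$ with $\xi\in\mu_{Np^\infty}$, $\xi\neq1$. Set $\mathfrak{C}_K=\mathrm{Hom}_{\mathrm{cts}}(\mathcal{C}_K,\mathbf{Z}_p(1))$.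 $\mathbf{Z}_p[[\mathbf{Z}_{p,N}]]$ is viewed as a continuous module over $\Lambda_N$ via left multiplication, $[j]$ denotes its element corresponding to $j\in\mathbf{Z}_{p,N}$, and $\Lambda_N^\star$ is the quotient of $\mathbf{Z}_p[[\mathbf{Z}_{p,N}]]$ by the $\Lambda_N$-submodule generated by $[0]$. Similarly, $\mathbf{Z}_p[(\mathbf{Z}/Np^r\mathbf{Z})^\star]$ is the quotient of $\mathbf{Z}_p[\mathbf{Z}/Np^r\mathbf{Z}]$ by the $\mathbf{Z}_p[(\mathbf{Z}/Np^r\mathbf{Z})^\times]$-submodule generated by $[0]_r$, and $[i]_r$ denotes the class in it of the element corresponding to $i$; $\Lambda_N^\star$ is the inverse limit of the $\mathbf{Z}_p[(\mathbf{Z}/Np^r\mathbf{Z})^\star]$ under the natural maps $[i]_s\mapsto[i]_r$ for $s\ge r$. For a $\Lambda_N$-module $A$, $A^\pm$ denotes its $(\pm1)$-eigenspace for the action of $-1\in(\mathbf{Z}/Np\mathbf{Z})^\times$.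
   Formalization: The target carries the Λ_N-action of the Tate twist Λ_N^⋆(1), where -1 acts as -[-1]; with plain left multiplication the formula puts Θ_K(φ) in the plus part, so injectivity fails. "Canonical" is stated as uniqueness of Θ_K for each ι. *)

theory Defs
  imports
    "HOL-Analysis.Analysis"
    "HOL-Algebra.Algebraic_Closure_Type"
    "HOL-Algebra.Free_Abelian_Groups"
    "HOL-Algebra.Generated_Fields"
    "HOL-Number_Theory.Totient"
begin

section \<open>Profinite rings of integers\<close>

text \<open>
  \<open>Zlim p N\<close> is the ring \<open>lim_r Z/Np^rZ\<close>: an element is the sequence of its canonical
  representatives. Thus \<open>Zlim p N\<close> is the ring Z_{p,N}, and \<open>Zlim p 1\<close> is Z_p.
\<close>

type_synonym profint = "nat \<Rightarrow> int"

abbreviation lvl :: "nat \<Rightarrow> nat \<Rightarrow> nat \<Rightarrow> int"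
  where "lvl p N r \<equiv> int (N * p ^ r)"

definition Zlim :: "nat \<Rightarrow> nat \<Rightarrow> profint ring"
  where "Zlim p N =
    \<lparr>carrier = {x. \<forall>r. x r \<in> {0..<lvl p N r} \<and> x (Suc r) mod lvl p N r = x r},
     monoid.mult = (\<lambda>x y r. (x r * y r) mod lvl p N r),
     monoid.one = (\<lambda>r. 1 mod lvl p N r),
     ring.zero = (\<lambda>r. 0),
     ring.add = (\<lambda>x y r. (x r + y r) mod lvl p N r)\<rparr>"

abbreviation Zp :: "nat \<Rightarrow> profint ring"
  where "Zp p \<equiv> Zlim p 1"

section \<open>General module constructions\<close>

definition submodule_gen ::
    "('r, 'x) ring_scheme \<Rightarrow> ('r, 'm, 'y) module_scheme \<Rightarrow> 'm set \<Rightarrow> 'm set"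
  where "submodule_gen R M S = \<Inter>{H. submodule H R M \<and> S \<subseteq> H}"

definition quot_module :: "('r, 'm, 'y) module_scheme \<Rightarrow> 'm set \<Rightarrow> ('r, 'm set) module"
  where "quot_module M H =
    \<lparr>carrier = a_rcosets\<^bsub>M\<^esub> H,
     monoid.mult = undefined,
     monoid.one = undefined,
     ring.zero = H,
     ring.add = (\<lambda>S T. S <+>\<^bsub>M\<^esub> T),
     module.smult = (\<lambda>c S. \<Union>x\<in>S. H +>\<^bsub>M\<^esub> (c \<odot>\<^bsub>M\<^esub> x))\<rparr>"

definition restrict_scalars ::
    "('s \<Rightarrow> 'r) \<Rightarrow> ('r, 'm, 'y) module_scheme \<Rightarrow> ('s, 'm) module"
  where "restrict_scalars f M =
    \<lparr>carrier = carrier M,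
     monoid.mult = monoid.mult M,
     monoid.one = monoid.one M,
     ring.zero = ring.zero M,
     ring.add = ring.add M,
     module.smult = (\<lambda>c x. f c \<odot>\<^bsub>M\<^esub> x)\<rparr>"

text \<open>
  The tensor product of two modules over a commutative ring, as an abelian group (written
  multiplicatively, as in the library): the free abelian group on the pairs modulo the
  bilinearity relations.
\<close>

definition tensor_rels ::
    "('r, 'x) ring_scheme \<Rightarrow> ('r, 'm, 'y) module_scheme \<Rightarrow> ('r, 'n, 'z) module_scheme
      \<Rightarrow> (('m \<times> 'n) \<Rightarrow>\<^sub>0 int) set"
  where "tensor_rels R M P =
      {frag_of (x \<oplus>\<^bsub>M\<^esub> x', y) - frag_of (x, y) - frag_of (x', y) | x x' y.
         x \<in> carrier M \<and> x' \<in> carrier M \<and> y \<in> carrier P}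
    \<union> {frag_of (x, y \<oplus>\<^bsub>P\<^esub> y') - frag_of (x, y) - frag_of (x, y') | x y y'.
         x \<in> carrier M \<and> y \<in> carrier P \<and> y' \<in> carrier P}
    \<union> {frag_of (c \<odot>\<^bsub>M\<^esub> x, y) - frag_of (x, c \<odot>\<^bsub>P\<^esub> y) | c x y.
         c \<in> carrier R \<and> x \<in> carrier M \<and> y \<in> carrier P}"

definition tensor_kernel ::
    "('r, 'x) ring_scheme \<Rightarrow> ('r, 'm, 'y) module_scheme \<Rightarrow> ('r, 'n, 'z) module_scheme
      \<Rightarrow> (('m \<times> 'n) \<Rightarrow>\<^sub>0 int) set"
  where "tensor_kernel R M P =
    generate (free_Abelian_group (carrier M \<times> carrier P)) (tensor_rels R M P)"

definition tensor ::
    "('r, 'x) ring_scheme \<Rightarrow> ('r, 'm, 'y) module_scheme \<Rightarrow> ('r, 'n, 'z) module_scheme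
      \<Rightarrow> (('m \<times> 'n) \<Rightarrow>\<^sub>0 int) set monoid"
  where "tensor R M P =
    free_Abelian_group (carrier M \<times> carrier P) Mod tensor_kernel R M P"

definition pure_tensor ::
    "('r, 'x) ring_scheme \<Rightarrow> ('r, 'm, 'y) module_scheme \<Rightarrow> ('r, 'n, 'z) module_scheme
      \<Rightarrow> 'm \<Rightarrow> 'n \<Rightarrow> (('m \<times> 'n) \<Rightarrow>\<^sub>0 int) set"
  where "pure_tensor R M P x y =
    tensor_kernel R M P #>\<^bsub>free_Abelian_group (carrier M \<times> carrier P)\<^esub> frag_of (x, y)"

section \<open>Group rings and star modules at finite level\<close>

text \<open>
  An element of the free Z_p-module on a finite set \<open>S\<close> of residues is its coefficient
  function, extended by zero outside \<open>S\<close>.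
\<close>

definition residues_mod :: "int \<Rightarrow> int set"
  where "residues_mod m = {0..<m}"

definition unit_residues :: "int \<Rightarrow> int set"
  where "unit_residues m = {a \<in> {0..<m}. coprime a m}"

definition free_Zp :: "nat \<Rightarrow> int set \<Rightarrow> (int \<Rightarrow> profint) set"
  where "free_Zp p S =
    {f. (\<forall>i\<in>S. f i \<in> carrier (Zp p)) \<and> (\<forall>i. i \<notin> S \<longrightarrow> f i = \<zero>\<^bsub>Zp p\<^esub>)}"

definition scaled_single :: "nat \<Rightarrow> profint \<Rightarrow> int \<Rightarrow> int \<Rightarrow> profint"
  where "scaled_single p c i = (\<lambda>j. if j = i then c else \<zero>\<^bsub>Zp p\<^esub>)"

abbreviation single :: "nat \<Rightarrow> int \<Rightarrow> int \<Rightarrow> profint"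
  where "single p i \<equiv> scaled_single p \<one>\<^bsub>Zp p\<^esub> i"

definition conv ::
    "nat \<Rightarrow> int \<Rightarrow> int set \<Rightarrow> int set \<Rightarrow> (int \<Rightarrow> profint) \<Rightarrow> (int \<Rightarrow> profint) \<Rightarrow> int \<Rightarrow> profint"
  where "conv p m S T f g = (\<lambda>k.
    finsum (Zp p) (\<lambda>(i, j). f i \<otimes>\<^bsub>Zp p\<^esub> g j)
      {(i, j). i \<in> S \<and> j \<in> T \<and> (i * j) mod m = k})"

definition fin_group_ring :: "nat \<Rightarrow> int \<Rightarrow> (int \<Rightarrow> profint) ring"
  where "fin_group_ring p m =
    \<lparr>carrier = free_Zp p (unit_residues m),
     monoid.mult = conv p m (unit_residues m) (unit_residues m),
     monoid.one = single p (1 mod m),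
     ring.zero = (\<lambda>_. \<zero>\<^bsub>Zp p\<^esub>),
     ring.add = (\<lambda>f g i. f i \<oplus>\<^bsub>Zp p\<^esub> g i)\<rparr>"

definition fin_residue_module :: "nat \<Rightarrow> int \<Rightarrow> (int \<Rightarrow> profint, int \<Rightarrow> profint) module"
  where "fin_residue_module p m =
    \<lparr>carrier = free_Zp p (residues_mod m),
     monoid.mult = undefined,
     monoid.one = undefined,
     ring.zero = (\<lambda>_. \<zero>\<^bsub>Zp p\<^esub>),
     ring.add = (\<lambda>f g i. f i \<oplus>\<^bsub>Zp p\<^esub> g i),
     module.smult = conv p m (unit_residues m) (residues_mod m)\<rparr>"

definition fin_star_kernel :: "nat \<Rightarrow> int \<Rightarrow> (int \<Rightarrow> profint) set"
  where "fin_star_kernel p m =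
    submodule_gen (fin_group_ring p m) (fin_residue_module p m) {single p 0}"

definition fin_star :: "nat \<Rightarrow> int \<Rightarrow> (int \<Rightarrow> profint, (int \<Rightarrow> profint) set) module"
  where "fin_star p m = quot_module (fin_residue_module p m) (fin_star_kernel p m)"

definition fin_star_class :: "nat \<Rightarrow> int \<Rightarrow> int \<Rightarrow> (int \<Rightarrow> profint) set"
  where "fin_star_class p m i = fin_star_kernel p m +>\<^bsub>fin_residue_module p m\<^esub> single p i"

definition fin_star_Zp :: "nat \<Rightarrow> int \<Rightarrow> (profint, (int \<Rightarrow> profint) set) module"
  where "fin_star_Zp p m = restrict_scalars (\<lambda>c. scaled_single p c (1 mod m)) (fin_star p m)"

section \<open>The Iwasawa algebra and its star module\<close>

definition measures_on :: "nat \<Rightarrow> nat \<Rightarrow> (nat \<Rightarrow> int set) \<Rightarrow> (nat \<Rightarrow> int \<Rightarrow> profint) set"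
  where "measures_on p N S =
    {\<mu>. \<forall>r. \<mu> r \<in> free_Zp p (S r) \<and>
         (\<forall>j\<in>S r. \<mu> r j =
            (\<Oplus>\<^bsub>Zp p\<^esub>i\<in>{i \<in> S (Suc r). i mod lvl p N r = j}. \<mu> (Suc r) i))}"

definition Lambda :: "nat \<Rightarrow> nat \<Rightarrow> (nat \<Rightarrow> int \<Rightarrow> profint) ring"
  where "Lambda p N =
    \<lparr>carrier = measures_on p N (\<lambda>r. unit_residues (lvl p N r)),
     monoid.mult = (\<lambda>l k r. l r \<otimes>\<^bsub>fin_group_ring p (lvl p N r)\<^esub> k r),
     monoid.one = (\<lambda>r. \<one>\<^bsub>fin_group_ring p (lvl p N r)\<^esub>),
     ring.zero = (\<lambda>r. \<zero>\<^bsub>fin_group_ring p (lvl p N r)\<^esub>),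
     ring.add = (\<lambda>l k r. l r \<oplus>\<^bsub>fin_group_ring p (lvl p N r)\<^esub> k r)\<rparr>"

definition group_elt :: "nat \<Rightarrow> profint \<Rightarrow> nat \<Rightarrow> int \<Rightarrow> profint"
  where "group_elt p j = (\<lambda>r. single p (j r))"

definition completed_module ::
    "nat \<Rightarrow> nat \<Rightarrow> (nat \<Rightarrow> int \<Rightarrow> profint, nat \<Rightarrow> int \<Rightarrow> profint) module"
  where "completed_module p N =
    \<lparr>carrier = measures_on p N (\<lambda>r. residues_mod (lvl p N r)),
     monoid.mult = undefined,
     monoid.one = undefined,
     ring.zero = (\<lambda>r. \<zero>\<^bsub>fin_residue_module p (lvl p N r)\<^esub>),
     ring.add = (\<lambda>\<mu> \<nu> r. \<mu> r \<oplus>\<^bsub>fin_residue_module p (lvl p N r)\<^esub> \<nu> r),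
     module.smult = (\<lambda>l \<mu> r. l r \<odot>\<^bsub>fin_residue_module p (lvl p N r)\<^esub> \<mu> r)\<rparr>"

definition star_kernel :: "nat \<Rightarrow> nat \<Rightarrow> (nat \<Rightarrow> int \<Rightarrow> profint) set"
  where "star_kernel p N =
    submodule_gen (Lambda p N) (completed_module p N) {group_elt p \<zero>\<^bsub>Zlim p N\<^esub>}"

definition Lambda_star ::
    "nat \<Rightarrow> nat \<Rightarrow> (nat \<Rightarrow> int \<Rightarrow> profint, (nat \<Rightarrow> int \<Rightarrow> profint) set) module"
  where "Lambda_star p N = quot_module (completed_module p N) (star_kernel p N)"

definition star_proj ::
    "nat \<Rightarrow> nat \<Rightarrow> nat \<Rightarrow> (nat \<Rightarrow> int \<Rightarrow> profint) set \<Rightarrow> (int \<Rightarrow> profint) set"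
  where "star_proj p N r S =
    (\<Union>\<mu>\<in>S. fin_star_kernel p (lvl p N r) +>\<^bsub>fin_residue_module p (lvl p N r)\<^esub> \<mu> r)"

text \<open>
  The continuous ring endomorphism of the Iwasawa algebra with \<open>[a] \<mapsto> \<chi>(a)[a]\<close>, where
  \<open>\<chi>(a)\<close> is the image of \<open>a\<close> in Z_p, i.e. the cyclotomic character. The coefficient of
  \<open>[a]\<close> at level \<open>r\<close> is the integral of \<open>\<chi>\<close> over the residue class of \<open>a\<close> modulo \<open>Np^r\<close>; its
  residue modulo \<open>p^m\<close> can be read off at level \<open>max r m\<close>.
\<close>

definition twist_Lambda ::
    "nat \<Rightarrow> nat \<Rightarrow> (nat \<Rightarrow> int \<Rightarrow> profint) \<Rightarrow> nat \<Rightarrow> int \<Rightarrow> profint"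
  where "twist_Lambda p N l = (\<lambda>r a m.
    (\<Sum>b\<in>{b \<in> unit_residues (lvl p N (max r m)). b mod lvl p N r = a}.
        l (max r m) b m * b) mod int (p ^ m))"

text \<open>
  The Tate twist \<open>M(1)\<close>, i.e. the tensor product of \<open>M\<close> and Z_p(1) over Z_p with the diagonal
  Galois action, on the underlying group of \<open>M\<close>: \<open>x\<close> stands for \<open>x \<otimes> \<zeta>\<close>, and the element
  with cyclotomic character \<open>a\<close> sends \<open>x \<otimes> \<zeta>\<close> to \<open>\<chi>(a)[a]x \<otimes> \<zeta>\<close>. In particular -1 acts on \<open>M(1)\<close> as \<open>-[-1]\<close>
  acts on \<open>M\<close>.
\<close>

definition Tate_twist ::
    "nat \<Rightarrow> nat \<Rightarrow> (nat \<Rightarrow> int \<Rightarrow> profint, 'm, 'y) module_scheme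
      \<Rightarrow> (nat \<Rightarrow> int \<Rightarrow> profint, 'm) module"
  where "Tate_twist p N M = restrict_scalars (twist_Lambda p N) M"

definition minus_part ::
    "nat \<Rightarrow> nat \<Rightarrow> (nat \<Rightarrow> int \<Rightarrow> profint, 'm, 'y) module_scheme
      \<Rightarrow> (nat \<Rightarrow> int \<Rightarrow> profint, 'm, 'y) module_scheme"
  where "minus_part p N M = M\<lparr>carrier :=
    {x \<in> carrier M. group_elt p (\<ominus>\<^bsub>Zlim p N\<^esub> \<one>\<^bsub>Zlim p N\<^esub>) \<odot>\<^bsub>M\<^esub> x = \<ominus>\<^bsub>M\<^esub> x}\<rparr>"

section \<open>The cyclotomic field, its Galois group and its Tate module\<close>

definition mu_infty :: "nat \<Rightarrow> nat \<Rightarrow> 'a::field_char_0 set"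
  where "mu_infty p N = {\<xi>. \<exists>r. \<xi> ^ (N * p ^ r) = 1}"

definition cyc_field :: "nat \<Rightarrow> nat \<Rightarrow> 'a::field_char_0 ring"
  where "cyc_field p N =
    ring_of_type_algebra\<lparr>carrier := generate_field ring_of_type_algebra (mu_infty p N)\<rparr>"

definition Galois :: "nat \<Rightarrow> nat \<Rightarrow> ('a::field_char_0 \<Rightarrow> 'a) set"
  where "Galois p N =
    {\<sigma> \<in> ring_iso (cyc_field p N) (cyc_field p N). \<sigma> \<in> extensional (carrier (cyc_field p N))}"

definition galois_elt :: "nat \<Rightarrow> nat \<Rightarrow> profint \<Rightarrow> 'a::field_char_0 \<Rightarrow> 'a"
  where "galois_elt p N a =
    (THE \<sigma>. \<sigma> \<in> Galois p N \<and> (\<forall>r \<xi>. \<xi> ^ (N * p ^ r) = 1 \<longrightarrow> \<sigma> \<xi> = \<xi> ^ nat (a r)))"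

text \<open>The Tate module of the multiplicative group of the cyclotomic field, i.e. Z_p(1).\<close>

definition Tate :: "nat \<Rightarrow> nat \<Rightarrow> (profint, nat \<Rightarrow> 'a::field_char_0) module"
  where "Tate p N =
    \<lparr>carrier = {z. \<forall>r. z r \<in> carrier (cyc_field p N) \<and> z r ^ (p ^ r) = 1 \<and> z (Suc r) ^ p = z r},
     monoid.mult = undefined,
     monoid.one = undefined,
     ring.zero = (\<lambda>r. 1),
     ring.add = (\<lambda>z w r. z r * w r),
     module.smult = (\<lambda>c z r. z r ^ nat (c r))\<rparr>"

definition Tate_topology :: "nat \<Rightarrow> nat \<Rightarrow> (nat \<Rightarrow> 'a::field_char_0) topology"
  where "Tate_topology p N =
    subtopology (product_topology (\<lambda>r. discrete_topology UNIV) UNIV) (carrier (Tate p N))"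

definition zeta :: "('a::field_char_0 \<Rightarrow> complex) \<Rightarrow> nat \<Rightarrow> 'a"
  where "zeta \<iota> d = inv_into UNIV \<iota> (exp (2 * of_real pi * \<i> / of_nat d))"

definition Tate_generator :: "('a::field_char_0 \<Rightarrow> complex) \<Rightarrow> nat \<Rightarrow> nat \<Rightarrow> 'a"
  where "Tate_generator \<iota> p = (\<lambda>r. zeta \<iota> (p ^ r))"

section \<open>Pro-p completion\<close>

definition p_quot_kernels :: "nat \<Rightarrow> ('g, 'x) monoid_scheme \<Rightarrow> 'g set set"
  where "p_quot_kernels p G = {B. B \<lhd> G \<and> (\<exists>k. order (G Mod B) = p ^ k)}"

text \<open>
  For \<open>B \<subseteq> C\<close> the image in \<open>G/C\<close> of a coset of \<open>B\<close> is the coset of \<open>C\<close> containing it, so that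
  compatibility of a family of cosets is inclusion.
\<close>

definition pro_p_completion :: "nat \<Rightarrow> ('g, 'x) monoid_scheme \<Rightarrow> ('g set \<Rightarrow> 'g set) monoid"
  where "pro_p_completion p G =
    \<lparr>carrier = {x \<in> (\<Pi>\<^sub>E B\<in>p_quot_kernels p G. carrier (G Mod B)).
        \<forall>B\<in>p_quot_kernels p G. \<forall>C\<in>p_quot_kernels p G. B \<subseteq> C \<longrightarrow> x B \<subseteq> x C},
     monoid.mult = (\<lambda>x y. \<lambda>B\<in>p_quot_kernels p G. x B \<otimes>\<^bsub>G Mod B\<^esub> y B),
     monoid.one = (\<lambda>B\<in>p_quot_kernels p G. \<one>\<^bsub>G Mod B\<^esub>)\<rparr>"

definition pro_p_topology :: "nat \<Rightarrow> ('g, 'x) monoid_scheme \<Rightarrow> ('g set \<Rightarrow> 'g set) topology"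
  where "pro_p_topology p G =
    subtopology
      (product_topology (\<lambda>B. discrete_topology (carrier (G Mod B))) (p_quot_kernels p G))
      (carrier (pro_p_completion p G))"

definition to_pro_p :: "nat \<Rightarrow> ('g, 'x) monoid_scheme \<Rightarrow> 'g \<Rightarrow> 'g set \<Rightarrow> 'g set"
  where "to_pro_p p G g = (\<lambda>B\<in>p_quot_kernels p G. B #>\<^bsub>G\<^esub> g)"

text \<open>The automorphism of the completion induced by an automorphism \<open>\<sigma>\<close> of \<open>G\<close>.\<close>

definition pro_p_aut ::
    "nat \<Rightarrow> ('g, 'x) monoid_scheme \<Rightarrow> ('g \<Rightarrow> 'g) \<Rightarrow> ('g set \<Rightarrow> 'g set) \<Rightarrow> 'g set \<Rightarrow> 'g set"
  where "pro_p_aut p G \<sigma> x =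
    (\<lambda>B\<in>p_quot_kernels p G. \<sigma> ` x {g \<in> carrier G. \<sigma> g \<in> B})"

section \<open>Cyclotomic S-units and their dual\<close>

definition cyc_units :: "nat \<Rightarrow> nat \<Rightarrow> 'a::field_char_0 monoid"
  where "cyc_units p N =
    subgroup_generated (mult_of (cyc_field p N)) {1 - \<xi> | \<xi>. \<xi> \<in> mu_infty p N \<and> \<xi> \<noteq> 1}"

abbreviation CK :: "nat \<Rightarrow> nat \<Rightarrow> ('a::field_char_0 set \<Rightarrow> 'a set) monoid"
  where "CK p N \<equiv> pro_p_completion p (cyc_units p N)"

definition CK_class :: "nat \<Rightarrow> nat \<Rightarrow> 'a::field_char_0 \<Rightarrow> 'a set \<Rightarrow> 'a set"
  where "CK_class p N u = to_pro_p p (cyc_units p N) u"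

definition CK_dual_carrier ::
    "nat \<Rightarrow> nat \<Rightarrow> (('a::field_char_0 set \<Rightarrow> 'a set) \<Rightarrow> nat \<Rightarrow> 'a) set"
  where "CK_dual_carrier p N =
    {\<phi> \<in> extensional (carrier (CK p N)).
       \<phi> \<in> hom (CK p N) (add_monoid (Tate p N)) \<and>
       continuous_map (pro_p_topology p (cyc_units p N)) (Tate_topology p N) \<phi>}"

text \<open>The Galois action \<open>(\<sigma>\<phi>)(x) = \<sigma>(\<phi>(\<sigma>\<inverse>x))\<close> of the element with cyclotomic character \<open>a\<close>.\<close>

definition CK_dual_galois ::
    "nat \<Rightarrow> nat \<Rightarrow> profint \<Rightarrow> (('a::field_char_0 set \<Rightarrow> 'a set) \<Rightarrow> nat \<Rightarrow> 'a)
      \<Rightarrow> ('a set \<Rightarrow> 'a set) \<Rightarrow> nat \<Rightarrow> 'a"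
  where "CK_dual_galois p N a \<phi> =
    (\<lambda>x\<in>carrier (CK p N). \<lambda>r. galois_elt p N a
       (\<phi> (pro_p_aut p (cyc_units p N) (galois_elt p N (inv\<^bsub>Zlim p N\<^esub> a)) x) r))"

text \<open>
  The action of the Iwasawa algebra arising from the Galois action: \<open>l\<phi>\<close> is the integral of
  \<open>\<sigma>\<^sub>a\<phi>\<close> against the measure \<open>l\<close>, i.e. the limit of its Riemann sums for the topology of
  pointwise convergence on the cyclotomic S-units (which are dense in their completion).
  The \<open>s r c\<close> are sample points: arbitrary lifts of the residue classes \<open>c\<close> modulo \<open>Np^r\<close>.
\<close>

definition CK_dual_smult ::
    "nat \<Rightarrow> nat \<Rightarrow> (nat \<Rightarrow> int \<Rightarrow> profint) \<Rightarrow> (('a::field_char_0 set \<Rightarrow> 'a set) \<Rightarrow> nat \<Rightarrow> 'a)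
      \<Rightarrow> ('a set \<Rightarrow> 'a set) \<Rightarrow> nat \<Rightarrow> 'a"
  where "CK_dual_smult p N l \<phi> =
    (THE \<psi>. \<psi> \<in> CK_dual_carrier p N \<and>
       (\<forall>u\<in>carrier (cyc_units p N). \<forall>s.
          (\<forall>r. \<forall>c\<in>unit_residues (lvl p N r). s r c \<in> Units (Zlim p N) \<and> s r c r = c) \<longrightarrow>
          limitin (Tate_topology p N)
            (\<lambda>r. \<Oplus>\<^bsub>Tate p N\<^esub>c\<in>unit_residues (lvl p N r).
               l r c \<odot>\<^bsub>Tate p N\<^esub> CK_dual_galois p N (s r c) \<phi> (CK_class p N u))
            (\<psi> (CK_class p N u)) sequentially))"

definition CK_dual ::
    "nat \<Rightarrow> nat
      \<Rightarrow> (nat \<Rightarrow> int \<Rightarrow> profint, ('a::field_char_0 set \<Rightarrow> 'a set) \<Rightarrow> nat \<Rightarrow> 'a) module"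
  where "CK_dual p N =
    \<lparr>carrier = CK_dual_carrier p N,
     monoid.mult = undefined,
     monoid.one = undefined,
     ring.zero = (\<lambda>x\<in>carrier (CK p N). \<zero>\<^bsub>Tate p N\<^esub>),
     ring.add = (\<lambda>\<phi> \<psi>. \<lambda>x\<in>carrier (CK p N). \<phi> x \<oplus>\<^bsub>Tate p N\<^esub> \<psi> x),
     module.smult = CK_dual_smult p N\<rparr>"

definition module_homs ::
    "('r, 'x) ring_scheme \<Rightarrow> ('r, 'm, 'y) module_scheme \<Rightarrow> ('r, 'n, 'z) module_scheme
      \<Rightarrow> ('m \<Rightarrow> 'n) set"
  where "module_homs R M P =
    {f \<in> carrier M \<rightarrow>\<^sub>E carrier P.
       (\<forall>x\<in>carrier M. \<forall>y\<in>carrier M. f (x \<oplus>\<^bsub>M\<^esub> y) = f x \<oplus>\<^bsub>P\<^esub> f y) \<and>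
       (\<forall>c\<in>carrier R. \<forall>x\<in>carrier M. f (c \<odot>\<^bsub>M\<^esub> x) = c \<odot>\<^bsub>P\<^esub> f x)}"

end

theory Submission
  imports Defs "HOL-Number_Theory.Residues"
begin

text \<open>
  Write \<open>C\<close> for the group generated by the \<open>1 - \<xi>\<close>. A continuous homomorphism \<open>\<phi>\<close> from the pro-p
  completion of \<open>C\<close> to Z_p(1) is the same thing as a homomorphism from \<open>C\<close> to Z_p(1): each layer
  \<open>C \<rightarrow> \<mu>_{p^m}\<close> has a kernel of p-power index (\<open>Dual_extend\<close>), and \<open>C\<close> is dense in its completion
  (\<open>dense_classes\<close>). As Z_p(1) is free on \<open>\<zeta>\<close>, such a \<open>\<phi>\<close> amounts to a Z_p-valued logarithm \<open>dlog \<phi>\<close>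
  on \<open>C\<close>, hence to the family of numbers \<open>dlog \<phi> (1 - \<zeta>_{Np^r}^i)\<close> with \<open>i\<close> not divisible by \<open>Np^r\<close>.

  The identity \<open>\<Prod> (1 - \<zeta>_{Np^{r+1}}^j) = 1 - \<zeta>_{Np^r}^i\<close>, over the residues \<open>j\<close> modulo \<open>Np^{r+1}\<close> that reduce to \<open>i\<close>
  modulo \<open>Np^r\<close>, says that this family is additive in the way that a measure on Z_{p,N} is
  (\<open>distribution\<close>). Only the masses of the residue classes of \<open>0\<close> are missing. They can be supplied
  by recursion on \<open>r\<close>, and two choices differ by a multiple of the Dirac measure \<open>[0]\<close>; so the class
  \<open>Theta \<phi>\<close> in the quotient by \<open>[0]\<close> is well defined. It determines \<open>\<phi>\<close> on the generators of \<open>C\<close>,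
  which gives injectivity.

  Let \<open>\<sigma>_a\<close> have cyclotomic character \<open>a\<close>. Then \<open>\<sigma>_a\<phi>\<close> takes \<open>1 - \<zeta>_{Np^r}^i\<close> to
  \<open>a \<sqdot> \<phi>(1 - \<zeta>_{Np^r}^{i/a})\<close>, so that \<open>Theta (\<sigma>_a\<phi>) = \<chi>(a)[a] Theta \<phi>\<close>, which is the twisted action. An
  arbitrary element of the Iwasawa algebra acts through a limit of Riemann sums. Modulo \<open>p^m\<close> and at
  a fixed unit these sums do not change any more once the level exceeds \<open>m\<close> and the level of a
  cyclotomic field that contains the unit (\<open>Riemann_sum_stable\<close>); so the limit exists, and it can be
  compared with the convolution that defines the module structure on measures
  (\<open>dual_measure_smult\<close>). For the element \<open>[-1]\<close> this comparison shows that \<open>\<phi>\<close> lies in the minus part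
  precisely when its measure is even away from \<open>0\<close>, which is also the condition to lie in the minus
  part of the twisted module.

  That \<open>\<sigma>_a\<close> exists for every unit \<open>a\<close> is the irreducibility of the cyclotomic polynomials. It enters in
  the form: an integer polynomial relation for a root of unity of order dividing \<open>n\<close> holds for its
  \<open>k\<close>-th power if \<open>k\<close> is prime to \<open>n\<close> (\<open>int_relation_conjugate\<close>, by an argument of Landau).

  Uniqueness: \<open>(x, c\<zeta>) \<mapsto> cx\<close> is bilinear, so \<open>x \<otimes> \<zeta>\<close> determines \<open>x\<close> (\<open>tensor_gen_cancel\<close>). Hence the
  formula prescribes all projections of \<open>Theta \<phi>\<close> to finite level, and these determine a class because
  two measures that agree away from \<open>0\<close> at every level differ by a multiple of \<open>[0]\<close>
  (\<open>star_cls_eq_iff\<close>).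
\<close>

section \<open>Conjugates of roots of unity\<close>

abbreviation ipoly :: "int poly \<Rightarrow> 'a::field_char_0 \<Rightarrow> 'a"
  where "ipoly P x \<equiv> poly (map_poly of_int P) x"

lemma ipoly_0 [simp]: "ipoly 0 x = 0" by simp

lemma ipoly_add [simp]: "ipoly (P + Q) x = ipoly P x + ipoly Q x"
proof -
  have "map_poly of_int (P + Q) = (map_poly of_int P + map_poly of_int Q :: 'a poly)"
    by (auto intro!: poly_eqI simp: coeff_map_poly)
  then show ?thesis by simp
qed

lemma ipoly_diff [simp]: "ipoly (P - Q) x = ipoly P x - ipoly Q x"
proof -
  have "map_poly of_int (P - Q) = (map_poly of_int P - map_poly of_int Q :: 'a poly)"
    by (auto intro!: poly_eqI simp: coeff_map_poly)
  then show ?thesis by simp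
qed

lemma ipoly_uminus [simp]: "ipoly (- P) x = - ipoly P x"
  using ipoly_diff[of 0 P x] by (simp del: ipoly_diff)

lemma ipoly_mult [simp]: "ipoly (P * Q) x = ipoly P x * ipoly Q x"
proof -
  have "map_poly of_int (P * Q) = (map_poly of_int P * map_poly of_int Q :: 'a poly)"
    by (auto intro!: poly_eqI simp: coeff_map_poly coeff_mult)
  then show ?thesis by simp
qed

lemma ipoly_pCons [simp]: "ipoly (pCons a P) x = of_int a + x * ipoly P x"
  by (simp add: map_poly_pCons)

lemma ipoly_power [simp]: "ipoly (P ^ k) x = ipoly P x ^ k"
  by (induction k) simp_all

lemma ipoly_monom [simp]: "ipoly (Polynomial.monom c k) x = of_int c * x ^ k"
  by (simp add: map_poly_monom poly_monom)

lemma ipoly_smult [simp]: "ipoly (Polynomial.smult c P) x = of_int c * ipoly P x"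
proof -
  have "Polynomial.smult c P = [:c:] * P" by simp
  then show ?thesis by (simp only: ipoly_mult ipoly_pCons ipoly_0) simp
qed

lemma ipoly_pcompose [simp]: "ipoly (pcompose P Q) x = ipoly P (ipoly Q x)"
  by (induction P) (simp_all add: pcompose_pCons)

lemma ipoly_prod_mset [simp]: "ipoly (prod_mset A) x = prod_mset (image_mset (\<lambda>P. ipoly P x) A)"
  by (induction A) simp_all

text \<open>
  The inner binomial coefficients are divisible by the prime \<open>q\<close>.
\<close>

lemma freshman_dvd:
  fixes u v :: "'b::comm_ring_1"
  assumes "Factorial_Ring.prime q"
  shows "of_nat q dvd (u + v) ^ q - u ^ q - v ^ q"
proof -
  have q0: "q > 0" using assms prime_gt_0_nat by blast
  have "{..q} = insert 0 (insert q {0<..<q})" using q0 by auto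
  then have "(u + v) ^ q = v ^ q + (u ^ q + (\<Sum>k\<in>{0<..<q}. of_nat (q choose k) * u ^ k * v ^ (q - k)))"
    using q0 by (simp add: binomial_ring)
  moreover have "of_nat q dvd (\<Sum>k\<in>{0<..<q}. of_nat (q choose k) * u ^ k * v ^ (q - k))"
  proof (rule dvd_sum)
    fix k assume "k \<in> {0<..<q}"
    then have "q dvd (q choose k)" by (intro dvd_choose_prime assms) auto
    then have "(of_nat q :: 'b) dvd of_nat (q choose k)" by (metis dvd_def of_nat_mult)
    then show "of_nat q dvd of_nat (q choose k) * u ^ k * v ^ (q - k)"
      by (simp add: dvd_mult2)
  qed
  ultimately show ?thesis by simp
qed

text \<open>
  \<open>F(X^q) \<equiv> F(X)^q\<close> modulo \<open>q\<close>: by the binomial theorem and Fermat's little theorem, both sides are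
  additive in \<open>F\<close>, compatible with multiplication by \<open>X\<close>, and agree on constants.
\<close>

lemma Frobenius_dvd:
  fixes F :: "int poly"
  assumes q: "Factorial_Ring.prime q"
  shows "of_nat q dvd pcompose F (Polynomial.monom 1 q) - F ^ q"
proof (induction F)
  case 0
  then show ?case using q by (simp add: prime_gt_0_nat power_0_left)
next
  case (pCons a F)
  let ?M = "Polynomial.monom 1 q :: int poly"
  have F: "pCons a F = [:a:] + Polynomial.monom 1 1 * F"
    by (simp add: monom_altdef)
  have "int q dvd a - a ^ q"
  proof -
    define b where "b = nat (a mod int q)"
    have b: "[int b = a] (mod int q)" using prime_gt_0_nat[OF q] by (simp add: b_def cong_def)
    have "[b ^ q = b] (mod q)"
    proof (cases "q dvd b")
      case True
      then have "q dvd b ^ q" using prime_gt_0_nat[OF q] by (simp add: dvd_power_same dvd_trans dvd_power)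
      then show ?thesis using True by (simp add: cong_def mod_eq_0_iff_dvd)
    next
      case False
      then have "[b ^ (q - 1) = 1] (mod q)" by (rule fermat_theorem[OF q])
      then have "[b * b ^ (q - 1) = b * 1] (mod q)" by (rule cong_scalar_left)
      then show ?thesis using prime_gt_0_nat[OF q] by (simp add: power_eq_if)
    qed
    then have "[int b ^ q = int b] (mod int q)" by (metis cong_int_iff of_nat_power)
    then have "[a ^ q = a] (mod int q)" using b by (meson cong_pow cong_sym cong_trans)
    then show ?thesis by (simp add: cong_iff_dvd_diff dvd_diff_commute)
  qed
  then have 1: "of_nat q dvd [:a:] - [:a:] ^ q"
    by (simp add: poly_const_pow of_nat_poly)
  have 2: "of_nat q dvd ?M * (pcompose F ?M - F ^ q)" using pCons by simp
  have 3: "of_nat q dvd ([:a:] + Polynomial.monom 1 1 * F) ^ q - [:a:] ^ q - (Polynomial.monom 1 1 * F) ^ q"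
    by (rule freshman_dvd[OF q])
  define Y where "Y = (Polynomial.monom 1 1 :: int poly)"
  have XF: "(Y * F) ^ q = ?M * F ^ q"
    by (simp add: power_mult_distrib monom_power Y_def)
  have "pcompose (pCons a F) ?M = [:a:] + ?M * pcompose F ?M"
    by (simp add: pcompose_pCons)
  moreover have "pCons a F ^ q = ([:a:] + Y * F) ^ q" unfolding Y_def by (subst F) simp
  ultimately have "pcompose (pCons a F) ?M - pCons a F ^ q =
     ([:a:] - [:a:] ^ q) + ?M * (pcompose F ?M - F ^ q)
     - (([:a:] + Y * F) ^ q - [:a:] ^ q - (Y * F) ^ q)"
    unfolding XF by (simp only: algebra_simps)
  then show ?case using dvd_diff[OF dvd_add[OF 1 2] 3[folded Y_def]] by (simp only:)
qed

text \<open>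
  A prime factor \<open>f\<close> of \<open>X^n - 1\<close> over the integers that vanishes at \<open>z\<close> has leading coefficient \<open>1\<close> or
  \<open>-1\<close>, so that division by \<open>f\<close> stays within integer polynomials. Its degree is minimal, because a
  nonzero \<open>h\<close> of minimal degree that vanishes at \<open>z\<close> divides a constant multiple of \<open>f\<close>, and
  primality of \<open>f\<close> in a unique factorization domain then gives that \<open>f\<close> divides \<open>h\<close>; this replaces the
  passage to rational coefficients.
\<close>

lemma minimal_int_poly_root_of_unity:
  fixes z :: "'a::field_char_0"
  assumes "n > 0" "z ^ n = 1"
  obtains f :: "int poly" where "Polynomial.lead_coeff f dvd 1" "ipoly f z = 0" "Polynomial.degree f > 0"
    "\<And>g. ipoly g z = 0 \<Longrightarrow> g \<noteq> 0 \<Longrightarrow> Polynomial.degree f \<le> Polynomial.degree g"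
proof -
  define P :: "int poly" where "P = Polynomial.monom 1 n - 1"
  have degP: "Polynomial.degree P = n" "Polynomial.lead_coeff P = 1"
  proof -
    have "Polynomial.coeff P n = 1" using assms by (simp add: P_def)
    moreover have "Polynomial.degree P \<le> n" unfolding P_def
      by (rule degree_diff_le) (auto simp: degree_monom_le)
    ultimately show "Polynomial.degree P = n" using le_degree[of P n] by auto
    then show "Polynomial.lead_coeff P = 1" using \<open>Polynomial.coeff P n = 1\<close> by simp
  qed
  have P0: "P \<noteq> 0" using degP assms by auto
  have "ipoly P z = 0" using assms by (simp add: P_def)
  have "P dvd prod_mset (prime_factorization P)"
    using prod_mset_prime_factorization_weak[OF P0] by (metis dvd_refl dvd_normalize_iff)
  then obtain Q where "prod_mset (prime_factorization P) = P * Q" by (elim dvdE)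
  then have "ipoly (prod_mset (prime_factorization P)) z = 0"
    using \<open>ipoly P z = 0\<close> by (simp del: ipoly_prod_mset)
  then obtain f where f: "f \<in># prime_factorization P" "ipoly f z = 0"
    by (auto simp: prod_mset_zero_iff)
  then have f_prime: "prime_elem f" and fP: "f dvd P"
    using in_prime_factors_imp_prime[OF f(1)] in_prime_factors_imp_dvd[OF f(1)] prime_imp_prime_elem by blast+
  have lf: "Polynomial.lead_coeff f dvd 1"
    using fP degP by (metis dvdE dvd_triv_left lead_coeff_mult)
  have min: "Polynomial.degree f \<le> Polynomial.degree g" if g: "ipoly g z = 0" "g \<noteq> 0" for g
  proof -
    define Q where "Q = (\<lambda>g::int poly. ipoly g z = 0 \<and> g \<noteq> 0)"
    obtain h where h: "Q h" "\<And>g. Q g \<Longrightarrow> Polynomial.degree h \<le> Polynomial.degree g"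
      using ex_has_least_nat[of Q g Polynomial.degree] g by (auto simp: Q_def)
    \<comment> \<open>The remainder vanishes at \<open>z\<close> and is therefore zero.\<close>
    obtain q r where qr: "pseudo_divmod f h = (q, r)" by fastforce
    define c where "c = Polynomial.lead_coeff h ^ (Suc (Polynomial.degree f) - Polynomial.degree h)"
    have "Polynomial.smult c f = h * q + r" and r: "r = 0 \<or> Polynomial.degree r < Polynomial.degree h"
      using pseudo_divmod[OF _ qr] h by (auto simp: Q_def c_def)
    then have "ipoly r z = 0"
      using f h(1) by (metis Q_def ipoly_add ipoly_mult ipoly_smult add_0 mult_zero_left mult_zero_right)
    then have "r = 0" using r h(2)[of r] unfolding Q_def by (meson leD)
    then have cf: "Polynomial.smult c f = h * q" using \<open>Polynomial.smult c f = h * q + r\<close> by simp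
    have c0: "c \<noteq> 0" using h by (simp add: c_def Q_def)
    have "f dvd h * q" using cf by (metis dvd_smult dvd_refl)
    then have "f dvd h \<or> f dvd q" using f_prime by (simp add: prime_elem_dvd_mult_iff)
    then have "f dvd h"
    proof
      assume "f dvd q"
      then obtain q' where "q = f * q'" by (elim dvdE)
      then have "f * [:c:] = f * (h * q')" using cf by (simp add: algebra_simps)
      then have "[:c:] = h * q'"
        using f_prime by (metis mult_left_cancel prime_elem_not_zeroI)
      then have "of_int c = ipoly h z * ipoly q' z"
        by (metis ipoly_mult ipoly_pCons ipoly_0 mult_zero_right add_0_right)
      then show ?thesis using h(1) c0 by (simp add: Q_def)
    qed
    then have "Polynomial.degree f \<le> Polynomial.degree h" using h(1) by (auto simp: Q_def intro: dvd_imp_degree_le)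
    then show ?thesis using h(2)[of g] g by (auto simp: Q_def)
  qed
  have "Polynomial.degree f \<noteq> 0"
  proof
    assume "Polynomial.degree f = 0"
    then obtain a where "f = [:a:]" by (metis degree_eq_zeroE)
    then show False using f(2) f_prime by auto
  qed
  then show ?thesis using that[of f] lf f(2) min by auto
qed

text \<open>
  Landau's argument. Every value \<open>P(z^j)\<close> is \<open>g(z)\<close> for a unique \<open>g\<close> of degree less than that of \<open>f\<close>. If
  \<open>P(z^j) = 0\<close> and \<open>q\<close> is prime, the Frobenius congruence shows that \<open>P(z^{jq})\<close> is \<open>q\<close> times an integer
  polynomial in \<open>z\<close>, so that \<open>q\<close> divides all coefficients of the \<open>g\<close> that belongs to \<open>jq\<close>. As only
  finitely many \<open>g\<close> occur, a prime \<open>q\<close> that exceeds a bound \<open>A\<close> on their leading coefficients can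
  divide \<open>g\<close> only if \<open>g = 0\<close>. Hence \<open>P(z^m) = 0\<close> for all \<open>m\<close> whose prime factors exceed \<open>A\<close>, and every \<open>k\<close>
  prime to \<open>n\<close> is congruent to such an \<open>m\<close> modulo \<open>n\<close>.
\<close>

theorem int_relation_conjugate:
  fixes z :: "'a::field_char_0"
  assumes n: "n > 0" "z ^ n = 1" and k: "coprime k n" and P: "ipoly P z = 0"
  shows "ipoly P (z ^ k) = 0"
proof -
  obtain f :: "int poly" where f: "Polynomial.lead_coeff f dvd 1" "ipoly f z = 0" "Polynomial.degree f > 0"
    and fmin: "\<And>g. ipoly g z = 0 \<Longrightarrow> g \<noteq> 0 \<Longrightarrow> Polynomial.degree f \<le> Polynomial.degree g"
    using minimal_int_poly_root_of_unity[OF n] by metis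
  have red: "\<exists>g. Polynomial.degree g < Polynomial.degree f \<and> ipoly g z = ipoly h z" for h
  proof -
    obtain q r where qr: "pseudo_divmod h f = (q, r)" by fastforce
    define c where "c = Polynomial.lead_coeff f ^ (Suc (Polynomial.degree h) - Polynomial.degree f)"
    have 1: "Polynomial.smult c h = f * q + r" and r: "r = 0 \<or> Polynomial.degree r < Polynomial.degree f"
      using pseudo_divmod[OF _ qr] f(3) unfolding c_def by (metis degree_0 less_numeral_extra(3))+
    have "c dvd 1" using f(1) unfolding c_def using is_unit_power_iff by blast
    then have cc: "c * c = 1" by (metis abs_mult_self_eq mult_1 zdvd1_eq)
    have "of_int c * ipoly h z = ipoly r z" using arg_cong[OF 1, of "\<lambda>h. ipoly h z"] f by simp
    then have "of_int (c * c) * ipoly h z = ipoly (Polynomial.smult c r) z" by simp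
    then have "ipoly (Polynomial.smult c r) z = ipoly h z" using cc by simp
    moreover have "Polynomial.degree (Polynomial.smult c r) < Polynomial.degree f" using r f(3) by auto
    ultimately show ?thesis by blast
  qed
  then obtain g where g: "\<And>j. Polynomial.degree (g j) < Polynomial.degree f" "\<And>j. ipoly (g j) z = ipoly P (z ^ j)"
  proof -
    have "\<forall>j. \<exists>g. Polynomial.degree g < Polynomial.degree f \<and> ipoly g z = ipoly P (z ^ j)"
    proof
      fix j
      show "\<exists>g. Polynomial.degree g < Polynomial.degree f \<and> ipoly g z = ipoly P (z ^ j)"
        using red[of "pcompose P (Polynomial.monom 1 j)"] by simp
    qed
    then show ?thesis using that by metis
  qed
  have unique: "g1 = g2" if "Polynomial.degree g1 < Polynomial.degree f" "Polynomial.degree g2 < Polynomial.degree f" "ipoly g1 z = ipoly g2 z" for g1 g2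
    using fmin[of "g1 - g2"] that degree_diff_less[of g1 "Polynomial.degree f" g2] by force
  have zmod: "z ^ (j mod n) = z ^ j" for j
  proof -
    have "z ^ j = z ^ (n * (j div n) + j mod n)" by simp
    also have "\<dots> = z ^ (j mod n)" using n by (simp only: power_add power_mult) simp
    finally show ?thesis by simp
  qed
  have gmod: "g (j mod n) = g j" for j
    by (rule unique) (auto simp: g zmod)
  define A where "A = nat (\<Sum>j<n. \<bar>Polynomial.lead_coeff (g j)\<bar>)"
  have A: "\<bar>Polynomial.lead_coeff (g j)\<bar> \<le> int A" for j
  proof -
    have "\<bar>Polynomial.lead_coeff (g (j mod n))\<bar> \<le> (\<Sum>j<n. \<bar>Polynomial.lead_coeff (g j)\<bar>)"
      by (rule member_le_sum) (use n in auto)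
    then show ?thesis unfolding A_def gmod by simp
  qed
  have step: "ipoly P (z ^ (j * q)) = 0" if q: "Factorial_Ring.prime q" "q > A" and j: "ipoly P (z ^ j) = 0" for j q
  proof -
    define F where "F = pcompose P (Polynomial.monom 1 j)"
    have Fz: "ipoly F x = ipoly P (x ^ j)" for x :: 'a by (simp add: F_def)
    obtain h where h: "pcompose F (Polynomial.monom 1 q) - F ^ q = of_nat q * h"
      using Frobenius_dvd[OF q(1), of F] unfolding dvd_def by blast
    have "ipoly F (z ^ q) - ipoly F z ^ q = of_nat q * ipoly h z"
      using arg_cong[OF h, of "\<lambda>h. ipoly h z"] by (simp add: of_nat_poly)
    then have 1: "ipoly P (z ^ (j * q)) = of_nat q * ipoly h z"
      using j prime_gt_0_nat[OF q(1)] by (simp add: Fz power_mult[symmetric] mult.commute zero_power)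
    obtain h' where h': "Polynomial.degree h' < Polynomial.degree f" "ipoly h' z = ipoly h z" using red by blast
    have "g (j * q) = Polynomial.smult (int q) h'"
      by (rule unique) (use g h' 1 f(3) in auto)
    then have "int q dvd Polynomial.lead_coeff (g (j * q))" by simp
    moreover have "\<bar>Polynomial.lead_coeff (g (j * q))\<bar> < int q" using A[of "j * q"] q(2) by linarith
    ultimately have "Polynomial.lead_coeff (g (j * q)) = 0"
      by (meson dvd_imp_le_int abs_ge_self leD order_trans)
    then have "g (j * q) = 0" by simp
    then show ?thesis using g(2)[of "j * q"] by simp
  qed
  have all: "(\<forall>q. Factorial_Ring.prime q \<and> q dvd m \<longrightarrow> q > A) \<Longrightarrow> m > 0 \<Longrightarrow> ipoly P (z ^ m) = 0" for m
  proof (induction m rule: less_induct)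
    case (less m)
    show ?case
    proof (cases "m = 1")
      case True
      then show ?thesis using P by simp
    next
      case False
      then obtain q where q: "Factorial_Ring.prime q" "q dvd m" using prime_factor_nat by blast
      then obtain m' where m': "m = m' * q" by (metis dvdE mult.commute)
      then have "m' > 0" "m' < m" using less.prems q prime_gt_1_nat[of q] by auto
      moreover have "\<forall>q. Factorial_Ring.prime q \<and> q dvd m' \<longrightarrow> q > A" using less.prems m' by auto
      ultimately have "ipoly P (z ^ m') = 0" using less.IH by blast
      then show ?thesis using step q less.prems m' by blast
    qed
  qed
  \<comment> \<open>A prime \<open>q \<le> A\<close> divides exactly one of \<open>k\<close> and \<open>n * \<Prod>S\<close>, hence not their sum.\<close>
  define S where "S = {q. Factorial_Ring.prime q \<and> q \<le> A \<and> \<not> q dvd k}"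
  have "finite S" unfolding S_def by auto
  define m where "m = k + n * \<Prod>S"
  have "\<Prod>S > 0" unfolding S_def by (auto intro!: prod_pos prime_gt_0_nat)
  then have "m > 0" using n by (simp add: m_def)
  have "q > A" if q: "Factorial_Ring.prime q" "q dvd m" for q
  proof (rule ccontr)
    assume "\<not> q > A"
    show False
    proof (cases "q dvd k")
      case True
      then have "q dvd n * \<Prod>S" using q(2) unfolding m_def by (simp add: dvd_add_right_iff)
      moreover have "\<not> q dvd n" using True k q(1) by (metis coprime_common_divisor not_prime_unit)
      ultimately have "q dvd \<Prod>S" using q(1) prime_dvd_mult_iff by blast
      then obtain s where "s \<in> S" "q dvd s" using prime_dvd_prod_iff[OF \<open>finite S\<close> q(1)] by auto
      then have "s = q" using q(1) primes_dvd_imp_eq by (auto simp: S_def)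
      then show False using True \<open>s \<in> S\<close> by (simp add: S_def)
    next
      case False
      then have "q \<in> S" using q \<open>\<not> q > A\<close> by (simp add: S_def)
      then have "q dvd n * \<Prod>S" using dvd_prodI[OF \<open>finite S\<close>, of q "\<lambda>x. x"] by (simp add: dvd_mult)
      then show False using False q(2) unfolding m_def by (simp add: dvd_add_left_iff)
    qed
  qed
  then have "ipoly P (z ^ m) = 0" using all \<open>m > 0\<close> by blast
  moreover have "z ^ m = z ^ k" using zmod[of m] zmod[of k] by (simp add: m_def)
  ultimately show ?thesis by simp
qed

section \<open>Arithmetic of the profinite rings of integers\<close>

text \<open>
  The moduli \<open>int (N * p ^ r)\<close> and \<open>int (p ^ m)\<close> have to stay folded for the statements below to apply.
\<close>

declare of_nat_mult [simp del] of_nat_power [simp del] One_nat_def [simp del] power_Suc [simp del]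

lemma Zlim_carrier_iff:
  "x \<in> carrier (Zlim p N) \<longleftrightarrow> (\<forall>r. x r \<in> {0..<lvl p N r} \<and> x (Suc r) mod lvl p N r = x r)"
  by (simp add: Zlim_def)

lemma Zlim_simps [simp]:
  "x \<otimes>\<^bsub>Zlim p N\<^esub> y = (\<lambda>r. (x r * y r) mod lvl p N r)"
  "x \<oplus>\<^bsub>Zlim p N\<^esub> y = (\<lambda>r. (x r + y r) mod lvl p N r)"
  "\<zero>\<^bsub>Zlim p N\<^esub> = (\<lambda>r. 0)"
  "\<one>\<^bsub>Zlim p N\<^esub> = (\<lambda>r. 1 mod lvl p N r)"
  by (simp_all add: Zlim_def)

lemma lvl_dvd: "r \<le> s \<Longrightarrow> lvl p N r dvd lvl p N s"
  by (simp only: int_dvd_int_iff mult_dvd_mono dvd_refl le_imp_power_dvd)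

lemma Zlim_range: "x \<in> carrier (Zlim p N) \<Longrightarrow> 0 \<le> x r \<and> x r < lvl p N r"
  by (auto simp: Zlim_carrier_iff)

lemma Zlim_mod_self [simp]: "x \<in> carrier (Zlim p N) \<Longrightarrow> x r mod lvl p N r = x r"
  using Zlim_range[of x p N r] by simp

lemma Zlim_mod:
  assumes "x \<in> carrier (Zlim p N)" "r \<le> s"
  shows "x s mod lvl p N r = x r"
  using assms(2)
proof (induction s rule: dec_induct)
  case base
  then show ?case using Zlim_mod_self[OF assms(1)] by blast
next
  case (step s)
  have "x (Suc s) mod lvl p N s = x s" using assms(1) by (simp only: Zlim_carrier_iff) 
  then have "x (Suc s) mod lvl p N r = x s mod lvl p N r"
    by (metis lvl_dvd[OF step(1)] mod_mod_cancel)
  then show ?case using step.IH by simp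
qed

lemma Zlim_cong: "x \<in> carrier (Zlim p N) \<Longrightarrow> r \<le> s \<Longrightarrow> [x s = x r] (mod lvl p N r)"
  unfolding cong_def using Zlim_mod[of x p N r s] Zlim_mod_self[of x p N r] by presburger

lemma Zlim_memI:
  assumes "p > 0" "N > 0" "\<And>r. x r \<in> {0..<lvl p N r}" "\<And>r. [x (Suc r) = x r] (mod lvl p N r)"
  shows "x \<in> carrier (Zlim p N)"
  using assms(3,4) unfolding Zlim_carrier_iff cong_def by (metis atLeastLessThan_iff mod_pos_pos_trivial)

lemma cong_reduce: "[a mod m = b mod n] (mod k) \<longleftrightarrow> [a = b] (mod k)" if "k dvd m" "k dvd n" for k :: int
  using that by (simp add: cong_def mod_mod_cancel)

lemma cong_mod_left: "k dvd m \<Longrightarrow> [a mod m = b] (mod k) \<longleftrightarrow> [a = b] (mod k)" for k :: int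
  by (simp add: cong_def mod_mod_cancel)

lemma lvl_pos: "p > 0 \<Longrightarrow> N > 0 \<Longrightarrow> lvl p N r > 0" by simp

lemma Zlim_cring:
  assumes "p > 0" "N > 0"
  shows "cring (Zlim p N)"
proof -
  have pos: "lvl p N r > 0" for r using assms by simp
  have sd: "lvl p N r dvd lvl p N (Suc r)" for r by (rule lvl_dvd) simp
  have mem: "(\<lambda>r. f r mod lvl p N r) \<in> carrier (Zlim p N)" if "\<And>r. [f (Suc r) = f r] (mod lvl p N r)" for f
    by (rule Zlim_memI) (use assms pos that sd in \<open>auto simp only: cong_reduce[OF sd dvd_refl] atLeastLessThan_iff pos_mod_sign pos_mod_bound\<close>)
  have cg: "[x (Suc r) = x r] (mod lvl p N r)" if "x \<in> carrier (Zlim p N)" for x r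
    using Zlim_cong[OF that] by (meson le_SucI le_refl)
  have eq: "x = y" if "x \<in> carrier (Zlim p N)" "y \<in> carrier (Zlim p N)" "\<And>r. [x r = y r] (mod lvl p N r)" for x y
    using that Zlim_mod_self unfolding cong_def by (intro ext) metis
  show ?thesis
  proof (rule cringI)
    show "abelian_group (Zlim p N)"
    proof (rule abelian_groupI)
      fix x assume x: "x \<in> carrier (Zlim p N)"
      have "(\<lambda>r. (- x r) mod lvl p N r) \<in> carrier (Zlim p N)"
        by (rule mem) (use cg[OF x] cong_minus_minus_iff in blast)
      moreover have "(\<lambda>r. (- x r) mod lvl p N r) \<oplus>\<^bsub>Zlim p N\<^esub> x = \<zero>\<^bsub>Zlim p N\<^esub>"
        by (simp add: mod_simps)
      ultimately show "\<exists>y\<in>carrier (Zlim p N). y \<oplus>\<^bsub>Zlim p N\<^esub> x = \<zero>\<^bsub>Zlim p N\<^esub>" by blast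
    next
      fix x y assume "x \<in> carrier (Zlim p N)" "y \<in> carrier (Zlim p N)"
      then show "x \<oplus>\<^bsub>Zlim p N\<^esub> y \<in> carrier (Zlim p N)"
        unfolding Zlim_simps by (intro mem cong_add cg)
    next
      show "\<zero>\<^bsub>Zlim p N\<^esub> \<in> carrier (Zlim p N)" using mem[of "\<lambda>r. 0"] by simp
    next
      fix x assume x: "x \<in> carrier (Zlim p N)"
      then show "\<zero>\<^bsub>Zlim p N\<^esub> \<oplus>\<^bsub>Zlim p N\<^esub> x = x" using Zlim_mod_self[OF x] by (simp only: Zlim_simps add_0)
    qed (simp_all add: mod_simps algebra_simps)
    show "Group.comm_monoid (Zlim p N)"
    proof (rule comm_monoidI)
      fix x y assume "x \<in> carrier (Zlim p N)" "y \<in> carrier (Zlim p N)"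
      then show "x \<otimes>\<^bsub>Zlim p N\<^esub> y \<in> carrier (Zlim p N)"
        unfolding Zlim_simps by (intro mem cong_mult cg)
    next
      show "\<one>\<^bsub>Zlim p N\<^esub> \<in> carrier (Zlim p N)" unfolding Zlim_simps by (rule mem) simp
    next
      fix x assume x: "x \<in> carrier (Zlim p N)"
      then show "\<one>\<^bsub>Zlim p N\<^esub> \<otimes>\<^bsub>Zlim p N\<^esub> x = x"
        using Zlim_mod_self[OF x] by (simp only: Zlim_simps mod_mult_left_eq mult_1)
    qed (simp_all add: mod_simps algebra_simps)
  qed (simp_all add: mod_simps algebra_simps)
qed

lemma Zlim_reduceI:
  assumes "p > 0" "N > 0" "\<And>r. [f (Suc r) = f r] (mod lvl p N r)"
  shows "(\<lambda>r. f r mod lvl p N r) \<in> carrier (Zlim p N)"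
proof (rule Zlim_memI[OF assms(1,2)])
  fix r
  show "f r mod lvl p N r \<in> {0..<lvl p N r}" using lvl_pos[OF assms(1,2)] by simp
  have sd: "lvl p N r dvd lvl p N (Suc r)" for r by (rule lvl_dvd) simp
  show "[f (Suc r) mod lvl p N (Suc r) = f r mod lvl p N r] (mod lvl p N r)"
    using assms(3) by (simp only: cong_reduce[OF sd dvd_refl])
qed

lemma Zlim_eqI:
  assumes "x \<in> carrier (Zlim p N)" "y \<in> carrier (Zlim p N)" "\<And>r. [x r = y r] (mod lvl p N r)"
  shows "x = y"
  using assms Zlim_mod_self unfolding cong_def by (intro ext) metis

lemma Zlim_a_inv:
  assumes "p > 0" "N > 0" "x \<in> carrier (Zlim p N)"
  shows "\<ominus>\<^bsub>Zlim p N\<^esub> x = (\<lambda>r. (- x r) mod lvl p N r)"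
proof -
  interpret cring "Zlim p N" by (rule Zlim_cring[OF assms(1,2)])
  have "(\<lambda>r. (- x r) mod lvl p N r) \<in> carrier (Zlim p N)"
    by (rule Zlim_reduceI[OF assms(1,2)])
       (meson Zlim_cong[OF assms(3)] cong_minus_minus_iff le_SucI le_refl)
  moreover have "(\<lambda>r. (- x r) mod lvl p N r) \<oplus>\<^bsub>Zlim p N\<^esub> x = \<zero>\<^bsub>Zlim p N\<^esub>"
    by (simp add: mod_simps)
  ultimately show ?thesis using minus_equality assms(3) by blast
qed

lemma Zlim_finsum:
  assumes "p > 0" "N > 0" "finite A" "\<And>a. a \<in> A \<Longrightarrow> f a \<in> carrier (Zlim p N)"
  shows "finsum (Zlim p N) f A \<in> carrier (Zlim p N)"
    and "finsum (Zlim p N) f A r = (\<Sum>a\<in>A. f a r) mod lvl p N r"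
proof -
  interpret cring "Zlim p N" by (rule Zlim_cring[OF assms(1,2)])
  show "finsum (Zlim p N) f A \<in> carrier (Zlim p N)" using assms by (intro finsum_closed) auto
  show "finsum (Zlim p N) f A r = (\<Sum>a\<in>A. f a r) mod lvl p N r"
    using assms(3,4)
  proof (induction A)
    case empty
    then show ?case by simp
  next
    case (insert a A)
    then have "finsum (Zlim p N) f (insert a A) = f a \<oplus>\<^bsub>Zlim p N\<^esub> finsum (Zlim p N) f A"
      by (intro finsum_insert) auto
    moreover have "finsum (Zlim p N) f A r = (\<Sum>a\<in>A. f a r) mod lvl p N r" using insert by blast
    ultimately show ?case using insert(1,2) by (simp add: mod_simps)
  qed
qed

lemma Zlim_Units_inv:
  assumes "p > 0" "N > 0" "x \<in> Units (Zlim p N)"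
  shows "x \<in> carrier (Zlim p N)" "inv\<^bsub>Zlim p N\<^esub> x \<in> Units (Zlim p N)"
    "[x r * (inv\<^bsub>Zlim p N\<^esub> x) r = 1] (mod lvl p N r)"
proof -
  interpret cring "Zlim p N" by (rule Zlim_cring[OF assms(1,2)])
  show "x \<in> carrier (Zlim p N)" "inv\<^bsub>Zlim p N\<^esub> x \<in> Units (Zlim p N)" using assms(3) by auto
  have "x \<otimes>\<^bsub>Zlim p N\<^esub> inv\<^bsub>Zlim p N\<^esub> x = \<one>\<^bsub>Zlim p N\<^esub>" using assms(3) by (rule Units_r_inv)
  then show "[x r * (inv\<^bsub>Zlim p N\<^esub> x) r = 1] (mod lvl p N r)"
    by (auto simp: cong_def dest: fun_cong[of _ _ r])
qed

lemma Zlim_Units_coprime: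
  assumes "p > 0" "N > 0" "x \<in> Units (Zlim p N)"
  shows "coprime (x r) (lvl p N r)"
  using Zlim_Units_inv(3)[OF assms, of r] by (meson coprime_iff_invertible_int)

text \<open>
  Inverses modulo \<open>Np^r\<close> are unique and therefore compatible.
\<close>

lemma Zlim_UnitsI:
  assumes "p > 0" "N > 0" "x \<in> carrier (Zlim p N)" "\<And>r. coprime (x r) (lvl p N r)"
  shows "x \<in> Units (Zlim p N)"
proof -
  interpret cring "Zlim p N" by (rule Zlim_cring[OF assms(1,2)])
  have "\<forall>r. \<exists>y. [x r * y = 1] (mod lvl p N r)" using assms(4) coprime_iff_invertible_int by blast
  then obtain y where y: "\<And>r. [x r * y r = 1] (mod lvl p N r)" by metis
  have "[y (Suc r) = y r] (mod lvl p N r)" for r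
  proof -
    have "[x (Suc r) * y (Suc r) = 1] (mod lvl p N r)"
      by (rule cong_dvd_modulus[OF y lvl_dvd]) simp
    moreover have "[x (Suc r) * y (Suc r) = x r * y (Suc r)] (mod lvl p N r)"
      by (rule cong_scalar_right) (rule Zlim_cong[OF assms(3)], simp)
    ultimately have "[x r * y (Suc r) = x r * y r] (mod lvl p N r)"
      using y[of r] by (meson cong_sym cong_trans)
    then show ?thesis using assms(4) cong_mult_lcancel by blast
  qed
  then have 1: "(\<lambda>r. y r mod lvl p N r) \<in> carrier (Zlim p N)"
    by (intro Zlim_reduceI assms(1,2))
  have 2: "x \<otimes>\<^bsub>Zlim p N\<^esub> (\<lambda>r. y r mod lvl p N r) = \<one>\<^bsub>Zlim p N\<^esub>"
    using y by (simp add: cong_def mod_simps)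
  show ?thesis using assms(3) 1 2 m_comm[of x "\<lambda>r. y r mod lvl p N r"] unfolding Units_def by force
qed

text \<open>
  In this locale \<open>M r\<close> is the modulus \<open>Np^r\<close>, \<open>U r\<close> and \<open>R r\<close> are the unit residues and all residues
  modulo \<open>M r\<close>, and \<open>P m\<close> is \<open>p^m\<close>. Equalities in Z_p are mostly handled as congruences modulo all \<open>P m\<close>.
  \<open>L\<close> and \<open>Q\<close> are the sets of measures that carry the Iwasawa algebra and the completed module.
\<close>

locale tower =
  fixes p N :: nat
  assumes p_prime: "Factorial_Ring.prime p" and N_pos: "N > 0" and coprime_N_p: "coprime N p"
begin

abbreviation M where "M r \<equiv> lvl p N r"
abbreviation U where "U r \<equiv> unit_residues (lvl p N r)"

abbreviation UZ where "UZ \<equiv> Units (Zlim p N)"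
abbreviation iv where "iv a \<equiv> inv\<^bsub>Zlim p N\<^esub> a"

lemma p_pos: "p > 0" using p_prime prime_gt_0_nat by blast

lemma M_pos: "M r > 0" using p_pos N_pos by simp

lemma P_pos: "int (p ^ m) > 0" using p_pos by simp

lemma P_dvd_M: "m \<le> r \<Longrightarrow> int (p ^ m) dvd M r"
  by (metis dvd_mult int_dvd_int_iff le_imp_power_dvd)

lemma finite_U [simp]: "finite (unit_residues m)"
  by (rule finite_subset[of _ "{0..<m}"]) (auto simp: unit_residues_def)

lemma finite_residues [simp]: "finite (residues_mod m)" unfolding residues_mod_def by auto

lemma U_mod: "c \<in> U s \<Longrightarrow> r \<le> s \<Longrightarrow> c mod M r \<in> U r"
proof -
  assume "c \<in> U s" "r \<le> s"
  then have "coprime c (M r)"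
    using coprime_divisors[OF dvd_refl lvl_dvd[OF \<open>r \<le> s\<close>]] unfolding unit_residues_def by blast
  then have "coprime (c mod M r) (M r)" using M_pos[of r] by (metis coprime_mod_left_iff less_irrefl)
  then show ?thesis using M_pos[of r] by (simp add: unit_residues_def)
qed

lemma coprime_M: "coprime k (int N) \<Longrightarrow> coprime k (int p) \<Longrightarrow> coprime k (M s)"
  by (simp add: of_nat_mult of_nat_power)

lemma coprime_N_of_M: "coprime k (M s) \<Longrightarrow> coprime k (int N)"
  by (simp add: of_nat_mult)

text \<open>
  For \<open>r = 0\<close> a unit modulo \<open>N\<close> may be divisible by \<open>p\<close>; adding \<open>N\<close> once makes it prime to \<open>p\<close>.
\<close>

lemma lift_unit:
  assumes "c \<in> U r"
  shows "\<exists>x\<in>Units (Zlim p N). x r = c"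
proof -
  have c: "coprime c (M r)" "0 \<le> c" "c < M r" using assms by (auto simp: unit_residues_def)
  obtain k where k: "[k = c] (mod M r)" "coprime k (int N)" "coprime k (int p)"
  proof (cases "int p dvd c")
    case False
    then have "coprime c (int p)" using p_prime
      by (metis coprime_commute prime_imp_coprime prime_int_nat_transfer prime_nat_int_transfer)
    then show ?thesis using coprime_N_of_M[OF c(1)] that[of c] by simp
  next
    case True
    have "r = 0"
    proof (rule ccontr)
      assume "r \<noteq> 0"
      then have "int p dvd M r" by (simp add: of_nat_mult of_nat_power)
      then show False using True c(1) p_prime
        by (meson coprime_common_divisor not_prime_unit prime_nat_int_transfer)
    qed
    have "\<not> int p dvd c + int N"
    proof
      assume "int p dvd c + int N"
      then have "int p dvd int N" using True by (simp add: dvd_add_right_iff)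
      then show False using coprime_N_p p_prime
        by (metis coprime_common_divisor_nat dvd_refl int_dvd_int_iff not_prime_1)
    qed
    then have "coprime (c + int N) (int p)" using p_prime
      by (metis coprime_commute prime_imp_coprime prime_int_nat_transfer prime_nat_int_transfer)
    moreover have "coprime (c + int N) (int N)" using c(1) \<open>r = 0\<close>
      by (simp add: coprime_iff_gcd_eq_1)
    ultimately show ?thesis using that[of "c + int N"] \<open>r = 0\<close> by (simp add: cong_def)
  qed
  define x where "x = (\<lambda>s. k mod M s)"
  have x: "x \<in> carrier (Zlim p N)" unfolding x_def by (rule Zlim_reduceI[OF p_pos N_pos]) simp
  have "coprime (x s) (M s)" for s
  proof -
    have "coprime k (M s)" using k coprime_M by blast
    then show ?thesis using M_pos[of s] unfolding x_def
      by (metis coprime_mod_left_iff less_irrefl)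
  qed
  then have "x \<in> Units (Zlim p N)" by (rule Zlim_UnitsI[OF p_pos N_pos x])
  moreover have "x r = c" using k(1) c unfolding x_def cong_def by simp
  ultimately show ?thesis by blast
qed

lemma Zp_cong: "x \<in> carrier (Zp p) \<Longrightarrow> m \<le> m' \<Longrightarrow> [x m' = x m] (mod int (p ^ m))"
  using Zlim_cong[of x p 1 m m'] by simp

lemma Zp_eqI:
  "x \<in> carrier (Zp p) \<Longrightarrow> y \<in> carrier (Zp p) \<Longrightarrow> (\<And>m. [x m = y m] (mod int (p ^ m))) \<Longrightarrow> x = y"
  using Zlim_eqI[of x p 1 y] by simp

lemma Zp_reduceI:
  assumes "\<And>m. [f (Suc m) = f m] (mod int (p ^ m))"
  shows "(\<lambda>m. f m mod int (p ^ m)) \<in> carrier (Zp p)"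
  using Zlim_reduceI[of p 1 f] assms p_pos by simp

lemma Zp_finsum:
  assumes "finite A" "\<And>a. a \<in> A \<Longrightarrow> f a \<in> carrier (Zp p)"
  shows "finsum (Zp p) f A \<in> carrier (Zp p)"
    and "finsum (Zp p) f A m = (\<Sum>a\<in>A. f a m) mod int (p ^ m)"
  using Zlim_finsum[of p 1 A f] assms p_pos by simp_all

lemma Zp_cring: "cring (Zp p)" by (rule Zlim_cring) (use p_pos in auto)

end

section \<open>Quotient modules\<close>

lemma abelian_group_quot_module:
  assumes "abelian_subgroup H Q"
  shows "abelian_group (quot_module Q H)"
proof -
  interpret abelian_subgroup H Q by fact
  interpret A: comm_group "Q A_Mod H" by (rule a_factorgroup_is_comm_group)
  have eqs: "carrier (quot_module Q H) = carrier (Q A_Mod H)"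
    "(\<oplus>\<^bsub>quot_module Q H\<^esub>) = (\<otimes>\<^bsub>Q A_Mod H\<^esub>)" "\<zero>\<^bsub>quot_module Q H\<^esub> = \<one>\<^bsub>Q A_Mod H\<^esub>"
    by (simp_all add: quot_module_def A_FactGroup_def FactGroup_def A_RCOSETS_def set_add_def)
  show ?thesis
    by (rule abelian_groupI, unfold eqs)
       (metis A.m_closed A.one_closed A.m_assoc A.m_comm A.l_one A.l_inv_ex)+
qed

lemma quot_module_carrier:
  "carrier (quot_module Q H) = (\<lambda>x. H +>\<^bsub>Q\<^esub> x) ` carrier Q"
  by (auto simp: quot_module_def A_RCOSETS_defs a_r_coset_def)

lemma quot_module_zero: "\<zero>\<^bsub>quot_module Q H\<^esub> = H"
  by (simp add: quot_module_def)

lemma quot_module_add: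
  assumes "abelian_subgroup H Q" "x \<in> carrier Q" "y \<in> carrier Q"
  shows "(H +>\<^bsub>Q\<^esub> x) \<oplus>\<^bsub>quot_module Q H\<^esub> (H +>\<^bsub>Q\<^esub> y) = H +>\<^bsub>Q\<^esub> (x \<oplus>\<^bsub>Q\<^esub> y)"
  using abelian_subgroup.a_rcos_sum[OF assms] by (simp add: quot_module_def)

lemma quot_module_smult:
  assumes "abelian_subgroup H Q" "x \<in> carrier Q"
    and "\<And>y. y \<in> carrier Q \<Longrightarrow> H +>\<^bsub>Q\<^esub> y = H +>\<^bsub>Q\<^esub> x \<Longrightarrow> H +>\<^bsub>Q\<^esub> (c \<odot>\<^bsub>Q\<^esub> y) = H +>\<^bsub>Q\<^esub> (c \<odot>\<^bsub>Q\<^esub> x)"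
  shows "c \<odot>\<^bsub>quot_module Q H\<^esub> (H +>\<^bsub>Q\<^esub> x) = H +>\<^bsub>Q\<^esub> (c \<odot>\<^bsub>Q\<^esub> x)"
proof -
  interpret abelian_subgroup H Q by fact
  have "x \<in> H +>\<^bsub>Q\<^esub> x" using assms(2) a_rcos_self by blast
  moreover have "H +>\<^bsub>Q\<^esub> (c \<odot>\<^bsub>Q\<^esub> y) = H +>\<^bsub>Q\<^esub> (c \<odot>\<^bsub>Q\<^esub> x)" if "y \<in> H +>\<^bsub>Q\<^esub> x" for y
    using that assms(2) a_elemrcos_carrier a_repr_independence' by (intro assms(3)) (auto simp: a_subgroup)
  ultimately have "(\<Union>y\<in>H +>\<^bsub>Q\<^esub> x. H +>\<^bsub>Q\<^esub> (c \<odot>\<^bsub>Q\<^esub> y)) = H +>\<^bsub>Q\<^esub> (c \<odot>\<^bsub>Q\<^esub> x)"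
    by (intro UN_constant_eq ballI)
  then show ?thesis by (simp add: quot_module_def)
qed

lemma quot_module_class_eq:
  assumes "abelian_subgroup H Q" "x \<in> carrier Q" "y \<in> carrier Q"
  shows "H +>\<^bsub>Q\<^esub> x = H +>\<^bsub>Q\<^esub> y \<longleftrightarrow> (\<exists>h\<in>H. x = h \<oplus>\<^bsub>Q\<^esub> y)"
proof -
  interpret abelian_subgroup H Q by fact
  have "H +>\<^bsub>Q\<^esub> x = H +>\<^bsub>Q\<^esub> y \<longleftrightarrow> x \<in> H +>\<^bsub>Q\<^esub> y"
    using assms(2,3) a_rcos_self a_repr_independence' by (metis a_subgroup)
  then show ?thesis by (auto simp: a_r_coset_def')
qed

section \<open>Measures\<close>

context tower
begin

abbreviation P where "P m \<equiv> int (p ^ m)"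

abbreviation R where "R r \<equiv> residues_mod (M r)"

lemma R_mod: "c mod M r \<in> R r"
  using M_pos by (simp add: residues_mod_def)

lemma U_subset_R: "U r \<subseteq> R r" by (auto simp: unit_residues_def residues_mod_def)

lemma Zp_zero_mem: "(\<lambda>r. 0) \<in> carrier (Zp p)"
  using Zp_reduceI[of "\<lambda>_. 0"] by simp

lemma Zp_simps [simp]:
  "x \<otimes>\<^bsub>Zp p\<^esub> y = (\<lambda>r. (x r * y r) mod P r)"
  "x \<oplus>\<^bsub>Zp p\<^esub> y = (\<lambda>r. (x r + y r) mod P r)"
  "\<zero>\<^bsub>Zp p\<^esub> = (\<lambda>r. 0)"
  "\<one>\<^bsub>Zp p\<^esub> = (\<lambda>r. 1 mod P r)"
  by simp_all

lemma Zp_add_mem: "x \<in> carrier (Zp p) \<Longrightarrow> y \<in> carrier (Zp p) \<Longrightarrow> (\<lambda>r. (x r + y r) mod P r) \<in> carrier (Zp p)"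
  using cring.cring_simprules(1)[OF Zp_cring, of x y] by simp

lemma Zp_mult_mem: "x \<in> carrier (Zp p) \<Longrightarrow> y \<in> carrier (Zp p) \<Longrightarrow> (\<lambda>r. (x r * y r) mod P r) \<in> carrier (Zp p)"
  using cring.cring_simprules(5)[OF Zp_cring, of x y] by simp

lemma Zp_one_mem: "(\<lambda>r. 1 mod P r) \<in> carrier (Zp p)"
  using cring.cring_simprules(6)[OF Zp_cring] by simp

lemma Zp_uminus_mem: "x \<in> carrier (Zp p) \<Longrightarrow> (\<lambda>r. (- x r) mod P r) \<in> carrier (Zp p)"
  using cring.cring_simprules(3)[OF Zp_cring, of x] Zlim_a_inv[of p 1 x] p_pos by simp

lemma Zp_mod_self [simp]: "x \<in> carrier (Zp p) \<Longrightarrow> x m mod P m = x m"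
  using Zlim_mod_self[of x p 1 m] by simp

lemma Zp_cong_eq: "x \<in> carrier (Zp p) \<Longrightarrow> y \<in> carrier (Zp p) \<Longrightarrow> [x m = y m] (mod P m) \<Longrightarrow> x m = y m"
  unfolding cong_def using Zp_mod_self by metis

lemma measures_on_iff:
  assumes "\<And>r. finite (S r)"
  shows "\<mu> \<in> measures_on p N S \<longleftrightarrow> (\<forall>r.
    (\<forall>i\<in>S r. \<mu> r i \<in> carrier (Zp p)) \<and> (\<forall>i. i \<notin> S r \<longrightarrow> \<mu> r i = (\<lambda>m. 0)) \<and>
    (\<forall>j\<in>S r. \<forall>m. [\<mu> r j m = (\<Sum>i\<in>{i\<in>S (Suc r). i mod M r = j}. \<mu> (Suc r) i m)] (mod P m)))"
    (is "?l \<longleftrightarrow> ?r")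
proof -
  have "\<mu> r j = (\<Oplus>\<^bsub>Zp p\<^esub>i\<in>{i \<in> S (Suc r). i mod M r = j}. \<mu> (Suc r) i) \<longleftrightarrow>
     (\<forall>m. [\<mu> r j m = (\<Sum>i\<in>{i\<in>S (Suc r). i mod M r = j}. \<mu> (Suc r) i m)] (mod P m))"
    if "\<forall>i\<in>S (Suc r). \<mu> (Suc r) i \<in> carrier (Zp p)" "\<mu> r j \<in> carrier (Zp p)" for r j
  proof -
    have fin: "finite {i \<in> S (Suc r). i mod M r = j}" using assms by simp
    have mem: "\<And>i. i \<in> {i \<in> S (Suc r). i mod M r = j} \<Longrightarrow> \<mu> (Suc r) i \<in> carrier (Zp p)" using that by auto
    show ?thesis
      using Zp_finsum(1)[OF fin mem] Zp_finsum(2)[OF fin mem] Zp_eqI[OF that(2)]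
      by (auto simp: cong_def that(2))
  qed
  note eq = this
  define A where "A \<longleftrightarrow> (\<forall>r. (\<forall>i\<in>S r. \<mu> r i \<in> carrier (Zp p)) \<and> (\<forall>i. i \<notin> S r \<longrightarrow> \<mu> r i = (\<lambda>m. 0)))"
  have "\<mu> \<in> measures_on p N S \<longleftrightarrow> A \<and> (\<forall>r. \<forall>j\<in>S r.
      \<mu> r j = (\<Oplus>\<^bsub>Zp p\<^esub>i\<in>{i \<in> S (Suc r). i mod M r = j}. \<mu> (Suc r) i))"
    unfolding measures_on_def free_Zp_def mem_Collect_eq A_def Zp_simps by meson
  also have "\<dots> \<longleftrightarrow> A \<and> (\<forall>r. \<forall>j\<in>S r. \<forall>m.
      [\<mu> r j m = (\<Sum>i\<in>{i\<in>S (Suc r). i mod M r = j}. \<mu> (Suc r) i m)] (mod P m))"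
  proof (cases A)
    case True
    then have mem: "\<And>r i. i \<in> S r \<Longrightarrow> \<mu> r i \<in> carrier (Zp p)" by (simp add: A_def)
    have "\<mu> r j = (\<Oplus>\<^bsub>Zp p\<^esub>i\<in>{i \<in> S (Suc r). i mod M r = j}. \<mu> (Suc r) i) \<longleftrightarrow>
      (\<forall>m. [\<mu> r j m = (\<Sum>i\<in>{i\<in>S (Suc r). i mod M r = j}. \<mu> (Suc r) i m)] (mod P m))"
      if "j \<in> S r" for r j
      by (rule eq) (use mem that in auto)
    then show ?thesis by meson
  qed simp
  also have "\<dots> \<longleftrightarrow> ?r" unfolding A_def by meson
  finally show ?thesis .
qed

lemma measures_on_mem: "(\<And>r. finite (S r)) \<Longrightarrow> \<mu> \<in> measures_on p N S \<Longrightarrow> \<mu> r i \<in> carrier (Zp p)"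
  using Zp_zero_mem by (cases "i \<in> S r") (simp_all add: measures_on_iff)

lemma measures_on_outside: "(\<And>r. finite (S r)) \<Longrightarrow> \<mu> \<in> measures_on p N S \<Longrightarrow> i \<notin> S r \<Longrightarrow> \<mu> r i = (\<lambda>m. 0)"
  by (simp add: measures_on_iff)

lemma measures_on_sum:
  "(\<And>r. finite (S r)) \<Longrightarrow> \<mu> \<in> measures_on p N S \<Longrightarrow> j \<in> S r \<Longrightarrow>
   [\<mu> r j m = (\<Sum>i\<in>{i\<in>S (Suc r). i mod M r = j}. \<mu> (Suc r) i m)] (mod P m)"
  by (simp add: measures_on_iff)

text \<open>
  Integrating a function that is constant on residue classes modulo \<open>Np^r\<close> gives the same result at
  every finer level.
\<close>

lemma measures_on_push:
  assumes fin: "\<And>r. finite (S r)" and sub: "\<And>r. S r \<subseteq> R r" and cl: "\<And>r c. c \<in> S (Suc r) \<Longrightarrow> c mod M r \<in> S r"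
    and \<mu>: "\<mu> \<in> measures_on p N S" and "r \<le> s"
    and GH: "\<And>c. c \<in> S s \<Longrightarrow> [G c = H (c mod M r)] (mod P m)"
  shows "[(\<Sum>c\<in>S s. \<mu> s c m * G c) = (\<Sum>b\<in>S r. \<mu> r b m * H b)] (mod P m)"
proof -
  have "[(\<Sum>c\<in>S s. \<mu> s c m * G c) = (\<Sum>c\<in>S s. \<mu> s c m * H (c mod M r))] (mod P m)"
    by (intro cong_sum cong_mult cong_refl GH)
  also have "[(\<Sum>c\<in>S s. \<mu> s c m * H (c mod M r)) = (\<Sum>b\<in>S r. \<mu> r b m * H b)] (mod P m)"
    using \<open>r \<le> s\<close>
  proof (induction s rule: dec_induct)
    case base
    have "c mod M r = c" if "c \<in> S r" for c using sub that by (fastforce simp: residues_mod_def)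
    then show ?case by (simp cong: sum.cong)
  next
    case (step s)
    have "(\<Sum>c\<in>S (Suc s). \<mu> (Suc s) c m * H (c mod M r)) =
      (\<Sum>b\<in>S s. \<Sum>c\<in>{c\<in>S (Suc s). c mod M s = b}. \<mu> (Suc s) c m * H (c mod M r))"
      by (rule sum.group[symmetric]) (use fin cl in auto)
    also have "\<dots> = (\<Sum>b\<in>S s. (\<Sum>c\<in>{c\<in>S (Suc s). c mod M s = b}. \<mu> (Suc s) c m) * H (b mod M r))"
      unfolding sum_distrib_right using lvl_dvd[OF step(1)]
      by (intro sum.cong refl) (auto simp: mod_mod_cancel)
    also have "[\<dots> = (\<Sum>b\<in>S s. \<mu> s b m * H (b mod M r))] (mod P m)"
      by (intro cong_sum cong_mult cong_refl cong_sym[OF measures_on_sum] fin \<mu>)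
    finally show ?case using step.IH cong_trans by blast
  qed
  finally (cong_trans) show ?thesis .
qed

text \<open>
  Convolutions are computed modulo \<open>p^m\<close>, as double sums with the condition on the product as a
  summand, so that the order of summation can be exchanged freely.
\<close>

lemma conv_mem_eq:
  assumes "finite S" "finite T" "\<And>i. i \<in> S \<Longrightarrow> f i \<in> carrier (Zp p)" "\<And>j. j \<in> T \<Longrightarrow> g j \<in> carrier (Zp p)"
  shows "conv p n S T f g k \<in> carrier (Zp p)"
    and "conv p n S T f g k m = (\<Sum>i\<in>S. \<Sum>j\<in>T. if i * j mod n = k then f i m * g j m else 0) mod P m"
proof -
  let ?X = "{(i, j). i \<in> S \<and> j \<in> T \<and> i * j mod n = k}"
  have X: "?X = {x \<in> S \<times> T. fst x * snd x mod n = k}" by auto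
  have fin: "finite ?X" unfolding X using assms(1,2) by simp
  have mem: "(case x of (i, j) \<Rightarrow> f i \<otimes>\<^bsub>Zp p\<^esub> g j) \<in> carrier (Zp p)" if "x \<in> ?X" for x
    using that assms(3,4) Zp_mult_mem by auto
  show "conv p n S T f g k \<in> carrier (Zp p)" unfolding conv_def by (rule Zp_finsum(1)[OF fin mem])
  have "conv p n S T f g k m = (\<Sum>x\<in>?X. (case x of (i, j) \<Rightarrow> f i \<otimes>\<^bsub>Zp p\<^esub> g j) m) mod P m"
    unfolding conv_def by (rule Zp_finsum(2)[OF fin mem])
  also have "(\<Sum>x\<in>?X. (case x of (i, j) \<Rightarrow> f i \<otimes>\<^bsub>Zp p\<^esub> g j) m) = (\<Sum>x\<in>?X. (f (fst x) m * g (snd x) m) mod P m)"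
    by (intro sum.cong) auto
  also have "\<dots> mod P m = (\<Sum>x\<in>?X. f (fst x) m * g (snd x) m) mod P m" by (rule mod_sum_eq)
  also have "(\<Sum>x\<in>?X. f (fst x) m * g (snd x) m) =
      (\<Sum>x\<in>S\<times>T. if fst x * snd x mod n = k then f (fst x) m * g (snd x) m else 0)"
    unfolding X using assms(1,2) by (intro sum.inter_filter) simp
  also have "\<dots> = (\<Sum>i\<in>S. \<Sum>j\<in>T. if i * j mod n = k then f i m * g j m else 0)"
    by (simp add: sum.cartesian_product case_prod_unfold)
  finally show "conv p n S T f g k m = (\<Sum>i\<in>S. \<Sum>j\<in>T. if i * j mod n = k then f i m * g j m else 0) mod P m" .
qed

lemma free_Zp_mem: "f \<in> free_Zp p S \<Longrightarrow> f i \<in> carrier (Zp p)"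
  using Zp_zero_mem by (cases "i \<in> S") (auto simp: free_Zp_def)

lemma scaled_single_mem: "c \<in> carrier (Zp p) \<Longrightarrow> i \<in> S \<Longrightarrow> scaled_single p c i \<in> free_Zp p S"
  using Zp_zero_mem by (auto simp: free_Zp_def scaled_single_def)

lemma scaled_single_apply: "scaled_single p c i j m = (if j = i then c m else 0)"
  by (simp add: scaled_single_def)

section \<open>The star module at finite level\<close>

lemma fin_residue_module_simps:
  "carrier (fin_residue_module p n) = free_Zp p (residues_mod n)"
  "f \<oplus>\<^bsub>fin_residue_module p n\<^esub> g = (\<lambda>i m. (f i m + g i m) mod P m)"
  "\<zero>\<^bsub>fin_residue_module p n\<^esub> = (\<lambda>i m. 0)"
  "l \<odot>\<^bsub>fin_residue_module p n\<^esub> f = conv p n (unit_residues n) (residues_mod n) l f"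
  by (simp_all add: fin_residue_module_def)

lemma abelian_group_fin_residue_module: "abelian_group (fin_residue_module p n)"
proof (rule abelian_groupI, unfold fin_residue_module_simps)
  fix x y assume "x \<in> free_Zp p (residues_mod n)" "y \<in> free_Zp p (residues_mod n)"
  then show "(\<lambda>i m. (x i m + y i m) mod P m) \<in> free_Zp p (residues_mod n)"
    by (auto simp: free_Zp_def intro: Zp_add_mem)
next
  show "(\<lambda>i m. 0) \<in> free_Zp p (residues_mod n)" using Zp_zero_mem by (auto simp: free_Zp_def)
next
  fix x assume x: "x \<in> free_Zp p (residues_mod n)"
  then show "(\<lambda>i m. (0 + x i m) mod P m) = x" using free_Zp_mem[OF x] by simp
  have "(\<lambda>i m. (- x i m) mod P m) \<in> free_Zp p (residues_mod n)"
    using x by (auto simp: free_Zp_def intro: Zp_uminus_mem)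
  then show "\<exists>y\<in>free_Zp p (residues_mod n). (\<lambda>i m. (y i m + x i m) mod P m) = (\<lambda>i m. 0)"
    by (rule bexI[rotated]) (simp add: mod_simps)
qed (simp_all add: mod_simps algebra_simps)

lemma conv_scaled_zero:
  assumes "n > 0" "c \<in> carrier (Zp p)" "\<And>a. a \<in> unit_residues n \<Longrightarrow> l a \<in> carrier (Zp p)"
  shows "conv p n (unit_residues n) (residues_mod n) l (scaled_single p c 0)
     = scaled_single p (conv p n (unit_residues n) (residues_mod n) l (scaled_single p c 0) 0) 0"
proof (intro ext)
  fix k m
  let ?v = "conv p n (unit_residues n) (residues_mod n) l (scaled_single p c 0)"
  have "?v k m = 0" if "k \<noteq> 0"
  proof -
    have "?v k m = (\<Sum>i\<in>unit_residues n. \<Sum>j\<in>residues_mod n.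
        if i * j mod n = k then l i m * scaled_single p c 0 j m else 0) mod P m"
      by (rule conv_mem_eq(2)) (use assms Zp_zero_mem in \<open>auto simp: scaled_single_def\<close>)
    also have "(\<Sum>i\<in>unit_residues n. \<Sum>j\<in>residues_mod n.
        if i * j mod n = k then l i m * scaled_single p c 0 j m else 0) = 0"
      by (intro sum.neutral ballI) (use that in \<open>auto simp: scaled_single_apply\<close>)
    finally show ?thesis by simp
  qed
  then show "?v k m = scaled_single p (?v 0) 0 k m" by (simp add: scaled_single_apply)
qed

lemma conv_scaled_one:
  assumes "n > 0" "c \<in> carrier (Zp p)" "f \<in> free_Zp p (residues_mod n)"
  shows "conv p n (unit_residues n) (residues_mod n) (scaled_single p c (1 mod n)) f
     = (\<lambda>k m. (c m * f k m) mod P m)"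
proof (intro ext)
  fix k m
  have 1: "1 mod n \<in> unit_residues n" using assms(1)
    by (simp add: unit_residues_def)
  have k0: "f k = (\<lambda>m. 0)" if "k \<notin> residues_mod n" using assms(3) that by (simp add: free_Zp_def)
  have "conv p n (unit_residues n) (residues_mod n) (scaled_single p c (1 mod n)) f k m =
    (\<Sum>i\<in>unit_residues n. \<Sum>j\<in>residues_mod n. if i * j mod n = k then scaled_single p c (1 mod n) i m * f j m else 0) mod P m"
    by (rule conv_mem_eq(2)) (use assms Zp_zero_mem free_Zp_mem[OF assms(3)] in \<open>auto simp: scaled_single_def\<close>)
  also have "(\<Sum>i\<in>unit_residues n. \<Sum>j\<in>residues_mod n. if i * j mod n = k then scaled_single p c (1 mod n) i m * f j m else 0)
    = (\<Sum>i\<in>unit_residues n. if i = 1 mod n then (\<Sum>j\<in>residues_mod n. if j = k then c m * f j m else 0) else 0)"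
    by (intro sum.cong refl)
       (auto simp: scaled_single_apply mod_simps residues_mod_def intro!: sum.cong sum.neutral)
  also have "\<dots> = c m * f k m" using 1 k0 by (simp add: sum.delta)
  finally show "conv p n (unit_residues n) (residues_mod n) (scaled_single p c (1 mod n)) f k m = (c m * f k m) mod P m" .
qed

text \<open>
  Multiplication by a unit residue fixes the class \<open>0\<close>, so that the submodule generated by \<open>[0]\<close> is just
  the Z_p-line through \<open>[0]\<close>; consequently a class in the star module is a function on the nonzero
  residues.
\<close>

lemma submodule_scaled_zero:
  assumes "n > 0"
  shows "submodule {scaled_single p c 0 | c. c \<in> carrier (Zp p)} (fin_group_ring p n) (fin_residue_module p n)"
    (is "submodule ?X _ _")
proof -
  have 0: "0 \<in> residues_mod n" using assms by (simp add: residues_mod_def)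
  interpret Q: abelian_group "fin_residue_module p n" by (rule abelian_group_fin_residue_module)
  have "subgroup ?X (add_monoid (fin_residue_module p n))"
  proof (rule Q.add.subgroupI)
    show "?X \<subseteq> carrier (fin_residue_module p n)"
      using 0 by (auto simp: fin_residue_module_simps intro: scaled_single_mem)
    show "?X \<noteq> {}" using Zp_zero_mem by blast
    fix x assume "x \<in> ?X"
    then obtain c where c: "c \<in> carrier (Zp p)" "x = scaled_single p c 0" by blast
    let ?y = "scaled_single p (\<lambda>m. (- c m) mod P m) 0"
    have "x \<in> free_Zp p (residues_mod n)" "?y \<in> free_Zp p (residues_mod n)"
      unfolding c(2) using 0 c(1) Zp_uminus_mem[OF c(1)] by (intro scaled_single_mem; simp)+
    moreover have "?y \<oplus>\<^bsub>fin_residue_module p n\<^esub> x = \<zero>\<^bsub>fin_residue_module p n\<^esub>"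
      by (simp add: c fin_residue_module_simps scaled_single_apply fun_eq_iff mod_simps)
    ultimately have "\<ominus>\<^bsub>fin_residue_module p n\<^esub> x = ?y"
      by (intro Q.minus_equality) (simp_all add: fin_residue_module_simps)
    then show "\<ominus>\<^bsub>fin_residue_module p n\<^esub> x \<in> ?X" using Zp_uminus_mem[OF c(1)] by blast
    fix y assume "y \<in> ?X"
    then obtain d where d: "d \<in> carrier (Zp p)" "y = scaled_single p d 0" by blast
    have "x \<oplus>\<^bsub>fin_residue_module p n\<^esub> y = scaled_single p (\<lambda>m. (c m + d m) mod P m) 0"
      by (simp add: c d fin_residue_module_simps scaled_single_apply fun_eq_iff)
    then show "x \<oplus>\<^bsub>fin_residue_module p n\<^esub> y \<in> ?X" using Zp_add_mem[OF c(1) d(1)] by blast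
  qed
  moreover have "l \<odot>\<^bsub>fin_residue_module p n\<^esub> x \<in> ?X" if lx: "l \<in> carrier (fin_group_ring p n)" "x \<in> ?X" for l x
  proof -
    obtain c where c: "c \<in> carrier (Zp p)" "x = scaled_single p c 0" using lx(2) by blast
    have l: "\<And>a. l a \<in> carrier (Zp p)" using lx(1) free_Zp_mem by (simp add: fin_group_ring_def)
    have "conv p n (unit_residues n) (residues_mod n) l (scaled_single p c 0) 0 \<in> carrier (Zp p)"
      by (rule conv_mem_eq(1)) (use l c Zp_zero_mem in \<open>auto simp: scaled_single_def\<close>)
    then show ?thesis using conv_scaled_zero[OF assms c(1), of l] l
      unfolding c(2) fin_residue_module_simps by blast
  qed
  ultimately show ?thesis
    by (simp add: submodule_def submodule_axioms_def)
qed

lemma fin_star_kernel_eq: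
  assumes "n > 0"
  shows "fin_star_kernel p n = {scaled_single p c 0 | c. c \<in> carrier (Zp p)}" (is "_ = ?X")
proof
  have 0: "0 \<in> residues_mod n" using assms by (simp add: residues_mod_def)
  have "submodule ?X (fin_group_ring p n) (fin_residue_module p n)"
    by (rule submodule_scaled_zero[OF assms])
  moreover have "single p 0 \<in> ?X" using Zp_one_mem by auto
  ultimately show "fin_star_kernel p n \<subseteq> ?X" unfolding fin_star_kernel_def submodule_gen_def by blast
  show "?X \<subseteq> fin_star_kernel p n"
    unfolding fin_star_kernel_def submodule_gen_def
  proof safe
    fix c H assume c: "c \<in> carrier (Zp p)" and H: "submodule H (fin_group_ring p n) (fin_residue_module p n)" "{single p 0} \<subseteq> H"
    have 1: "1 mod n \<in> unit_residues n" using assms(1)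
      by (simp add: unit_residues_def)
    have "scaled_single p c (1 mod n) \<odot>\<^bsub>fin_residue_module p n\<^esub> single p 0 \<in> H"
      by (rule submodule.smult_closed[OF H(1)]) (use H(2) c 1 in \<open>auto simp: fin_group_ring_def intro: scaled_single_mem\<close>)
    moreover have "single p 0 \<in> free_Zp p (residues_mod n)" using 0 Zp_one_mem by (intro scaled_single_mem) auto
    moreover have "(\<lambda>k m. (c m * single p 0 k m) mod P m) = scaled_single p c 0"
      using c by (auto simp: fun_eq_iff scaled_single_apply mod_simps)
    ultimately show "scaled_single p c 0 \<in> H"
      using conv_scaled_one[OF assms c, of "single p 0"] by (simp only: fin_residue_module_simps)
  qed
qed

lemma fin_star_kernel_subgroup:
  assumes "n > 0"
  shows "abelian_subgroup (fin_star_kernel p n) (fin_residue_module p n)"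
proof (rule abelian_subgroupI3)
  show "abelian_group (fin_residue_module p n)" by (rule abelian_group_fin_residue_module)
  show "additive_subgroup (fin_star_kernel p n) (fin_residue_module p n)"
    using submodule_scaled_zero[OF assms] unfolding fin_star_kernel_eq[OF assms]
    by (simp add: submodule_def additive_subgroup_def)
qed

abbreviation fin_cls where "fin_cls n f \<equiv> fin_star_kernel p n +>\<^bsub>fin_residue_module p n\<^esub> f"

lemma fin_cls_eq_iff:
  assumes "n > 0" "f \<in> free_Zp p (residues_mod n)" "g \<in> free_Zp p (residues_mod n)"
  shows "fin_cls n f = fin_cls n g \<longleftrightarrow> (\<forall>i. i \<noteq> 0 \<longrightarrow> f i = g i)"
proof -
  have "fin_cls n f = fin_cls n g \<longleftrightarrow> (\<exists>h\<in>fin_star_kernel p n. f = h \<oplus>\<^bsub>fin_residue_module p n\<^esub> g)"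
    by (rule quot_module_class_eq[OF fin_star_kernel_subgroup]) (use assms in \<open>auto simp: fin_residue_module_simps\<close>)
  also have "\<dots> \<longleftrightarrow> (\<exists>c\<in>carrier (Zp p). f = (\<lambda>i m. (scaled_single p c 0 i m + g i m) mod P m))"
    unfolding fin_star_kernel_eq[OF assms(1)] fin_residue_module_simps by auto
  also have "\<dots> \<longleftrightarrow> (\<forall>i. i \<noteq> 0 \<longrightarrow> f i = g i)"
  proof safe
    fix c i assume "f = (\<lambda>i m. (scaled_single p c 0 i m + g i m) mod P m)" "(i::int) \<noteq> 0"
    then show "(\<lambda>m. (scaled_single p c 0 i m + g i m) mod P m) = g i"
      using free_Zp_mem[OF assms(3), of i] by (simp add: scaled_single_apply)
  next
    assume eq: "\<forall>i. i \<noteq> 0 \<longrightarrow> f i = g i"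
    let ?c = "\<lambda>m. (f 0 m + (- g 0 m) mod P m) mod P m"
    have c: "?c \<in> carrier (Zp p)"
      by (intro Zp_add_mem[of _ "\<lambda>m. (- g 0 m) mod P m"] Zp_uminus_mem free_Zp_mem[OF assms(2)] free_Zp_mem[OF assms(3)])
    have "f i m = (scaled_single p ?c 0 i m + g i m) mod P m" for i m
      using eq free_Zp_mem[OF assms(3), of i] free_Zp_mem[OF assms(2), of i]
      by (cases "i = 0") (simp_all add: scaled_single_apply mod_simps)
    then show "\<exists>c\<in>carrier (Zp p). f = (\<lambda>i m. (scaled_single p c 0 i m + g i m) mod P m)"
      using c by blast
  qed
  finally show ?thesis .
qed

lemma fin_star_Zp_carrier:
  "carrier (fin_star_Zp p n) = fin_cls n ` free_Zp p (residues_mod n)"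
  by (simp add: fin_star_Zp_def restrict_scalars_def fin_star_def quot_module_carrier fin_residue_module_simps)

lemma fin_star_Zp_add:
  assumes "n > 0" "f \<in> free_Zp p (residues_mod n)" "g \<in> free_Zp p (residues_mod n)"
  shows "fin_cls n f \<oplus>\<^bsub>fin_star_Zp p n\<^esub> fin_cls n g = fin_cls n (\<lambda>i m. (f i m + g i m) mod P m)"
  using quot_module_add[OF fin_star_kernel_subgroup[OF assms(1)], of f g] assms
  by (simp add: fin_star_Zp_def restrict_scalars_def fin_star_def fin_residue_module_simps)

lemma fin_star_Zp_smult:
  assumes "n > 0" "f \<in> free_Zp p (residues_mod n)" "c \<in> carrier (Zp p)"
  shows "c \<odot>\<^bsub>fin_star_Zp p n\<^esub> fin_cls n f = fin_cls n (\<lambda>i m. (c m * f i m) mod P m)"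
proof -
  have mem: "(\<lambda>i m. (c m * g i m) mod P m) \<in> free_Zp p (residues_mod n)"
    if "g \<in> free_Zp p (residues_mod n)" for g
    using that Zp_mult_mem[OF assms(3)] by (auto simp: free_Zp_def)
  have "scaled_single p c (1 mod n) \<odot>\<^bsub>quot_module (fin_residue_module p n) (fin_star_kernel p n)\<^esub> fin_cls n f
    = fin_cls n (scaled_single p c (1 mod n) \<odot>\<^bsub>fin_residue_module p n\<^esub> f)"
  proof (rule quot_module_smult[OF fin_star_kernel_subgroup[OF assms(1)]])
    show "f \<in> carrier (fin_residue_module p n)" using assms by (simp add: fin_residue_module_simps)
    fix y assume y: "y \<in> carrier (fin_residue_module p n)" "fin_cls n y = fin_cls n f"
    then have "\<forall>i. i \<noteq> 0 \<longrightarrow> y i = f i" using fin_cls_eq_iff assms by (simp add: fin_residue_module_simps)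
    then show "fin_cls n (scaled_single p c (1 mod n) \<odot>\<^bsub>fin_residue_module p n\<^esub> y)
      = fin_cls n (scaled_single p c (1 mod n) \<odot>\<^bsub>fin_residue_module p n\<^esub> f)"
      using y(1) assms mem by (simp add: fin_residue_module_simps conv_scaled_one fin_cls_eq_iff)
  qed
  then show ?thesis
    using assms by (simp add: fin_star_Zp_def restrict_scalars_def fin_star_def fin_residue_module_simps conv_scaled_one)
qed

lemma abelian_group_fin_star: "n > 0 \<Longrightarrow> abelian_group (fin_star p n)"
  unfolding fin_star_def by (intro abelian_group_quot_module fin_star_kernel_subgroup)

section \<open>The Iwasawa algebra and its star module\<close>

abbreviation L where "L \<equiv> measures_on p N U"
abbreviation Q where "Q \<equiv> measures_on p N R"

lemma fin_UR: "finite (U r)" "finite (R r)" by simp_all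

lemma L_mem: "l \<in> L \<Longrightarrow> l r i \<in> carrier (Zp p)" by (rule measures_on_mem) auto
lemma Q_mem: "\<mu> \<in> Q \<Longrightarrow> \<mu> r i \<in> carrier (Zp p)" by (rule measures_on_mem) auto
lemma Q_free: "\<mu> \<in> Q \<Longrightarrow> \<mu> r \<in> free_Zp p (R r)" by (simp add: measures_on_def)

lemma L_push:
  assumes "l \<in> L" "r \<le> s" "\<And>c. c \<in> U s \<Longrightarrow> [G c = H (c mod M r)] (mod P m)"
  shows "[(\<Sum>c\<in>U s. l s c m * G c) = (\<Sum>b\<in>U r. l r b m * H b)] (mod P m)"
proof (rule measures_on_push[where S = U])
  show "c mod M r \<in> U r" if "c \<in> U (Suc r)" for r c by (rule U_mod[OF that]) simp
qed (use assms U_subset_R in simp_all)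

lemma Q_push:
  assumes "l \<in> Q" "r \<le> s" "\<And>c. c \<in> R s \<Longrightarrow> [G c = H (c mod M r)] (mod P m)"
  shows "[(\<Sum>c\<in>R s. l s c m * G c) = (\<Sum>b\<in>R r. l r b m * H b)] (mod P m)"
  by (rule measures_on_push[where S = R]) (use assms R_mod in simp_all)

lemma conv_apply:
  assumes "l \<in> L" "\<mu> \<in> Q"
  shows "conv p (M r) (U r) (R r) (l r) (\<mu> r) k m
    = (\<Sum>a\<in>U r. l r a m * (\<Sum>j\<in>R r. \<mu> r j m * of_bool (a * j mod M r = k))) mod P m"
proof -
  have "conv p (M r) (U r) (R r) (l r) (\<mu> r) k m =
    (\<Sum>a\<in>U r. \<Sum>j\<in>R r. if a * j mod M r = k then l r a m * \<mu> r j m else 0) mod P m"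
    by (rule conv_mem_eq(2)) (use L_mem[OF assms(1)] Q_mem[OF assms(2)] in auto)
  also have "(\<Sum>a\<in>U r. \<Sum>j\<in>R r. if a * j mod M r = k then l r a m * \<mu> r j m else 0)
     = (\<Sum>a\<in>U r. l r a m * (\<Sum>j\<in>R r. \<mu> r j m * of_bool (a * j mod M r = k)))"
    unfolding sum_distrib_left by (intro sum.cong refl) simp
  finally show ?thesis .
qed

text \<open>
  Both factors may be pushed to level \<open>r + 1\<close>, and the residue of a product only depends on the
  residues of the factors.
\<close>

lemma conv_mem_Q:
  assumes l: "l \<in> L" and \<mu>: "\<mu> \<in> Q"
  shows "(\<lambda>r. conv p (M r) (U r) (R r) (l r) (\<mu> r)) \<in> Q"
  unfolding measures_on_iff[OF fin_UR(2)]
proof (intro allI conjI ballI impI)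
  fix r k
  show "conv p (M r) (U r) (R r) (l r) (\<mu> r) k \<in> carrier (Zp p)"
    by (rule conv_mem_eq(1)) (use L_mem[OF l] Q_mem[OF \<mu>] in auto)
next
  fix r k assume "k \<notin> R r"
  then have "a * j mod M r \<noteq> k" for a j using R_mod by blast
  then show "conv p (M r) (U r) (R r) (l r) (\<mu> r) k = (\<lambda>m. 0)"
    by (intro ext, subst conv_apply[OF assms]) simp
next
  fix r k m assume k: "k \<in> R r"
  let ?s = "Suc r"
  let ?X = "{k' \<in> R ?s. k' mod M r = k}"
  have "[(\<Sum>k'\<in>?X. conv p (M ?s) (U ?s) (R ?s) (l ?s) (\<mu> ?s) k' m)
     = (\<Sum>k'\<in>?X. \<Sum>a\<in>U ?s. l ?s a m * (\<Sum>j\<in>R ?s. \<mu> ?s j m * of_bool (a * j mod M ?s = k')))] (mod P m)"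
    unfolding conv_apply[OF assms] by (rule cong_sum) (simp only: cong_def mod_mod_trivial)
  also have "(\<Sum>k'\<in>?X. \<Sum>a\<in>U ?s. l ?s a m * (\<Sum>j\<in>R ?s. \<mu> ?s j m * of_bool (a * j mod M ?s = k')))
    = (\<Sum>a\<in>U ?s. l ?s a m * (\<Sum>j\<in>R ?s. \<mu> ?s j m * (\<Sum>k'\<in>?X. of_bool (a * j mod M ?s = k'))))"
    unfolding sum_distrib_left by (rule trans[OF sum.swap], rule sum.cong[OF refl], rule sum.swap)
  also have "\<dots> = (\<Sum>a\<in>U ?s. l ?s a m * (\<Sum>j\<in>R ?s. \<mu> ?s j m * of_bool (a * j mod M r = k)))"
  proof -
    have "(\<Sum>k'\<in>?X. of_bool (t mod M ?s = k')) = (of_bool (t mod M r = k) :: int)" for t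
    proof -
      have "(\<Sum>k'\<in>?X. of_bool (t mod M ?s = k')) = (of_bool (t mod M ?s \<in> ?X) :: int)"
        by (simp add: of_bool_def)
      moreover have "t mod M ?s mod M r = t mod M r" by (rule mod_mod_cancel) (rule lvl_dvd, simp)
      then have "t mod M ?s \<in> ?X \<longleftrightarrow> t mod M r = k" using R_mod[of t ?s] by simp
      ultimately show ?thesis by simp
    qed
    then show ?thesis by simp
  qed
  also have "[\<dots> = (\<Sum>a\<in>U r. l r a m * (\<Sum>j\<in>R r. \<mu> r j m * of_bool (a * j mod M r = k)))] (mod P m)"
    by (intro L_push[OF l] Q_push[OF \<mu>]) (simp_all add: mod_simps)
  also have "[(\<Sum>a\<in>U r. l r a m * (\<Sum>j\<in>R r. \<mu> r j m * of_bool (a * j mod M r = k))) = conv p (M r) (U r) (R r) (l r) (\<mu> r) k m] (mod P m)"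
    unfolding conv_apply[OF assms] by (simp only: cong_def mod_mod_trivial)
  finally (cong_trans) show "[conv p (M r) (U r) (R r) (l r) (\<mu> r) k m
    = (\<Sum>k'\<in>?X. conv p (M ?s) (U ?s) (R ?s) (l ?s) (\<mu> ?s) k' m)] (mod P m)"
    by (rule cong_sym)
qed

text \<open>
  The definition of the twist reads off the residue modulo \<open>p^m\<close> at level \<open>max r m\<close>. Any finer level gives
  the same answer, because the integrand \<open>c\<close> is constant modulo \<open>p^m\<close> on residue classes modulo \<open>Np^m\<close>.
\<close>

lemma twist_cong:
  assumes l: "l \<in> L" and s: "r \<le> s" "m \<le> s"
  shows "[twist_Lambda p N l r a m = (\<Sum>c\<in>{c\<in>U s. c mod M r = a}. l s c m * c)] (mod P m)"
proof -
  let ?t = "max r m"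
  have flt: "(\<Sum>c\<in>{c\<in>U s. c mod M r = a}. l s c m * c) = (\<Sum>c\<in>U s. l s c m * (of_bool (c mod M r = a) * c))" for s
    by (subst sum.inter_filter) (auto intro!: sum.cong)
  have "[(\<Sum>c\<in>U s. l s c m * (of_bool (c mod M r = a) * c))
     = (\<Sum>c\<in>U ?t. l ?t c m * (of_bool (c mod M r = a) * c))] (mod P m)"
  proof (rule L_push[OF l])
    show "?t \<le> s" using s by simp
    fix c
    have "[c = c mod M ?t] (mod P m)" using P_dvd_M[of m ?t] by (simp add: cong_def mod_mod_cancel)
    moreover have "c mod M ?t mod M r = c mod M r" by (rule mod_mod_cancel) (rule lvl_dvd, simp)
    ultimately show "[of_bool (c mod M r = a) * c = of_bool (c mod M ?t mod M r = a) * (c mod M ?t)] (mod P m)"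
      by (simp add: cong_mult)
  qed
  then have "[(\<Sum>c\<in>{c\<in>U s. c mod M r = a}. l s c m * c) = (\<Sum>c\<in>{c\<in>U ?t. c mod M r = a}. l ?t c m * c)] (mod P m)"
    by (simp only: flt)
  then show ?thesis unfolding twist_Lambda_def by (simp add: cong_def)
qed

lemma twist_mem:
  assumes l: "l \<in> L"
  shows "twist_Lambda p N l \<in> L"
  unfolding measures_on_iff[OF fin_UR(1)]
proof (intro allI conjI ballI impI)
  fix r a
  have red: "twist_Lambda p N l r a = (\<lambda>m. twist_Lambda p N l r a m mod P m)"
    by (auto simp: twist_Lambda_def)
  have "(\<lambda>m. twist_Lambda p N l r a m mod P m) \<in> carrier (Zp p)"
  proof (rule Zp_reduceI)
    fix m
    let ?s = "max r (Suc m)"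
    have sm: "P m dvd P (Suc m)" by (simp add: le_imp_power_dvd)
    have "[twist_Lambda p N l r a (Suc m) = (\<Sum>c\<in>{c\<in>U ?s. c mod M r = a}. l ?s c (Suc m) * c)] (mod P m)"
      by (rule cong_dvd_modulus[OF twist_cong[OF l] sm]) simp_all
    also have "[(\<Sum>c\<in>{c\<in>U ?s. c mod M r = a}. l ?s c (Suc m) * c) = (\<Sum>c\<in>{c\<in>U ?s. c mod M r = a}. l ?s c m * c)] (mod P m)"
      by (intro cong_sum cong_mult cong_refl Zp_cong L_mem l) simp
    also have "[(\<Sum>c\<in>{c\<in>U ?s. c mod M r = a}. l ?s c m * c) = twist_Lambda p N l r a m] (mod P m)"
      by (rule cong_sym[OF twist_cong[OF l]]) auto
    finally (cong_trans) show "[twist_Lambda p N l r a (Suc m) = twist_Lambda p N l r a m] (mod P m)" .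
  qed
  then show "twist_Lambda p N l r a \<in> carrier (Zp p)" using red by simp
next
  fix r a assume "a \<notin> U r"
  then have empty: "{b \<in> U (max r m). b mod M r = a} = {}" for m using U_mod[of _ "max r m" r] by auto
  show "twist_Lambda p N l r a = (\<lambda>m. 0)" by (simp only: twist_Lambda_def empty sum.empty mod_0)
next
  fix r a m assume "a \<in> U r"
  let ?s = "max (Suc r) m" and ?T = "{a' \<in> U (Suc r). a' mod M r = a}"
  have "[(\<Sum>a'\<in>?T. twist_Lambda p N l (Suc r) a' m)
      = (\<Sum>a'\<in>?T. \<Sum>c\<in>{c\<in>U ?s. c mod M (Suc r) = a'}. l ?s c m * c)] (mod P m)"
    by (intro cong_sum twist_cong[OF l]) auto
  also have "(\<Sum>a'\<in>?T. \<Sum>c\<in>{c\<in>U ?s. c mod M (Suc r) = a'}. l ?s c m * c)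
    = (\<Sum>a'\<in>?T. \<Sum>c\<in>{c\<in>{c\<in>U ?s. c mod M r = a}. c mod M (Suc r) = a'}. l ?s c m * c)"
  proof (intro sum.cong refl)
    have "c mod M (Suc r) mod M r = c mod M r" for c by (rule mod_mod_cancel) (rule lvl_dvd, simp)
    then show "{c\<in>U ?s. c mod M (Suc r) = a'} = {c\<in>{c\<in>U ?s. c mod M r = a}. c mod M (Suc r) = a'}"
      if "a' \<in> ?T" for a' using that by auto
  qed
  also have "\<dots> = (\<Sum>c\<in>{c\<in>U ?s. c mod M r = a}. l ?s c m * c)"
  proof (rule sum.group)
    have "c mod M (Suc r) mod M r = c mod M r" for c by (rule mod_mod_cancel) (rule lvl_dvd, simp)
    then show "(\<lambda>c. c mod M (Suc r)) ` {c \<in> U ?s. c mod M r = a} \<subseteq> ?T"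
      using U_mod[of _ ?s "Suc r"] by auto
  qed auto
  also have "[\<dots> = twist_Lambda p N l r a m] (mod P m)"
    by (rule cong_sym[OF twist_cong[OF l]]) auto
  finally (cong_trans) show "[twist_Lambda p N l r a m = (\<Sum>a'\<in>?T. twist_Lambda p N l (Suc r) a' m)] (mod P m)"
    by (rule cong_sym)
qed

lemma completed_module_simps:
  "carrier (completed_module p N) = Q"
  "f \<oplus>\<^bsub>completed_module p N\<^esub> g = (\<lambda>r i m. (f r i m + g r i m) mod P m)"
  "\<zero>\<^bsub>completed_module p N\<^esub> = (\<lambda>r i m. 0)"
  "l \<odot>\<^bsub>completed_module p N\<^esub> f = (\<lambda>r. conv p (M r) (U r) (R r) (l r) (f r))"
  by (simp_all add: completed_module_def fin_residue_module_simps)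

lemma Q_reduceI:
  assumes "\<And>r i. i \<in> R r \<Longrightarrow> (\<lambda>m. f r i m mod P m) \<in> carrier (Zp p)" "\<And>r i m. i \<notin> R r \<Longrightarrow> f r i m mod P m = 0"
    "\<And>r j m. j \<in> R r \<Longrightarrow> [f r j m = (\<Sum>i\<in>{i\<in>R (Suc r). i mod M r = j}. f (Suc r) i m)] (mod P m)"
  shows "(\<lambda>r i m. f r i m mod P m) \<in> Q"
  unfolding measures_on_iff[OF fin_UR(2)]
proof (intro allI conjI ballI impI)
  fix r j m assume "j \<in> R r"
  then show "[f r j m mod P m = (\<Sum>i\<in>{i\<in>R (Suc r). i mod M r = j}. f (Suc r) i m mod P m)] (mod P m)"
    using assms(3)[of j r m] by (simp add: cong_def mod_sum_eq)
qed (use assms in auto)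

lemma Q_sum: "\<mu> \<in> Q \<Longrightarrow> j \<in> R r \<Longrightarrow> [\<mu> r j m = (\<Sum>i\<in>{i\<in>R (Suc r). i mod M r = j}. \<mu> (Suc r) i m)] (mod P m)"
  by (rule measures_on_sum) auto

lemma Q_outside: "\<mu> \<in> Q \<Longrightarrow> i \<notin> R r \<Longrightarrow> \<mu> r i = (\<lambda>m. 0)"
  by (rule measures_on_outside) auto

lemma Q_add: "\<mu> \<in> Q \<Longrightarrow> \<nu> \<in> Q \<Longrightarrow> (\<lambda>r i m. (\<mu> r i m + \<nu> r i m) mod P m) \<in> Q"
  by (rule Q_reduceI) (auto simp: sum.distrib Q_outside intro: Zp_add_mem Q_mem cong_add Q_sum)

lemma Q_uminus: "\<mu> \<in> Q \<Longrightarrow> (\<lambda>r i m. (- \<mu> r i m) mod P m) \<in> Q"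
  by (rule Q_reduceI) (auto simp: sum_negf Q_outside cong_minus_minus_iff intro: Zp_uminus_mem Q_mem Q_sum)

lemma abelian_group_completed_module: "abelian_group (completed_module p N)"
proof (rule abelian_groupI, unfold completed_module_simps)
  show "(\<lambda>r i m. 0) \<in> Q" using Q_reduceI[of "\<lambda>r i m. 0"] Zp_zero_mem by simp
next
  fix x assume x: "x \<in> Q"
  show "(\<lambda>r i m. (0 + x r i m) mod P m) = x" using Q_mem[OF x] by simp
  show "\<exists>y\<in>Q. (\<lambda>r i m. (y r i m + x r i m) mod P m) = (\<lambda>r i m. 0)"
    by (rule bexI[OF _ Q_uminus[OF x]]) (simp add: mod_simps)
qed (auto simp: mod_simps algebra_simps intro: Q_add)

lemma measure_scaled_point:
  assumes "\<And>r. finite (S r)" "x \<in> carrier (Zlim p N)" "\<And>r. x r \<in> S r" "c \<in> carrier (Zp p)"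
  shows "(\<lambda>r. scaled_single p c (x r)) \<in> measures_on p N S"
  unfolding measures_on_iff[OF assms(1)]
proof (intro allI conjI ballI impI)
  fix r i show "scaled_single p c (x r) i \<in> carrier (Zp p)" using assms(4) Zp_zero_mem by (simp add: scaled_single_def)
next
  fix r i assume "i \<notin> S r"
  then show "scaled_single p c (x r) i = (\<lambda>m. 0)" using assms(3)[of r] by (auto simp: scaled_single_def)
next
  fix r j m
  have "x (Suc r) mod M r = x r" by (rule Zlim_mod[OF assms(2)]) simp
  then show "[scaled_single p c (x r) j m = (\<Sum>i\<in>{i\<in>S (Suc r). i mod M r = j}. scaled_single p c (x (Suc r)) i m)] (mod P m)"
    using assms(1,3) by (simp add: scaled_single_apply)
qed

lemma Zlim_zero_mem: "(\<lambda>r. 0) \<in> carrier (Zlim p N)"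
  using cring.cring_simprules(2)[OF Zlim_cring[OF p_pos N_pos]] by simp

lemma Zlim_one_mem: "(\<lambda>r. 1 mod M r) \<in> carrier (Zlim p N)"
  using cring.cring_simprules(6)[OF Zlim_cring[OF p_pos N_pos]] by simp

lemma one_mem_U: "1 mod M r \<in> U r"
  using M_pos[of r] by (simp add: unit_residues_def)

lemma zero_mem_R: "0 \<in> R r" using M_pos[of r] by (simp add: residues_mod_def)

text \<open>
  The mass of the class \<open>0\<close> cannot spread out at finer levels, so it is the same at all levels.
\<close>

lemma Q_supported_at_zero:
  assumes "\<mu> \<in> Q" "\<And>r i. i \<noteq> 0 \<Longrightarrow> \<mu> r i = (\<lambda>m. 0)"
  shows "\<mu> = (\<lambda>r. scaled_single p (\<mu> 0 0) 0)"
proof -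
  have "\<mu> (Suc r) 0 = \<mu> r 0" for r
  proof
    fix m
    have "(\<Sum>i\<in>{i\<in>R (Suc r). i mod M r = 0}. \<mu> (Suc r) i m) = (\<Sum>i\<in>{0}. \<mu> (Suc r) i m)"
      using assms(2) zero_mem_R by (intro sum.mono_neutral_right) auto
    then have "[\<mu> r 0 m = \<mu> (Suc r) 0 m] (mod P m)"
      using Q_sum[OF assms(1) zero_mem_R, of r m] by simp
    then show "\<mu> (Suc r) 0 m = \<mu> r 0 m"
      by (intro Zp_cong_eq Q_mem assms(1)) (rule cong_sym)
  qed
  then have "\<mu> r 0 = \<mu> 0 0" for r by (induction r) auto
  then show ?thesis by (intro ext) (metis assms(2) scaled_single_apply)
qed

lemma Lambda_carrier: "carrier (Lambda p N) = L" by (simp add: Lambda_def)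

lemma submodule_scaled_zero_completed:
  "submodule {(\<lambda>r. scaled_single p c 0) | c. c \<in> carrier (Zp p)} (Lambda p N) (completed_module p N)"
    (is "submodule ?X _ _")
proof -
  interpret Q: abelian_group "completed_module p N" by (rule abelian_group_completed_module)
  have XQ: "(\<lambda>r. scaled_single p c 0) \<in> Q" if "c \<in> carrier (Zp p)" for c
    by (rule measure_scaled_point[OF _ Zlim_zero_mem _ that]) (use zero_mem_R in auto)
  have "subgroup ?X (add_monoid (completed_module p N))"
  proof (rule Q.add.subgroupI)
    show "?X \<subseteq> carrier (completed_module p N)" using XQ by (auto simp: completed_module_simps)
    show "?X \<noteq> {}" using Zp_zero_mem by blast
    fix x assume "x \<in> ?X"
    then obtain c where c: "c \<in> carrier (Zp p)" "x = (\<lambda>r. scaled_single p c 0)" by blast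
    let ?y = "\<lambda>r::nat. scaled_single p (\<lambda>m. (- c m) mod P m) 0"
    have "?y \<oplus>\<^bsub>completed_module p N\<^esub> x = \<zero>\<^bsub>completed_module p N\<^esub>"
      by (simp add: c completed_module_simps scaled_single_apply fun_eq_iff mod_simps)
    then have "\<ominus>\<^bsub>completed_module p N\<^esub> x = ?y"
      using XQ[OF c(1)] XQ[OF Zp_uminus_mem[OF c(1)]]
      by (intro Q.minus_equality) (simp_all add: completed_module_simps c(2))
    then show "\<ominus>\<^bsub>completed_module p N\<^esub> x \<in> ?X" using Zp_uminus_mem[OF c(1)] by blast
    fix y assume "y \<in> ?X"
    then obtain d where d: "d \<in> carrier (Zp p)" "y = (\<lambda>r. scaled_single p d 0)" by blast
    have "x \<oplus>\<^bsub>completed_module p N\<^esub> y = (\<lambda>r. scaled_single p (\<lambda>m. (c m + d m) mod P m) 0)"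
      by (simp add: c d completed_module_simps scaled_single_apply fun_eq_iff)
    then show "x \<oplus>\<^bsub>completed_module p N\<^esub> y \<in> ?X" using Zp_add_mem[OF c(1) d(1)] by blast
  qed
  moreover have "l \<odot>\<^bsub>completed_module p N\<^esub> x \<in> ?X" if l: "l \<in> carrier (Lambda p N)" and x: "x \<in> ?X" for l x
  proof -
    have l: "l \<in> L" using l by (simp add: Lambda_carrier)
    obtain c where c: "c \<in> carrier (Zp p)" "x = (\<lambda>r. scaled_single p c 0)" using x by blast
    let ?y = "l \<odot>\<^bsub>completed_module p N\<^esub> x"
    have y: "?y \<in> Q" using conv_mem_Q[OF l XQ[OF c(1)]] by (simp add: completed_module_simps c(2))
    have "?y r i = (\<lambda>m. 0)" if "i \<noteq> 0" for r i
    proof -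
      have "?y r = scaled_single p (?y r 0) 0"
        using conv_scaled_zero[OF M_pos c(1), of r "l r"] L_mem[OF l] by (simp add: completed_module_simps c(2))
      then have "?y r i = scaled_single p (?y r 0) 0 i" by (rule fun_cong)
      then show ?thesis using that by (simp add: scaled_single_def)
    qed
    from Q_supported_at_zero[OF y this] show ?thesis using Q_mem[OF y] by blast
  qed
  ultimately show ?thesis by (simp add: submodule_def submodule_axioms_def)
qed

lemma star_kernel_eq: "star_kernel p N = {(\<lambda>r. scaled_single p c 0) | c. c \<in> carrier (Zp p)}" (is "_ = ?X")
proof
  have "group_elt p \<zero>\<^bsub>Zlim p N\<^esub> \<in> ?X" using Zp_one_mem by (auto simp: group_elt_def)
  then show "star_kernel p N \<subseteq> ?X"
    using submodule_scaled_zero_completed unfolding star_kernel_def submodule_gen_def by blast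
  show "?X \<subseteq> star_kernel p N"
    unfolding star_kernel_def submodule_gen_def
  proof safe
    fix c H assume c: "c \<in> carrier (Zp p)" and H: "submodule H (Lambda p N) (completed_module p N)"
      "{group_elt p \<zero>\<^bsub>Zlim p N\<^esub>} \<subseteq> H"
    let ?l = "\<lambda>r. scaled_single p c (1 mod M r)"
    have "?l \<in> L" by (rule measure_scaled_point[OF _ Zlim_one_mem one_mem_U c]) simp
    then have "?l \<odot>\<^bsub>completed_module p N\<^esub> group_elt p \<zero>\<^bsub>Zlim p N\<^esub> \<in> H"
      by (intro submodule.smult_closed[OF H(1)]) (use H(2) in \<open>auto simp: Lambda_carrier\<close>)
    moreover have "?l \<odot>\<^bsub>completed_module p N\<^esub> group_elt p \<zero>\<^bsub>Zlim p N\<^esub> = (\<lambda>r. scaled_single p c 0)"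
    proof
      fix r
      have "single p 0 \<in> free_Zp p (R r)" using zero_mem_R Zp_one_mem by (intro scaled_single_mem) auto
      from conv_scaled_one[OF M_pos c this]
      have "(?l \<odot>\<^bsub>completed_module p N\<^esub> group_elt p \<zero>\<^bsub>Zlim p N\<^esub>) r = (\<lambda>k m. (c m * single p 0 k m) mod P m)"
        by (simp add: completed_module_simps group_elt_def)
      also have "\<dots> = scaled_single p c 0"
        using c by (auto simp: fun_eq_iff scaled_single_apply mod_simps)
      finally show "(?l \<odot>\<^bsub>completed_module p N\<^esub> group_elt p \<zero>\<^bsub>Zlim p N\<^esub>) r = scaled_single p c 0" .
    qed
    ultimately show "(\<lambda>r. scaled_single p c 0) \<in> H" by simp
  qed
qed

lemma star_kernel_subgroup: "abelian_subgroup (star_kernel p N) (completed_module p N)"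
proof (rule abelian_subgroupI3)
  show "abelian_group (completed_module p N)" by (rule abelian_group_completed_module)
  show "additive_subgroup (star_kernel p N) (completed_module p N)"
    using submodule_scaled_zero_completed unfolding star_kernel_eq
    by (simp add: submodule_def additive_subgroup_def)
qed

abbreviation star_cls where "star_cls \<mu> \<equiv> star_kernel p N +>\<^bsub>completed_module p N\<^esub> \<mu>"

text \<open>
  The difference of two measures that agree away from \<open>0\<close> is supported at \<open>0\<close>, hence a multiple of \<open>[0]\<close>.
\<close>

lemma star_cls_eq_iff:
  assumes "\<mu> \<in> Q" "\<nu> \<in> Q"
  shows "star_cls \<mu> = star_cls \<nu> \<longleftrightarrow> (\<forall>r i. i \<noteq> 0 \<longrightarrow> \<mu> r i = \<nu> r i)"
proof -
  have "star_cls \<mu> = star_cls \<nu> \<longleftrightarrow> (\<exists>h\<in>star_kernel p N. \<mu> = h \<oplus>\<^bsub>completed_module p N\<^esub> \<nu>)"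
    by (rule quot_module_class_eq[OF star_kernel_subgroup]) (use assms in \<open>auto simp: completed_module_simps\<close>)
  also have "\<dots> \<longleftrightarrow> (\<exists>c\<in>carrier (Zp p). \<mu> = (\<lambda>r i m. (scaled_single p c 0 i m + \<nu> r i m) mod P m))"
    unfolding star_kernel_eq completed_module_simps by auto
  also have "\<dots> \<longleftrightarrow> (\<forall>r i. i \<noteq> 0 \<longrightarrow> \<mu> r i = \<nu> r i)"
  proof safe
    fix c r and i :: int
    assume "\<mu> = (\<lambda>r i m. (scaled_single p c 0 i m + \<nu> r i m) mod P m)" "i \<noteq> 0"
    then show "(\<lambda>m. (scaled_single p c 0 i m + \<nu> r i m) mod P m) = \<nu> r i"
      using Q_mem[OF assms(2), of r i] by (simp add: scaled_single_apply)
  next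
    assume eq: "\<forall>r i. i \<noteq> 0 \<longrightarrow> \<mu> r i = \<nu> r i"
    define \<delta> where "\<delta> = (\<lambda>r i m. (\<mu> r i m + (- \<nu> r i m) mod P m) mod P m)"
    have \<delta>: "\<delta> \<in> Q" unfolding \<delta>_def by (intro Q_add Q_uminus assms)
    have "\<delta> r i = (\<lambda>m. 0)" if "i \<noteq> 0" for r i using eq that by (simp add: \<delta>_def mod_simps)
    from Q_supported_at_zero[OF \<delta> this] have 1: "\<delta> r i m = scaled_single p (\<delta> 0 0) 0 i m" for r i m
      by metis
    have "\<mu> r i m = (\<delta> r i m + \<nu> r i m) mod P m" for r i m
      using Q_mem[OF assms(1), of r i] by (simp add: \<delta>_def mod_simps)
    then have "\<mu> r i m = (scaled_single p (\<delta> 0 0) 0 i m + \<nu> r i m) mod P m" for r i m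
      by (metis 1)
    then show "\<exists>c\<in>carrier (Zp p). \<mu> = (\<lambda>r i m. (scaled_single p c 0 i m + \<nu> r i m) mod P m)"
      using Q_mem[OF \<delta>] by blast
  qed
  finally show ?thesis .
qed

lemma Lambda_star_carrier: "carrier (Lambda_star p N) = star_cls ` Q"
  by (simp add: Lambda_star_def quot_module_carrier completed_module_simps)

lemma Lambda_star_add:
  assumes "\<mu> \<in> Q" "\<nu> \<in> Q"
  shows "star_cls \<mu> \<oplus>\<^bsub>Lambda_star p N\<^esub> star_cls \<nu> = star_cls (\<lambda>r i m. (\<mu> r i m + \<nu> r i m) mod P m)"
  using quot_module_add[OF star_kernel_subgroup, of \<mu> \<nu>] assms
  by (simp add: Lambda_star_def completed_module_simps)

lemma Lambda_star_smult:
  assumes "l \<in> L" "\<mu> \<in> Q"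
  shows "l \<odot>\<^bsub>Lambda_star p N\<^esub> star_cls \<mu> = star_cls (\<lambda>r. conv p (M r) (U r) (R r) (l r) (\<mu> r))"
proof -
  have "l \<odot>\<^bsub>quot_module (completed_module p N) (star_kernel p N)\<^esub> star_cls \<mu> = star_cls (l \<odot>\<^bsub>completed_module p N\<^esub> \<mu>)"
  proof (rule quot_module_smult[OF star_kernel_subgroup])
    show "\<mu> \<in> carrier (completed_module p N)" using assms by (simp add: completed_module_simps)
    fix \<nu> assume \<nu>: "\<nu> \<in> carrier (completed_module p N)" "star_cls \<nu> = star_cls \<mu>"
    then have \<nu>Q: "\<nu> \<in> Q" and eq: "\<And>r i. i \<noteq> 0 \<Longrightarrow> \<nu> r i = \<mu> r i"
      using star_cls_eq_iff assms by (auto simp: completed_module_simps)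
    have "conv p (M r) (U r) (R r) (l r) (\<nu> r) k m = conv p (M r) (U r) (R r) (l r) (\<mu> r) k m" if "k \<noteq> 0" for r k m
    proof -
      have *: "\<nu> r j m * of_bool (a * j mod M r = k) = \<mu> r j m * of_bool (a * j mod M r = k)" for a j
        using eq that by (cases "j = 0") auto
      show ?thesis unfolding conv_apply[OF assms(1) \<nu>Q] conv_apply[OF assms] by (simp only: *)
    qed
    then show "star_cls (l \<odot>\<^bsub>completed_module p N\<^esub> \<nu>) = star_cls (l \<odot>\<^bsub>completed_module p N\<^esub> \<mu>)"
      unfolding completed_module_simps
      by (subst star_cls_eq_iff) (use assms \<nu>Q conv_mem_Q in auto)
  qed
  then show ?thesis by (simp add: Lambda_star_def completed_module_simps)
qed

lemma abelian_group_Lambda_star: "abelian_group (Lambda_star p N)"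
  unfolding Lambda_star_def by (intro abelian_group_quot_module star_kernel_subgroup)

lemma star_proj_star_cls:
  assumes "\<mu> \<in> Q"
  shows "star_proj p N r (star_cls \<mu>) = fin_cls (M r) (\<mu> r)"
proof -
  interpret abelian_subgroup "star_kernel p N" "completed_module p N" by (rule star_kernel_subgroup)
  have \<mu>: "\<mu> \<in> carrier (completed_module p N)" using assms by (simp add: completed_module_simps)
  have "\<mu> \<in> star_cls \<mu>" using a_rcos_self \<mu> by blast
  moreover have "fin_cls (M r) (\<nu> r) = fin_cls (M r) (\<mu> r)" if "\<nu> \<in> star_cls \<mu>" for \<nu>
  proof -
    have \<nu>: "\<nu> \<in> carrier (completed_module p N)" "star_cls \<nu> = star_cls \<mu>"
      using that \<mu> a_elemrcos_carrier a_repr_independence' by (auto simp: a_subgroup)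
    then have "\<forall>r i. i \<noteq> 0 \<longrightarrow> \<nu> r i = \<mu> r i" using star_cls_eq_iff assms by (simp add: completed_module_simps)
    then show ?thesis
      by (subst fin_cls_eq_iff) (use M_pos Q_free assms \<nu>(1) in \<open>auto simp: completed_module_simps\<close>)
  qed
  ultimately show ?thesis unfolding star_proj_def by (intro UN_constant_eq ballI)
qed

end

section \<open>Roots of unity and the Tate module\<close>

locale cyclotomic = tower p N for p N :: nat +
  fixes \<iota> :: "'a::{alg_closed_field, field_char_0} \<Rightarrow> complex"
  assumes embedding: "\<iota> \<in> ring_hom ring_of_type_algebra ring_of_type_algebra"
begin

lemma iota_add: "\<iota> (x + y) = \<iota> x + \<iota> y" and iota_mult: "\<iota> (x * y) = \<iota> x * \<iota> y" and iota_1: "\<iota> 1 = 1"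
  using embedding by (auto simp: ring_hom_def ring_of_type_algebra_def)

lemma iota_0: "\<iota> 0 = 0" using iota_add[of 0 0] by simp

lemma iota_uminus: "\<iota> (- x) = - \<iota> x"
  using iota_add[of x "- x"] iota_0 by (simp add: add_eq_0_iff)

lemma iota_eq_0_iff: "\<iota> x = 0 \<longleftrightarrow> x = 0"
proof
  assume "\<iota> x = 0"
  show "x = 0"
  proof (rule ccontr)
    assume "x \<noteq> 0"
    then have "\<iota> x * \<iota> (inverse x) = 1" by (simp flip: iota_mult add: iota_1)
    then show False using \<open>\<iota> x = 0\<close> by simp
  qed
qed (simp add: iota_0)

lemma inj_iota: "inj \<iota>"
proof (rule injI)
  fix x y assume "\<iota> x = \<iota> y"
  then have "\<iota> (x - y) = 0" using iota_add[of x "- y"] by (simp add: iota_uminus)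
  then show "x = y" by (simp add: iota_eq_0_iff)
qed

lemma iota_power: "\<iota> (x ^ k) = \<iota> x ^ k"
  by (induction k) (simp_all add: iota_mult iota_1 power_Suc)

text \<open>
  Over the algebraically closed field, \<open>X^d - 1\<close> is a product of linear factors. Its image under \<open>\<iota>\<close>
  vanishes at \<open>w\<close>, so that \<open>w\<close> is the image of one of the roots.
\<close>

lemma root_of_unity_in_range:
  assumes "d > 0" "w ^ d = 1"
  shows "w \<in> range \<iota>"
proof -
  define F where "F = (\<lambda>q. poly (map_poly \<iota> q) w)"
  have F_mult: "F (q * q') = F q * F q'" for q q'
  proof -
    have "\<iota> (\<Sum>i\<in>A. f i) = (\<Sum>i\<in>A. \<iota> (f i))" for A :: "nat set" and f
      by (induction A rule: infinite_finite_induct) (simp_all add: iota_0 iota_add)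
    then have "map_poly \<iota> (q * q') = map_poly \<iota> q * map_poly \<iota> q'"
      by (intro poly_eqI) (simp add: coeff_map_poly iota_0 coeff_mult iota_mult)
    then show ?thesis by (simp add: F_def)
  qed
  define q where "q = (Polynomial.monom 1 d - 1 :: 'a poly)"
  have "Polynomial.coeff q d = 1" using assms by (simp add: q_def)
  then have q0: "q \<noteq> 0" by auto
  obtain A where A: "q = Polynomial.smult (Polynomial.lead_coeff q) (\<Prod>x\<in>#A. [:-x, 1:])"
    using alg_closed_imp_factorization[OF q0] by blast
  have "F q = w ^ d - 1"
  proof -
    have "map_poly \<iota> q = Polynomial.monom 1 d - 1"
    proof (rule poly_eqI)
      fix i
      have "\<iota> (- 1) = - 1" by (simp add: iota_uminus iota_1)
      then show "Polynomial.coeff (map_poly \<iota> q) i = Polynomial.coeff (Polynomial.monom 1 d - 1) i"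
        using assms(1) by (simp add: q_def coeff_map_poly iota_0 iota_1 coeff_1 when_def)
    qed
    then show ?thesis by (simp add: F_def poly_monom)
  qed
  then have Fq: "F q = 0" using assms by simp
  have "F (\<Prod>x\<in>#A. [:-x, 1:]) = (\<Prod>x\<in>#A. w - \<iota> x)"
  proof (induction A)
    case empty
    have "map_poly \<iota> 1 = 1" by (intro poly_eqI) (simp add: coeff_map_poly iota_0 iota_1 coeff_1 when_def)
    then show ?case by (simp add: F_def)
  next
    case (add x A)
    have "F [:-x, 1:] = w - \<iota> x"
      by (simp add: F_def map_poly_pCons iota_0 iota_1 iota_uminus)
    then show ?case using add by (simp only: image_mset_add_mset prod_mset.add_mset F_mult)
  qed
  moreover have "F (Polynomial.smult (Polynomial.lead_coeff q) r) = \<iota> (Polynomial.lead_coeff q) * F r" for r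
  proof -
    have "Polynomial.smult (Polynomial.lead_coeff q) r = [:Polynomial.lead_coeff q:] * r" by simp
    moreover have "F [:Polynomial.lead_coeff q:] = \<iota> (Polynomial.lead_coeff q)"
      by (simp add: F_def map_poly_pCons iota_0)
    ultimately show ?thesis by (simp only: F_mult)
  qed
  ultimately have "\<iota> (Polynomial.lead_coeff q) * (\<Prod>x\<in>#A. w - \<iota> x) = 0"
    using Fq A by metis
  moreover have "\<iota> (Polynomial.lead_coeff q) \<noteq> 0" using q0 by (simp add: iota_eq_0_iff)
  ultimately show ?thesis by (auto simp: prod_mset_zero_iff)
qed

abbreviation \<zeta> where "\<zeta> d \<equiv> zeta \<iota> d"

lemma iota_zeta: "d > 0 \<Longrightarrow> \<iota> (\<zeta> d) = exp (2 * of_real pi * \<i> / of_nat d)"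
  unfolding zeta_def
  by (rule f_inv_into_f, rule root_of_unity_in_range[of d])
     (use complex_root_unity[of d 1] in simp_all)

lemma iota_zeta_pow: "d > 0 \<Longrightarrow> \<iota> (\<zeta> d ^ k) = exp (2 * of_real pi * \<i> * of_nat k / of_nat d)"
  by (simp add: iota_power iota_zeta exp_of_nat_mult[symmetric] mult_ac)

lemma zeta_pow_eq_iff: "d > 0 \<Longrightarrow> \<zeta> d ^ j = \<zeta> d ^ k \<longleftrightarrow> [j = k] (mod d)"
  using complex_root_unity_eq[of d j k] inj_iota
  by (simp add: inj_eq[OF inj_iota, symmetric] iota_zeta_pow cong_def)

lemma zeta_pow_1: "d > 0 \<Longrightarrow> \<zeta> d ^ d = 1"
  using zeta_pow_eq_iff[of d d 0] by (simp add: cong_def)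

lemma root_of_unity_zeta_pow:
  assumes "d > 0" "x ^ d = 1"
  shows "\<exists>k<d. x = \<zeta> d ^ k"
proof -
  have "\<iota> x ^ d = 1" using assms iota_power[of x d] iota_1 by simp
  then obtain j where "j < d" "\<iota> x = exp (2 * of_real pi * \<i> * of_nat j / of_nat d)"
    using complex_roots_unity[of d] assms(1) by (auto simp: set_eq_iff)
  then show ?thesis using iota_zeta_pow[OF assms(1)] inj_iota by (metis injD)
qed

lemma zeta_mult_pow: "d > 0 \<Longrightarrow> e > 0 \<Longrightarrow> \<zeta> (d * e) ^ e = \<zeta> d"
  by (rule injD[OF inj_iota]) (simp add: iota_zeta_pow iota_zeta of_nat_mult)

lemma root_pow_cong:
  fixes x :: "'b::comm_ring_1"
  assumes "x ^ n = 1" "[i = j] (mod n)"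
  shows "x ^ i = x ^ j"
proof -
  have "x ^ k = x ^ (k mod n)" for k
  proof -
    have "x ^ k = x ^ (n * (k div n) + k mod n)" by simp
    also have "\<dots> = x ^ (k mod n)" using assms by (simp only: power_add power_mult) simp
    finally show ?thesis .
  qed
  then show ?thesis using assms(2) by (metis cong_def)
qed

lemma nat_cong: "0 \<le> a \<Longrightarrow> 0 \<le> b \<Longrightarrow> [a = b] (mod int n) \<Longrightarrow> [nat a = nat b] (mod n)"
  by (metis cong_int_iff int_nat_eq)

lemma root_pow_int_cong:
  fixes x :: "'b::comm_ring_1"
  assumes "x ^ n = 1" "0 \<le> a" "0 \<le> b" "[a = b] (mod int n)"
  shows "x ^ nat a = x ^ nat b"
  using root_pow_cong[OF assms(1) nat_cong[OF assms(2-4)]] .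

abbreviation K :: "'a set" where "K \<equiv> carrier (cyc_field p N)"
abbreviation \<mu> :: "'a set" where "\<mu> \<equiv> mu_infty p N"
abbreviation T :: "(profint, nat \<Rightarrow> 'a) module" where "T \<equiv> Tate p N"

lemma type_ring_simps [simp]:
  "carrier (ring_of_type_algebra :: 'b::comm_ring_1 ring) = UNIV"
  "x \<otimes>\<^bsub>(ring_of_type_algebra :: 'b::comm_ring_1 ring)\<^esub> y = x * y"
  "x \<oplus>\<^bsub>(ring_of_type_algebra :: 'b::comm_ring_1 ring)\<^esub> y = x + y"
  "\<one>\<^bsub>(ring_of_type_algebra :: 'b::comm_ring_1 ring)\<^esub> = 1"
  "\<zero>\<^bsub>(ring_of_type_algebra :: 'b::comm_ring_1 ring)\<^esub> = 0"
  by (simp_all add: ring_of_type_algebra_def)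

lemma cyc_field_simps [simp]:
  "x \<otimes>\<^bsub>cyc_field p N\<^esub> y = x * (y :: 'a)"
  "x \<oplus>\<^bsub>cyc_field p N\<^esub> y = x + (y :: 'a)"
  "\<one>\<^bsub>cyc_field p N\<^esub> = (1 :: 'a)"
  "\<zero>\<^bsub>cyc_field p N\<^esub> = (0 :: 'a)"
  by (simp_all add: cyc_field_def)

lemma K_def: "K = generate_field ring_of_type_algebra \<mu>"
  by (simp add: cyc_field_def)

lemma type_ring_uminus: "\<ominus>\<^bsub>ring_of_type_algebra\<^esub> x = - (x :: 'a)"
proof -
  interpret field "ring_of_type_algebra :: 'a ring" by (rule field_from_type_algebra)
  show ?thesis by (rule minus_equality) simp_all
qed

lemma type_ring_inverse: "x \<noteq> 0 \<Longrightarrow> inv\<^bsub>ring_of_type_algebra\<^esub> x = inverse (x :: 'a)"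
proof -
  assume x: "x \<noteq> 0"
  interpret field "ring_of_type_algebra :: 'a ring" by (rule field_from_type_algebra)
  show ?thesis by (rule comm_inv_char) (use x in simp_all)
qed

lemma mu_subset_K: "\<xi> \<in> \<mu> \<Longrightarrow> \<xi> \<in> K" unfolding K_def by (rule generate_field.incl)
lemma K_1: "1 \<in> K" using generate_field.one[of ring_of_type_algebra \<mu>] by (simp add: K_def)
lemma K_add: "x \<in> K \<Longrightarrow> y \<in> K \<Longrightarrow> x + y \<in> K" unfolding K_def using generate_field.eng_add by fastforce
lemma K_mult: "x \<in> K \<Longrightarrow> y \<in> K \<Longrightarrow> x * y \<in> K" unfolding K_def using generate_field.eng_mult by fastforce
lemma K_uminus: "x \<in> K \<Longrightarrow> - x \<in> K" unfolding K_def using generate_field.a_inv type_ring_uminus by metis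
lemma K_0: "0 \<in> K" using K_add[OF K_1 K_uminus[OF K_1]] by simp
lemma K_diff: "x \<in> K \<Longrightarrow> y \<in> K \<Longrightarrow> x - y \<in> K" using K_add[OF _ K_uminus, of x y] by simp
lemma K_inverse: "x \<in> K \<Longrightarrow> inverse x \<in> K"
  using K_0 generate_field.m_inv[of x ring_of_type_algebra \<mu>] type_ring_inverse[of x] unfolding K_def
  by (cases "x = 0") auto

lemma K_power: "x \<in> K \<Longrightarrow> x ^ k \<in> K" by (induction k) (auto simp: K_1 K_mult power_Suc)

lemma K_of_int: "of_int k \<in> K"
proof (induction k rule: int_induct[where k = 0])
  case base
  then show ?case by (simp add: K_0)
next
  case (step1 i)
  then show ?case using K_add[OF _ K_1] by simp
next
  case (step2 i)
  then show ?case using K_diff[OF _ K_1] by simp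
qed

lemma K_induct [consumes 1, case_names root one uminus inverse add mult]:
  assumes "x \<in> K" "\<And>\<xi>. \<xi> \<in> \<mu> \<Longrightarrow> Pr \<xi>" "Pr 1" "\<And>x. x \<in> K \<Longrightarrow> Pr x \<Longrightarrow> Pr (- x)"
    "\<And>x. x \<in> K \<Longrightarrow> x \<noteq> 0 \<Longrightarrow> Pr x \<Longrightarrow> Pr (inverse x)" "\<And>x y. x \<in> K \<Longrightarrow> y \<in> K \<Longrightarrow> Pr x \<Longrightarrow> Pr y \<Longrightarrow> Pr (x + y)"
    "\<And>x y. x \<in> K \<Longrightarrow> y \<in> K \<Longrightarrow> Pr x \<Longrightarrow> Pr y \<Longrightarrow> Pr (x * y)"
  shows "Pr x"
  using assms(1) unfolding K_def
proof (induction rule: generate_field.induct)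
  case (m_inv h)
  then show ?case using assms(5)[of h] type_ring_inverse[of h] by (simp add: K_def)
qed (use assms in \<open>simp_all add: K_def type_ring_uminus\<close>)

lemma root_in_mu: "x ^ (N * p ^ r) = 1 \<Longrightarrow> x \<in> \<mu>" by (auto simp: mu_infty_def)

lemma p_root_in_mu: "x ^ (p ^ r) = 1 \<Longrightarrow> x \<in> \<mu>"
  by (rule root_in_mu[of _ r]) (simp add: power_mult mult.commute[of N])

lemma Tate_carrier: "z \<in> carrier T \<longleftrightarrow> (\<forall>r. z r ^ (p ^ r) = 1 \<and> z (Suc r) ^ p = z r)"
  using mu_subset_K p_root_in_mu by (auto simp: Tate_def)

lemma Tate_simps:
  "x \<oplus>\<^bsub>T\<^esub> y = (\<lambda>r. x r * y r)" "\<zero>\<^bsub>T\<^esub> = (\<lambda>r. 1)" "c \<odot>\<^bsub>T\<^esub> z = (\<lambda>r. z r ^ nat (c r))"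
  by (simp_all add: Tate_def)

text \<open>
  The Z_p-linear map to the Tate module with \<open>1 \<mapsto> \<zeta>\<close>, which is an isomorphism.
\<close>

definition tate_point :: "profint \<Rightarrow> nat \<Rightarrow> 'a" where "tate_point c = (\<lambda>r. \<zeta> (p ^ r) ^ nat (c r))"

lemma pp: "p ^ r > 0" using p_pos by simp

lemma Zp_nonneg: "c \<in> carrier (Zp p) \<Longrightarrow> 0 \<le> c r" and Zp_less: "c \<in> carrier (Zp p) \<Longrightarrow> c r < P r"
  using Zlim_range[of c p 1 r] by auto

lemma zeta_p_pow_eq_iff: "0 \<le> a \<Longrightarrow> 0 \<le> b \<Longrightarrow> \<zeta> (p ^ r) ^ nat a = \<zeta> (p ^ r) ^ nat b \<longleftrightarrow> [a = b] (mod P r)"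
  using zeta_pow_eq_iff[OF pp, of r "nat a" "nat b"] by (simp add: cong_int_iff[symmetric])

lemma zeta_p_step: "\<zeta> (p ^ Suc r) ^ p = \<zeta> (p ^ r)"
  using zeta_mult_pow[OF pp p_pos, of r] by (simp add: power_Suc mult.commute)

lemma tate_point_mem:
  assumes c: "c \<in> carrier (Zp p)"
  shows "tate_point c \<in> carrier T"
  unfolding Tate_carrier
proof (intro allI conjI)
  fix r
  show "tate_point c r ^ (p ^ r) = 1"
    unfolding tate_point_def using zeta_pow_1[OF pp, of r] by (metis power_mult mult.commute power_one)
  have "tate_point c (Suc r) ^ p = \<zeta> (p ^ r) ^ nat (c (Suc r))"
    unfolding tate_point_def zeta_p_step[of r, symmetric] by (simp only: power_mult[symmetric] mult.commute)
  also have "\<dots> = tate_point c r" unfolding tate_point_def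
    by (subst zeta_p_pow_eq_iff) (use c Zp_nonneg Zp_cong[OF c, of r "Suc r"] in auto)
  finally show "tate_point c (Suc r) ^ p = tate_point c r" .
qed

lemma tate_point_inj: "c \<in> carrier (Zp p) \<Longrightarrow> d \<in> carrier (Zp p) \<Longrightarrow> tate_point c = tate_point d \<longleftrightarrow> c = d"
proof
  assume c: "c \<in> carrier (Zp p)" and d: "d \<in> carrier (Zp p)" and eq: "tate_point c = tate_point d"
  have "[c r = d r] (mod P r)" for r
    using fun_cong[OF eq, of r] zeta_p_pow_eq_iff[of "c r" "d r" r] Zp_nonneg c d by (simp add: tate_point_def)
  then show "c = d" by (rule Zp_eqI[OF c d])
qed simp

lemma tate_point_surj:
  assumes z: "z \<in> carrier T"
  shows "\<exists>c\<in>carrier (Zp p). z = tate_point c"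
proof -
  have "\<forall>r. \<exists>k<p^r. z r = \<zeta> (p ^ r) ^ k"
    using z root_of_unity_zeta_pow[OF pp] by (simp add: Tate_carrier)
  then obtain k where k: "\<And>r. k r < p ^ r" "\<And>r. z r = \<zeta> (p ^ r) ^ k r" by metis
  have "[k (Suc r) = k r] (mod p ^ r)" for r
  proof -
    have "\<zeta> (p ^ r) ^ k (Suc r) = z (Suc r) ^ p"
      unfolding zeta_p_step[of r, symmetric] k(2) by (simp only: power_mult[symmetric] mult.commute)
    also have "\<dots> = \<zeta> (p ^ r) ^ k r" using z k(2) by (metis Tate_carrier)
    finally show ?thesis using zeta_pow_eq_iff[OF pp] by blast
  qed
  then have "(\<lambda>r. int (k r) mod P r) \<in> carrier (Zp p)"
    by (intro Zp_reduceI) (simp add: cong_int_iff)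
  moreover have "int (k r) mod P r = int (k r)" for r using k(1)[of r] by (simp flip: of_nat_mod)
  ultimately show ?thesis using k(2) by (intro bexI[of _ "\<lambda>r. int (k r)"]) (auto simp: tate_point_def)
qed

lemma tate_point_add:
  assumes "c \<in> carrier (Zp p)" "d \<in> carrier (Zp p)"
  shows "tate_point (\<lambda>r. (c r + d r) mod P r) = (\<lambda>r. tate_point c r * tate_point d r)"
proof
  fix r
  have "tate_point (\<lambda>r. (c r + d r) mod P r) r = \<zeta> (p ^ r) ^ nat (c r + d r)"
    unfolding tate_point_def using Zp_nonneg[OF assms(1), of r] Zp_nonneg[OF assms(2), of r] P_pos[of r]
    by (subst zeta_p_pow_eq_iff) (simp_all add: cong_def)
  then show "tate_point (\<lambda>r. (c r + d r) mod P r) r = tate_point c r * tate_point d r"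
    using Zp_nonneg[OF assms(1), of r] Zp_nonneg[OF assms(2), of r]
    by (simp add: tate_point_def nat_add_distrib power_add)
qed

lemma tate_point_pow:
  assumes "d \<in> carrier (Zp p)" "0 \<le> k"
  shows "tate_point d r ^ nat k = \<zeta> (p ^ r) ^ nat ((k * d r) mod P r)"
proof -
  have "\<zeta> (p ^ r) ^ nat ((k * d r) mod P r) = \<zeta> (p ^ r) ^ nat (k * d r)"
    using Zp_nonneg[OF assms(1), of r] assms(2) P_pos[of r]
    by (subst zeta_p_pow_eq_iff) (simp_all add: cong_def)
  then show ?thesis using assms(2) by (simp add: tate_point_def nat_mult_distrib power_mult[symmetric] mult.commute)
qed

lemma tate_point_smult:
  assumes "c \<in> carrier (Zp p)" "d \<in> carrier (Zp p)"
  shows "c \<odot>\<^bsub>T\<^esub> tate_point d = tate_point (\<lambda>r. (c r * d r) mod P r)"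
  using tate_point_pow[OF assms(2) Zp_nonneg[OF assms(1)]] by (simp add: Tate_simps tate_point_def fun_eq_iff)

lemma tate_point_one: "tate_point (\<lambda>r. 1 mod P r) = Tate_generator \<iota> p"
proof
  fix r
  have "tate_point (\<lambda>r. 1 mod P r) r = \<zeta> (p ^ r) ^ nat 1"
    unfolding tate_point_def using P_pos[of r] by (subst zeta_p_pow_eq_iff) (simp_all add: cong_def)
  then show "tate_point (\<lambda>r. 1 mod P r) r = Tate_generator \<iota> p r" by (simp add: Tate_generator_def)
qed

lemma abelian_group_Tate: "abelian_group T"
proof (rule abelian_groupI)
  fix x assume "x \<in> carrier T"
  then have "(\<lambda>r. inverse (x r)) \<in> carrier T" "(\<lambda>r. inverse (x r)) \<oplus>\<^bsub>T\<^esub> x = \<zero>\<^bsub>T\<^esub>"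
    using pp p_pos by (auto simp: Tate_carrier Tate_simps power_inverse fun_eq_iff)
      (metis inverse_1 nonzero_inverse_eq_imp_eq inverse_zero left_inverse power_0_left zero_neq_one less_numeral_extra(3) pp)
  then show "\<exists>y\<in>carrier T. y \<oplus>\<^bsub>T\<^esub> x = \<zero>\<^bsub>T\<^esub>" by blast
qed (auto simp: Tate_carrier Tate_simps power_mult_distrib mult_ac)

lemma Tate_finsum:
  assumes "finite A" "\<And>a. a \<in> A \<Longrightarrow> f a \<in> carrier T"
  shows "finsum T f A = (\<lambda>r. \<Prod>a\<in>A. f a r)"
proof -
  interpret T: abelian_group T by (rule abelian_group_Tate)
  show ?thesis using assms
  proof (induction A)
    case empty
    then show ?case by (simp add: Tate_simps)
  next
    case (insert a A)
    then have "finsum T f (insert a A) = f a \<oplus>\<^bsub>T\<^esub> finsum T f A" by (intro T.finsum_insert) auto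
    then show ?case using insert by (simp add: Tate_simps)
  qed
qed

lemma limitin_Tate:
  "limitin (Tate_topology p N :: (nat \<Rightarrow> 'a) topology) f z sequentially \<longleftrightarrow>
   z \<in> carrier T \<and> eventually (\<lambda>n. f n \<in> carrier T) sequentially \<and> (\<forall>m. eventually (\<lambda>n. f n m = z m) sequentially)"
proof -
  have "limitin (discrete_topology (UNIV :: 'a set)) g l sequentially \<longleftrightarrow> eventually (\<lambda>n. g n = l) sequentially" for g l
  proof
    assume "limitin (discrete_topology UNIV) g l sequentially"
    then show "eventually (\<lambda>n. g n = l) sequentially"
      unfolding limitin_def using openin_discrete_topology[of UNIV "{l}"] by auto
  qed (auto simp: limitin_def elim: eventually_mono)
  then show ?thesis
    by (simp add: Tate_topology_def limitin_subtopology limitin_componentwise)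
qed

end

section \<open>The Galois group of the cyclotomic field\<close>

context cyclotomic
begin

abbreviation n where "n r \<equiv> N * p ^ r"
abbreviation z where "z r \<equiv> \<zeta> (n r)"

lemma n_pos: "n r > 0" using p_pos N_pos by simp

lemma z_pow_n: "z r ^ n r = 1" by (rule zeta_pow_1[OF n_pos])

lemma z_lower: "r \<le> s \<Longrightarrow> z s ^ p ^ (s - r) = z r"
  using zeta_mult_pow[OF n_pos pp, of r "s - r"] by (simp add: mult.assoc power_add[symmetric])

lemma iv_mem: "a \<in> UZ \<Longrightarrow> iv a \<in> UZ" by (rule Zlim_Units_inv(2)[OF p_pos N_pos])

lemma UZ_carrier: "a \<in> UZ \<Longrightarrow> a \<in> carrier (Zlim p N)" by (rule Zlim_Units_inv(1)[OF p_pos N_pos])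

lemma unit_nat: "a \<in> UZ \<Longrightarrow> 0 \<le> a r"
  using Zlim_range[of a p N r] Zlim_Units_inv(1)[OF p_pos N_pos, of a] by auto

lemma unit_nat_coprime: "a \<in> UZ \<Longrightarrow> coprime (nat (a r)) (n r)"
  using Zlim_Units_coprime[OF p_pos N_pos, of a r] unit_nat[of a r]
  by (metis coprime_int_iff nat_0_le)

lemma conj_inverse:
  assumes "a \<in> UZ" "\<xi> ^ n r = (1 :: 'a)"
  shows "(\<xi> ^ nat (a r)) ^ nat ((iv a) r) = \<xi>"
proof -
  let ?b = "iv a"
  have b: "?b \<in> UZ" using iv_mem[OF assms(1)] .
  have "\<xi> ^ nat (a r * ?b r) = \<xi> ^ nat 1"
    by (rule root_pow_int_cong[OF assms(2)])
       (use unit_nat[OF assms(1)] unit_nat[OF b] Zlim_Units_inv(3)[OF p_pos N_pos assms(1), of r] in auto)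
  then show ?thesis using unit_nat[OF assms(1), of r] by (simp add: power_mult[symmetric] nat_mult_distrib)
qed

text \<open>
  The converse is the forward direction for the inverse of \<open>a\<close>.
\<close>

lemma conj_zero_iff:
  assumes a: "a \<in> UZ"
  shows "ipoly F (z r ^ nat (a r)) = 0 \<longleftrightarrow> ipoly F (z r) = 0"
proof
  assume "ipoly F (z r) = 0"
  then show "ipoly F (z r ^ nat (a r)) = 0"
    by (rule int_relation_conjugate[OF n_pos z_pow_n unit_nat_coprime[OF a]])
next
  assume F: "ipoly F (z r ^ nat (a r)) = 0"
  have b: "iv a \<in> UZ" by (rule iv_mem[OF a])
  have "(z r ^ nat (a r)) ^ n r = 1" using z_pow_n[of r] by (metis power_mult mult.commute power_one)
  from int_relation_conjugate[OF n_pos this unit_nat_coprime[OF b] F]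
  show "ipoly F (z r) = 0" by (simp only: conj_inverse[OF a z_pow_n])
qed

lemma conj_lower:
  assumes a: "a \<in> UZ" and "r \<le> s"
  shows "(z s ^ nat (a s)) ^ p ^ (s - r) = z r ^ nat (a r)"
proof -
  have "(z s ^ nat (a s)) ^ p ^ (s - r) = z r ^ nat (a s)"
    unfolding z_lower[OF assms(2), symmetric] by (simp only: power_mult[symmetric] mult.commute)
  also have "\<dots> = z r ^ nat (a r)"
    by (rule root_pow_int_cong[OF z_pow_n])
       (use unit_nat[OF a] Zlim_cong[OF Zlim_Units_inv(1)[OF p_pos N_pos a] assms(2)] in auto)
  finally show ?thesis .
qed

abbreviation frac :: "int poly \<Rightarrow> int poly \<Rightarrow> 'a \<Rightarrow> 'a" where "frac F G x \<equiv> ipoly F x / ipoly G x"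

text \<open>Substitution of \<open>X^e\<close>, which rewrites a polynomial in \<open>\<zeta>_{Np^r}\<close> at a finer level.\<close>

definition raise :: "int poly \<Rightarrow> nat \<Rightarrow> int poly" where "raise F e = pcompose F (Polynomial.monom 1 e)"

lemma ipoly_raise [simp]: "ipoly (raise F e) x = ipoly F (x ^ e)" by (simp add: raise_def)

text \<open>
  Quotients of integer polynomials in a single \<open>\<zeta>_{Np^r}\<close> form a field, because two of them can be
  rewritten at a common level.
\<close>

lemma K_frac:
  assumes "x \<in> K"
  obtains F G r where "ipoly G (z r) \<noteq> 0" "x = frac F G (z r)"
proof -
  have "\<exists>F G r. ipoly G (z r) \<noteq> 0 \<and> x = frac F G (z r)"
    using assms
  proof (induction rule: K_induct)
    case (root \<xi>)
    then obtain r where "\<xi> ^ n r = 1" by (auto simp: mu_infty_def)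
    then obtain k where "\<xi> = z r ^ k" using root_of_unity_zeta_pow[OF n_pos] by blast
    then show ?case by (intro exI[of _ "Polynomial.monom 1 k"] exI[of _ 1] exI[of _ r]) simp
  next
    case one
    show ?case by (intro exI[of _ 1]) simp
  next
    case (uminus x)
    then obtain F G r where "ipoly G (z r) \<noteq> 0" "x = frac F G (z r)" by blast
    then show ?case by (intro exI[of _ "- F"] exI[of _ G] exI[of _ r]) simp
  next
    case (inverse x)
    then obtain F G r where "ipoly G (z r) \<noteq> 0" "x = frac F G (z r)" by blast
    then show ?case using inverse(2) by (intro exI[of _ G] exI[of _ F] exI[of _ r]) auto
  next
    case (add x y)
    then obtain F G r F' G' r' where x: "ipoly G (z r) \<noteq> 0" "x = frac F G (z r)"
      and y: "ipoly G' (z r') \<noteq> 0" "y = frac F' G' (z r')" by blast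
    define s where "s = max r r'"
    have *: "z s ^ p ^ (s - r) = z r" "z s ^ p ^ (s - r') = z r'" by (simp_all add: z_lower s_def)
    show ?case
      by (rule exI[of _ "raise F (p ^ (s - r)) * raise G' (p ^ (s - r')) + raise F' (p ^ (s - r')) * raise G (p ^ (s - r))"],
          rule exI[of _ "raise G (p ^ (s - r)) * raise G' (p ^ (s - r'))"], rule exI[of _ s])
         (use x y in \<open>simp add: * add_frac_eq\<close>)
  next
    case (mult x y)
    then obtain F G r F' G' r' where x: "ipoly G (z r) \<noteq> 0" "x = frac F G (z r)"
      and y: "ipoly G' (z r') \<noteq> 0" "y = frac F' G' (z r')" by blast
    define s where "s = max r r'"
    have *: "z s ^ p ^ (s - r) = z r" "z s ^ p ^ (s - r') = z r'" by (simp_all add: z_lower s_def)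
    show ?case
      by (rule exI[of _ "raise F (p ^ (s - r)) * raise F' (p ^ (s - r'))"],
          rule exI[of _ "raise G (p ^ (s - r)) * raise G' (p ^ (s - r'))"], rule exI[of _ s])
         (use x y in \<open>simp add: *\<close>)
  qed
  then show ?thesis using that by blast
qed

lemma z_in_K: "z r \<in> K" using mu_subset_K root_in_mu z_pow_n by blast

lemma frac_in_K: "x \<in> K \<Longrightarrow> frac F G x \<in> K"
proof -
  assume x: "x \<in> K"
  have "ipoly F x \<in> K" for F by (induction F) (auto simp: K_0 K_add K_of_int K_mult x)
  then show ?thesis unfolding divide_inverse by (intro K_mult K_inverse)
qed

text \<open>
  The automorphism with cyclotomic character \<open>a\<close>: substitute \<open>\<zeta>_{Np^r}^a\<close> for \<open>\<zeta>_{Np^r}\<close> in any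
  representation as a quotient.
\<close>

definition conj_map :: "profint \<Rightarrow> 'a \<Rightarrow> 'a" where
  "conj_map a x = (THE y. \<exists>F G r. ipoly G (z r) \<noteq> 0 \<and> x = frac F G (z r) \<and> y = frac F G (z r ^ nat (a r)))"

text \<open>
  Independence of the representation: at a common level two representations of the same number differ
  by a polynomial relation for \<open>\<zeta>_{Np^s}\<close>, which is inherited by the conjugate.
\<close>

lemma conj_map_frac:
  assumes a: "a \<in> UZ" and G: "ipoly G (z r) \<noteq> 0"
  shows "conj_map a (frac F G (z r)) = frac F G (z r ^ nat (a r))"
  unfolding conj_map_def
proof (rule the_equality)
  show "\<exists>F' G' r'. ipoly G' (z r') \<noteq> 0 \<and> frac F G (z r) = frac F' G' (z r') \<and>
      frac F G (z r ^ nat (a r)) = frac F' G' (z r' ^ nat (a r'))"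
    using G by blast
next
  fix y assume "\<exists>F' G' r'. ipoly G' (z r') \<noteq> 0 \<and> frac F G (z r) = frac F' G' (z r') \<and>
      y = frac F' G' (z r' ^ nat (a r'))"
  then obtain F' G' r' where G': "ipoly G' (z r') \<noteq> 0" and eq: "frac F G (z r) = frac F' G' (z r')"
    and y: "y = frac F' G' (z r' ^ nat (a r'))" by blast
  define s where "s = max r r'"
  have *: "z s ^ p ^ (s - r) = z r" "z s ^ p ^ (s - r') = z r'" by (simp_all add: z_lower s_def)
  have **: "(z s ^ nat (a s)) ^ p ^ (s - r) = z r ^ nat (a r)" "(z s ^ nat (a s)) ^ p ^ (s - r') = z r' ^ nat (a r')"
    by (simp_all add: conj_lower[OF a] s_def)
  define H where "H = raise F (p ^ (s - r)) * raise G' (p ^ (s - r')) - raise F' (p ^ (s - r')) * raise G (p ^ (s - r))"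
  have "ipoly H (z s) = 0" using eq G G' by (simp add: H_def * frac_eq_eq)
  then have "ipoly H (z s ^ nat (a s)) = 0" using conj_zero_iff[OF a] by blast
  then show "y = frac F G (z r ^ nat (a r))"
    using G G' conj_zero_iff[OF a, of G r] conj_zero_iff[OF a, of G' r']
    by (simp add: H_def ** frac_eq_eq y)
qed

lemma conj_map_in_K: "a \<in> UZ \<Longrightarrow> x \<in> K \<Longrightarrow> conj_map a x \<in> K"
  by (elim K_frac) (simp add: conj_map_frac frac_in_K K_power z_in_K)

lemma K_frac2:
  assumes "x \<in> K" "y \<in> K"
  obtains F G F' G' r where "ipoly G (z r) \<noteq> 0" "x = frac F G (z r)" "ipoly G' (z r) \<noteq> 0" "y = frac F' G' (z r)"
proof -
  obtain F G r where x: "ipoly G (z r) \<noteq> 0" "x = frac F G (z r)" using assms(1) by (rule K_frac)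
  obtain F' G' r' where y: "ipoly G' (z r') \<noteq> 0" "y = frac F' G' (z r')" using assms(2) by (rule K_frac)
  define s where "s = max r r'"
  have *: "z s ^ p ^ (s - r) = z r" "z s ^ p ^ (s - r') = z r'" by (simp_all add: z_lower s_def)
  show ?thesis
    by (rule that[of "raise G (p ^ (s - r))" s "raise F (p ^ (s - r))" "raise G' (p ^ (s - r'))" "raise F' (p ^ (s - r'))"])
       (use x y in \<open>simp_all add: *\<close>)
qed

lemma conj_map_add:
  assumes a: "a \<in> UZ" and "x \<in> K" "y \<in> K"
  shows "conj_map a (x + y) = conj_map a x + conj_map a y"
proof -
  obtain F G F' G' r where x: "ipoly G (z r) \<noteq> 0" "x = frac F G (z r)" and y: "ipoly G' (z r) \<noteq> 0" "y = frac F' G' (z r)"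
    using K_frac2[OF assms(2,3)] by metis
  have "x + y = frac (F * G' + F' * G) (G * G') (z r)" using x y by (simp add: add_frac_eq)
  then have "conj_map a (x + y) = frac (F * G' + F' * G) (G * G') (z r ^ nat (a r))"
    using x y by (simp only:) (rule conj_map_frac[OF a], simp)
  then show ?thesis using x y conj_zero_iff[OF a, of G r] conj_zero_iff[OF a, of G' r]
    by (simp add: conj_map_frac[OF a] add_frac_eq)
qed

lemma conj_map_mult:
  assumes a: "a \<in> UZ" and "x \<in> K" "y \<in> K"
  shows "conj_map a (x * y) = conj_map a x * conj_map a y"
proof -
  obtain F G F' G' r where x: "ipoly G (z r) \<noteq> 0" "x = frac F G (z r)" and y: "ipoly G' (z r) \<noteq> 0" "y = frac F' G' (z r)"
    using K_frac2[OF assms(2,3)] by metis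
  have "x * y = frac (F * F') (G * G') (z r)" using x y by simp
  then have "conj_map a (x * y) = frac (F * F') (G * G') (z r ^ nat (a r))"
    using x y by (simp only:) (rule conj_map_frac[OF a], simp)
  then show ?thesis using x y by (simp add: conj_map_frac[OF a])
qed

lemma conj_map_root:
  assumes a: "a \<in> UZ" and "\<xi> ^ n r = 1"
  shows "conj_map a \<xi> = \<xi> ^ nat (a r)"
proof -
  obtain k where k: "\<xi> = z r ^ k" using assms(2) root_of_unity_zeta_pow[OF n_pos] by blast
  have "conj_map a (frac (Polynomial.monom 1 k) 1 (z r)) = frac (Polynomial.monom 1 k) 1 (z r ^ nat (a r))"
    by (rule conj_map_frac[OF a]) simp
  then show ?thesis by (simp add: k power_mult[symmetric] mult.commute)
qed

lemma conj_map_1: "a \<in> UZ \<Longrightarrow> conj_map a 1 = 1"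
  using conj_map_root[of a 1 0] by simp

lemma conj_map_inv:
  assumes a: "a \<in> UZ" and x: "x \<in> K"
  shows "conj_map (iv a) (conj_map a x) = x"
proof -
  let ?b = "iv a"
  have b: "?b \<in> UZ" by (rule iv_mem[OF a])
  obtain F G r where x: "ipoly G (z r) \<noteq> 0" "x = frac F G (z r)" using x by (rule K_frac)
  have "conj_map a x = frac (raise F (nat (a r))) (raise G (nat (a r))) (z r)"
    unfolding x(2) by (simp add: conj_map_frac[OF a x(1)])
  moreover have nz: "ipoly (raise G (nat (a r))) (z r) \<noteq> 0" using x(1) conj_zero_iff[OF a, of G r] by simp
  ultimately have "conj_map ?b (conj_map a x) = frac (raise F (nat (a r))) (raise G (nat (a r))) (z r ^ nat (?b r))"
    using conj_map_frac[OF b nz] by metis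
  also have "\<dots> = frac F G ((z r ^ nat (a r)) ^ nat (?b r))"
    by (simp add: power_mult[symmetric] mult.commute)
  finally show ?thesis by (simp add: conj_inverse[OF a z_pow_n] x(2))
qed

lemma iv_iv: "a \<in> UZ \<Longrightarrow> iv (iv a) = a"
proof -
  interpret cring "Zlim p N" by (rule Zlim_cring[OF p_pos N_pos])
  show "a \<in> UZ \<Longrightarrow> iv (iv a) = a" by (rule Units_inv_inv)
qed

lemma conj_map_inv': "a \<in> UZ \<Longrightarrow> x \<in> K \<Longrightarrow> conj_map a (conj_map (iv a) x) = x"
  using conj_map_inv[OF iv_mem, of a x] by (simp add: iv_iv)

lemma restrict_conj_map_in_Galois:
  assumes a: "a \<in> UZ"
  shows "restrict (conj_map a) K \<in> Galois p N"
proof -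
  have "bij_betw (conj_map a) K K"
    by (rule bij_betw_byWitness[of _ "conj_map (iv a)"])
       (use a conj_map_inv conj_map_inv' conj_map_in_K iv_mem[OF a] in auto)
  then have "bij_betw (restrict (conj_map a) K) K K" by (simp cong: bij_betw_cong)
  moreover have "restrict (conj_map a) K \<in> ring_hom (cyc_field p N) (cyc_field p N)"
    by (rule ring_hom_memI) (simp_all add: a K_add K_mult K_1 conj_map_add conj_map_mult conj_map_1 conj_map_in_K)
  ultimately show ?thesis by (simp add: Galois_def ring_iso_def)
qed

lemma Galois_eqI:
  assumes s: "\<sigma> \<in> Galois p N" and t: "\<tau> \<in> Galois p N" and eq: "\<And>\<xi>. \<xi> \<in> \<mu> \<Longrightarrow> \<sigma> \<xi> = (\<tau> \<xi> :: 'a)"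
  shows "\<sigma> = \<tau>"
proof -
  have hom: "\<rho> 1 = 1 \<and> (\<forall>x\<in>K. \<forall>y\<in>K. \<rho> (x + y) = \<rho> x + \<rho> y \<and> \<rho> (x * y) = \<rho> x * \<rho> y)"
    if "\<rho> \<in> Galois p N" for \<rho> :: "'a \<Rightarrow> 'a"
    using that by (auto simp: Galois_def ring_iso_def ring_hom_def)
  have \<rho>0: "\<rho> 0 = 0" if "\<rho> \<in> Galois p N" for \<rho> :: "'a \<Rightarrow> 'a"
    using hom[OF that] K_0 by (metis add_cancel_right_right add_0)
  have "\<sigma> x = \<tau> x" if "x \<in> K" for x
    using that
  proof (induction rule: K_induct)
    case (uminus x)
    have neg: "\<rho> (- x) = - \<rho> x" if "\<rho> \<in> Galois p N" for \<rho> :: "'a \<Rightarrow> 'a"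
      using hom[OF that] \<rho>0[OF that] uminus(1) K_uminus[OF uminus(1)] by (metis add.right_inverse minus_unique)
    show ?case using neg[OF s] neg[OF t] uminus by simp
  next
    case (inverse x)
    have inv: "\<rho> (inverse x) = inverse (\<rho> x)" if "\<rho> \<in> Galois p N" for \<rho> :: "'a \<Rightarrow> 'a"
      using hom[OF that] inverse(1,2) K_inverse[OF inverse(1)] by (metis right_inverse inverse_unique)
    show ?case using inv[OF s] inv[OF t] inverse by simp
  qed (use eq hom[OF s] hom[OF t] in auto)
  then show ?thesis using s t by (intro extensionalityI[of _ K]) (auto simp: Galois_def)
qed

abbreviation gal :: "profint \<Rightarrow> 'a \<Rightarrow> 'a" where "gal a \<equiv> galois_elt p N a"

lemma galois_elt_eq:
  assumes a: "a \<in> UZ"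
  shows "gal a = restrict (conj_map a) K"
  unfolding galois_elt_def
proof (rule the_equality)
  have rK: "\<xi> \<in> K" if "\<xi> ^ n r = 1" for \<xi> r using mu_subset_K root_in_mu that by blast
  show "restrict (conj_map a) K \<in> Galois p N \<and> (\<forall>r \<xi>. \<xi> ^ n r = 1 \<longrightarrow> restrict (conj_map a) K \<xi> = \<xi> ^ nat (a r))"
    using restrict_conj_map_in_Galois[OF a] conj_map_root[OF a] rK by auto
  fix \<sigma> :: "'a \<Rightarrow> 'a" assume \<sigma>: "\<sigma> \<in> Galois p N \<and> (\<forall>r \<xi>. \<xi> ^ n r = 1 \<longrightarrow> \<sigma> \<xi> = \<xi> ^ nat (a r))"
  show "\<sigma> = restrict (conj_map a) K"
  proof (rule Galois_eqI[OF _ restrict_conj_map_in_Galois[OF a]])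
    fix \<xi> assume "\<xi> \<in> \<mu>"
    then obtain r where "\<xi> ^ n r = 1" by (auto simp: mu_infty_def)
    then show "\<sigma> \<xi> = restrict (conj_map a) K \<xi>" using \<sigma> conj_map_root[OF a] rK by auto
  qed (use \<sigma> in simp)
qed

lemma gal_eq_conj_map: "a \<in> UZ \<Longrightarrow> x \<in> K \<Longrightarrow> gal a x = conj_map a x"
  by (simp add: galois_elt_eq)

lemma gal_mult: "a \<in> UZ \<Longrightarrow> x \<in> K \<Longrightarrow> y \<in> K \<Longrightarrow> gal a (x * y) = gal a x * gal a y"
  by (simp add: gal_eq_conj_map conj_map_mult K_mult)

lemma gal_inv: "a \<in> UZ \<Longrightarrow> x \<in> K \<Longrightarrow> gal (iv a) (gal a x) = x"
  by (simp add: gal_eq_conj_map conj_map_in_K iv_mem conj_map_inv)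

lemma gal_inv': "a \<in> UZ \<Longrightarrow> x \<in> K \<Longrightarrow> gal a (gal (iv a) x) = x"
  by (simp add: gal_eq_conj_map conj_map_in_K iv_mem conj_map_inv')

lemma gal_1: "a \<in> UZ \<Longrightarrow> gal a 1 = 1"
  by (simp add: gal_eq_conj_map K_1 conj_map_1)

lemma gal_root: "a \<in> UZ \<Longrightarrow> \<xi> ^ n r = 1 \<Longrightarrow> gal a \<xi> = \<xi> ^ nat (a r)"
  using gal_eq_conj_map[of a \<xi>] conj_map_root[of a \<xi> r] mu_subset_K root_in_mu by metis

lemma gal_one_minus_root:
  assumes a: "a \<in> UZ" and "\<xi> ^ n r = 1"
  shows "gal a (1 - \<xi>) = 1 - \<xi> ^ nat (a r)"
proof -
  have \<xi>: "\<xi> \<in> K" using mu_subset_K root_in_mu assms(2) by blast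
  have "conj_map a (1 - \<xi>) + conj_map a \<xi> = 1"
    using conj_map_add[OF a K_diff[OF K_1 \<xi>] \<xi>] by (simp add: conj_map_1[OF a])
  then show ?thesis using \<xi> conj_map_root[OF a assms(2)] by (simp add: gal_eq_conj_map[OF a] K_diff K_1 eq_diff_eq)
qed

text \<open>
  The Galois group acts continuously on the discrete field.
\<close>

lemma gal_eq_of_level:
  assumes "x \<in> K"
  obtains t where "\<And>a b. a \<in> UZ \<Longrightarrow> b \<in> UZ \<Longrightarrow> a t = b t \<Longrightarrow> gal a x = gal b x"
proof -
  obtain F G r where x: "ipoly G (z r) \<noteq> 0" "x = frac F G (z r)" using assms by (rule K_frac)
  show ?thesis by (rule that[of r]) (use assms in \<open>simp add: gal_eq_conj_map, simp add: x conj_map_frac\<close>)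
qed

end

section \<open>Pro-p completions of abelian groups\<close>

text \<open>
  \<open>pker\<close> is the set of subgroups of p-power index, \<open>Ghat\<close> the completion and \<open>to_Ghat\<close> the map to it.
\<close>

locale p_completion = comm_group G for p :: nat and G :: "('g, 'x) monoid_scheme" (structure) +
  assumes prime_p: "Factorial_Ring.prime p"
begin

abbreviation pker where "pker \<equiv> p_quot_kernels p G"

lemma pker_iff: "B \<in> pker \<longleftrightarrow> B \<lhd> G \<and> (\<exists>k. order (G Mod B) = p ^ k)"
  by (simp add: p_quot_kernels_def)

lemma pker_normal: "B \<in> pker \<Longrightarrow> B \<lhd> G" by (simp add: pker_iff)

lemma pker_subgroup: "B \<in> pker \<Longrightarrow> subgroup B G" using pker_normal normal_iff_subgroup by blast

text \<open>
  The quotient by the kernel embeds into \<open>H\<close>, so that its order divides that of \<open>H\<close>.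
\<close>

lemma kernel_in_pker:
  assumes H: "group H" and h: "h \<in> hom G H" and ord: "order H = p ^ k"
  shows "kernel G H h \<in> pker"
proof -
  interpret h: group_hom G H h by (simp add: group_hom_def group_hom_axioms_def H h is_group)
  let ?f = "\<lambda>Y. the_elem (h ` Y)" and ?Q = "G Mod kernel G H h"
  have Q: "group ?Q" by (rule normal.factorgroup_is_group[OF h.normal_kernel])
  interpret f: group_hom ?Q H ?f
    by (simp add: group_hom_def group_hom_axioms_def H Q h.FactGroup_hom)
  have "order ?Q = card (?f ` carrier ?Q)"
    unfolding order_def by (rule card_image[OF h.FactGroup_inj_on, symmetric])
  moreover have "card (?f ` carrier ?Q) dvd order H"
    using group.lagrange[OF H f.img_is_subgroup] by (metis dvd_triv_right)
  ultimately have "\<exists>i. order ?Q = p ^ i"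
    unfolding ord using divides_primepow_nat[OF prime_p] by metis
  then show ?thesis unfolding pker_iff using h.normal_kernel by blast
qed

lemma carrier_in_pker: "carrier G \<in> pker"
proof -
  have "rcosets (carrier G) = {carrier G}"
    unfolding RCOSETS_def using coset_join2[OF _ subgroup_self] by force
  then have "order (G Mod carrier G) = p ^ 0" by (simp add: order_def FactGroup_def)
  moreover have "carrier G \<lhd> G" using normal_iff_subgroup subgroup_self by blast
  ultimately show ?thesis unfolding pker_iff by blast
qed

lemma inter_in_pker:
  assumes B: "B \<in> pker" and C: "C \<in> pker"
  shows "B \<inter> C \<in> pker"
proof -
  interpret B: normal B G by (rule pker_normal[OF B])
  interpret C: normal C G by (rule pker_normal[OF C])
  \<comment> \<open>The intersection is the kernel of the diagonal map.\<close>
  let ?H = "(G Mod B) \<times>\<times> (G Mod C)" and ?h = "\<lambda>g. (B #> g, C #> g)"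
  have H: "group ?H" by (rule DirProd_group[OF B.factorgroup_is_group C.factorgroup_is_group])
  have h: "?h \<in> hom G ?H"
    using B.r_coset_hom_Mod C.r_coset_hom_Mod by (auto simp: hom_def)
  obtain k l where "order (G Mod B) = p ^ k" "order (G Mod C) = p ^ l" using B C pker_iff by blast
  then have "order ?H = p ^ (k + l)"
    by (simp add: order_def DirProd_def card_cartesian_product power_add)
  from kernel_in_pker[OF H h this] have "kernel G ?H ?h \<in> pker" .
  moreover have "kernel G ?H ?h = B \<inter> C"
    using B.rcos_const C.rcos_const rcos_self[OF _ B.subgroup_axioms] rcos_self[OF _ C.subgroup_axioms] B.subset
    by (auto simp: kernel_def)
  ultimately show ?thesis by simp
qed

lemma finite_inter_in_pker:
  assumes "finite \<F>" "\<F> \<subseteq> pker"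
  shows "\<exists>C\<in>pker. \<forall>B\<in>\<F>. C \<subseteq> B"
  using assms
proof (induction \<F>)
  case empty
  then show ?case using carrier_in_pker by blast
next
  case (insert B \<F>)
  then obtain C where "C \<in> pker" "\<forall>B\<in>\<F>. C \<subseteq> B" by auto
  then show ?case using inter_in_pker[of B C] insert.prems by (intro bexI[of _ "B \<inter> C"]) auto
qed

abbreviation Ghat where "Ghat \<equiv> pro_p_completion p G"

abbreviation to_Ghat where "to_Ghat \<equiv> to_pro_p p G"

lemma FactGroup_simps:
  "carrier (G Mod B) = rcosets B" "x \<otimes>\<^bsub>G Mod B\<^esub> y = x <#> y" "\<one>\<^bsub>G Mod B\<^esub> = B"
  by (simp_all add: FactGroup_def)

lemma Ghat_carrier:
  "x \<in> carrier Ghat \<longleftrightarrow> x \<in> extensional pker \<and> (\<forall>B\<in>pker. x B \<in> rcosets B) \<and> (\<forall>B\<in>pker. \<forall>C\<in>pker. B \<subseteq> C \<longrightarrow> x B \<subseteq> x C)"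
  by (auto simp: pro_p_completion_def FactGroup_simps PiE_iff)

lemma Ghat_mult: "x \<otimes>\<^bsub>Ghat\<^esub> y = (\<lambda>B\<in>pker. x B <#> y B)"
  by (simp add: pro_p_completion_def FactGroup_simps)

lemma Ghat_coset:
  assumes "x \<in> carrier Ghat" "B \<in> pker"
  obtains g where "g \<in> carrier G" "x B = B #> g"
  using assms by (auto simp: Ghat_carrier RCOSETS_def)

lemma Ghat_nonempty: "x \<in> carrier Ghat \<Longrightarrow> B \<in> pker \<Longrightarrow> \<exists>g\<in>carrier G. g \<in> x B"
  using Ghat_coset[of x B] rcos_self pker_subgroup by metis

lemma Ghat_in_carrier: "x \<in> carrier Ghat \<Longrightarrow> B \<in> pker \<Longrightarrow> g \<in> x B \<Longrightarrow> g \<in> carrier G"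
  using Ghat_coset[of x B] r_coset_subset_G pker_subgroup subgroup.subset by (metis subsetD)

lemma Ghat_eq_coset: "x \<in> carrier Ghat \<Longrightarrow> B \<in> pker \<Longrightarrow> g \<in> x B \<Longrightarrow> x B = B #> g"
  using Ghat_coset[of x B] repr_independence pker_subgroup by metis

lemma Ghat_mult_closed:
  assumes x: "x \<in> carrier Ghat" and y: "y \<in> carrier Ghat"
  shows "x \<otimes>\<^bsub>Ghat\<^esub> y \<in> carrier Ghat"
  unfolding Ghat_carrier Ghat_mult
proof (intro conjI ballI impI)
  fix B assume B: "B \<in> pker"
  obtain g h where "g \<in> carrier G" "x B = B #> g" "h \<in> carrier G" "y B = B #> h"
    using Ghat_coset[OF x B] Ghat_coset[OF y B] by metis
  then show "(\<lambda>B\<in>pker. x B <#> y B) B \<in> rcosets B"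
    using B normal.rcos_sum[OF pker_normal[OF B]] by (auto simp: RCOSETS_def)
next
  fix B C assume "B \<in> pker" "C \<in> pker" "B \<subseteq> C"
  then show "(\<lambda>B\<in>pker. x B <#> y B) B \<subseteq> (\<lambda>B\<in>pker. x B <#> y B) C"
    using x y by (simp add: Ghat_carrier mono_set_mult)
qed simp

lemma to_Ghat_apply: "B \<in> pker \<Longrightarrow> to_Ghat g B = B #> g" by (simp add: to_pro_p_def)

lemma to_Ghat_mem: "g \<in> carrier G \<Longrightarrow> to_Ghat g \<in> carrier Ghat"
  unfolding Ghat_carrier to_pro_p_def by (auto simp: RCOSETS_def r_coset_def)

lemma self_in_to_Ghat: "g \<in> carrier G \<Longrightarrow> B \<in> pker \<Longrightarrow> g \<in> to_Ghat g B"
  using rcos_self pker_subgroup by (simp add: to_Ghat_apply)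

lemma to_Ghat_mult: "g \<in> carrier G \<Longrightarrow> h \<in> carrier G \<Longrightarrow> to_Ghat (g \<otimes> h) = to_Ghat g \<otimes>\<^bsub>Ghat\<^esub> to_Ghat h"
  unfolding Ghat_mult to_pro_p_def using normal.rcos_sum[OF pker_normal] by (auto simp: fun_eq_iff)

lemma pro_p_topology_topspace: "topspace (pro_p_topology p G) = carrier Ghat"
  by (auto simp: pro_p_topology_def Ghat_carrier FactGroup_simps PiE_iff extensional_def)

lemma continuous_component:
  assumes "B \<in> pker"
  shows "continuous_map (pro_p_topology p G) (discrete_topology UNIV) (\<lambda>x. h (x B))"
proof -
  have "continuous_map (pro_p_topology p G) (discrete_topology (carrier (G Mod B))) (\<lambda>x. x B)"
    unfolding pro_p_topology_def
    by (intro continuous_map_from_subtopology continuous_map_product_projection assms)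
  moreover have "continuous_map (discrete_topology (carrier (G Mod B))) (discrete_topology UNIV) h"
    by simp
  ultimately show ?thesis by (rule continuous_map_compose[unfolded o_def])
qed

text \<open>
  A basic open set constrains only finitely many components, and all of them are determined by the
  component at the intersection of the subgroups in question.
\<close>

lemma dense_classes:
  assumes W: "openin (pro_p_topology p G) W" and x: "x \<in> W"
  shows "\<exists>g\<in>carrier G. to_Ghat g \<in> W"
proof -
  let ?D = "\<lambda>B. discrete_topology (carrier (G Mod B))"
  obtain W' where W': "openin (product_topology ?D pker) W'" "W = W' \<inter> carrier Ghat"
    using W by (auto simp: pro_p_topology_def openin_subtopology)
  then obtain V where V: "finite {B \<in> pker. V B \<noteq> topspace (?D B)}" "x \<in> Pi\<^sub>E pker V" "Pi\<^sub>E pker V \<subseteq> W'"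
    using x by (auto simp: openin_product_topology_alt)
  have xC: "x \<in> carrier Ghat" using x W' by blast
  let ?F = "{B \<in> pker. V B \<noteq> topspace (?D B)}"
  obtain C where C: "C \<in> pker" "\<forall>B\<in>?F. C \<subseteq> B" using finite_inter_in_pker[OF V(1)] by auto
  obtain g where g: "g \<in> carrier G" "g \<in> x C" using Ghat_nonempty[OF xC C(1)] by blast
  have "to_Ghat g B \<in> V B" if B: "B \<in> pker" for B
  proof (cases "B \<in> ?F")
    case True
    then have "x C \<subseteq> x B" using C B xC by (simp add: Ghat_carrier)
    then have "x B = to_Ghat g B" using Ghat_eq_coset[OF xC B] g to_Ghat_apply[OF B] by auto
    then show ?thesis using PiE_mem[OF V(2) B] by simp
  next
    case False
    then have "V B = carrier (G Mod B)" using B by simp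
    then show ?thesis using to_Ghat_mem[OF g(1)] B by (simp add: Ghat_carrier FactGroup_simps)
  qed
  then have "to_Ghat g \<in> Pi\<^sub>E pker V" using to_Ghat_mem[OF g(1)] by (auto simp: PiE_iff Ghat_carrier)
  then show ?thesis using V(3) W'(2) to_Ghat_mem[OF g(1)] g(1) by blast
qed

lemma continuous_eqI:
  assumes f: "continuous_map (pro_p_topology p G) (discrete_topology UNIV) f"
    and f': "continuous_map (pro_p_topology p G) (discrete_topology UNIV) f'"
    and eq: "\<And>g. g \<in> carrier G \<Longrightarrow> f (to_Ghat g) = f' (to_Ghat g)" and x: "x \<in> carrier Ghat"
  shows "f x = f' x"
proof -
  let ?W = "{y \<in> carrier Ghat. f y \<in> {f x}} \<inter> {y \<in> carrier Ghat. f' y \<in> {f' x}}"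
  have "openin (pro_p_topology p G) ?W"
    using openin_continuous_map_preimage[OF f, of "{f x}"] openin_continuous_map_preimage[OF f', of "{f' x}"]
    by (intro openin_Int) (simp_all add: pro_p_topology_topspace)
  from dense_classes[OF this, of x] x eq show ?thesis by auto
qed

text \<open>
  The preimage of \<open>B\<close> under \<open>\<sigma>\<close> has p-power index, being the kernel of \<open>G \<rightarrow> G \<rightarrow> G/B\<close>, so the
  automorphism of the completion does look at one of its components.
\<close>

lemma pro_p_aut_to_Ghat:
  assumes \<sigma>: "\<sigma> \<in> hom G G" "\<sigma> ` carrier G = carrier G" and g: "g \<in> carrier G"
  shows "pro_p_aut p G \<sigma> (to_Ghat g) = to_Ghat (\<sigma> g)"
proof -
  have "\<sigma> ` to_Ghat g {u \<in> carrier G. \<sigma> u \<in> B} = B #> \<sigma> g" if B: "B \<in> pker" for B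
  proof -
    let ?B = "{u \<in> carrier G. \<sigma> u \<in> B}"
    interpret B: normal B G by (rule pker_normal[OF B])
    obtain k where k: "order (G Mod B) = p ^ k" using B pker_iff by blast
    have \<sigma>c: "\<sigma> u \<in> carrier G" if "u \<in> carrier G" for u using that \<sigma>(1) by (auto simp: hom_def)
    have "(\<lambda>u. B #> \<sigma> u) \<in> hom G (G Mod B)"
      using \<sigma>(1) \<sigma>c by (intro homI) (auto simp only: hom_def mem_Collect_eq FactGroup_simps RCOSETS_def B.rcos_sum)
    from kernel_in_pker[OF B.factorgroup_is_group this k]
    have "kernel G (G Mod B) (\<lambda>u. B #> \<sigma> u) \<in> pker" .
    moreover have "kernel G (G Mod B) (\<lambda>u. B #> \<sigma> u) = ?B"
      using B.rcos_const rcos_self[OF \<sigma>c B.subgroup_axioms] by (auto simp: kernel_def FactGroup_simps)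
    ultimately have "?B \<in> pker" by simp
    then have "\<sigma> ` to_Ghat g ?B = \<sigma> ` (?B #> g)" by (simp add: to_Ghat_apply)
    also have "\<dots> = B #> \<sigma> g"
    proof
      show "\<sigma> ` (?B #> g) \<subseteq> B #> \<sigma> g"
        using \<sigma>(1) g by (auto simp: r_coset_def hom_def)
      show "B #> \<sigma> g \<subseteq> \<sigma> ` (?B #> g)"
      proof
        fix v assume "v \<in> B #> \<sigma> g"
        then obtain b where b: "b \<in> B" "v = b \<otimes> \<sigma> g" by (auto simp: r_coset_def)
        then obtain u where u: "u \<in> carrier G" "b = \<sigma> u" using \<sigma>(2) B.subset by blast
        then have "v = \<sigma> (u \<otimes> g)" using \<sigma>(1) g b by (simp add: hom_def)
        moreover have "u \<otimes> g \<in> ?B #> g" using u b by (auto simp: r_coset_def)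
        ultimately show "v \<in> \<sigma> ` (?B #> g)" by blast
      qed
    qed
    finally show ?thesis .
  qed
  then show ?thesis unfolding pro_p_aut_def by (auto simp: to_pro_p_def fun_eq_iff)
qed

end

section \<open>Cyclotomic units and their dual\<close>

context cyclotomic
begin

abbreviation Cyc :: "'a monoid" where "Cyc \<equiv> cyc_units p N"

lemma Cyc_simps [simp]: "x \<otimes>\<^bsub>Cyc\<^esub> y = x * y" "\<one>\<^bsub>Cyc\<^esub> = 1"
  by (simp_all add: cyc_units_def)

lemma field_cyc_field: "field (cyc_field p N :: 'a ring)"
  unfolding cyc_field_def
  by (rule field.generate_field_is_field[OF field_from_type_algebra]) simp

lemma Cyc_carrier:
  "carrier Cyc = generate (Ring_Divisibility.mult_of (cyc_field p N)) {1 - \<xi> | \<xi>. \<xi> \<in> \<mu> \<and> \<xi> \<noteq> 1}"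
proof -
  have "carrier (Ring_Divisibility.mult_of (cyc_field p N)) \<inter> {1 - \<xi> | \<xi>. \<xi> \<in> \<mu> \<and> \<xi> \<noteq> 1} = {1 - \<xi> | \<xi>::'a. \<xi> \<in> \<mu> \<and> \<xi> \<noteq> 1}"
    using K_diff[OF K_1] mu_subset_K by auto
  then show ?thesis by (simp add: cyc_units_def carrier_subgroup_generated)
qed

lemma group_mult_of: "group (Ring_Divisibility.mult_of (cyc_field p N :: 'a ring))"
  using field.field_mult_group[OF field_cyc_field]
  by (simp add: Ring_Divisibility.mult_of_def Multiplicative_Group.mult_of_def)

lemma comm_group_mult_of: "comm_group (Ring_Divisibility.mult_of (cyc_field p N :: 'a ring))"
  using group.group_comm_groupI[OF group_mult_of] by (simp add: mult.commute)

lemma comm_group_Cyc: "comm_group Cyc"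
  unfolding cyc_units_def
  by (intro group.abelian_subgroup_generated comm_group_mult_of comm_group.axioms(2))

lemma mult_of_inv: "x \<in> K \<Longrightarrow> x \<noteq> 0 \<Longrightarrow> inv\<^bsub>Ring_Divisibility.mult_of (cyc_field p N)\<^esub> x = inverse x"
  by (rule group.inv_equality[OF group_mult_of]) (simp_all add: K_inverse)

lemma Cyc_in_K: "u \<in> carrier Cyc \<Longrightarrow> u \<in> K \<and> u \<noteq> 0"
  unfolding Cyc_carrier
  by (induction rule: generate.induct) (auto simp: K_1 K_mult K_diff mu_subset_K mult_of_inv K_inverse)

lemma Cyc_one_minus: "\<xi> \<in> \<mu> \<Longrightarrow> \<xi> \<noteq> 1 \<Longrightarrow> 1 - \<xi> \<in> carrier Cyc"
  unfolding Cyc_carrier by (rule generate.incl) blast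

lemma Cyc_mult: "u \<in> carrier Cyc \<Longrightarrow> v \<in> carrier Cyc \<Longrightarrow> u * v \<in> carrier Cyc"
  using monoid.m_closed[of Cyc u v] comm_group_Cyc by (simp add: comm_group_def group_def)

lemma Cyc_inverse: "u \<in> carrier Cyc \<Longrightarrow> inverse u \<in> carrier Cyc"
proof -
  assume u: "u \<in> carrier Cyc"
  interpret comm_group Cyc by (rule comm_group_Cyc)
  have "inv\<^bsub>Cyc\<^esub> u * u = 1" using u l_inv by simp
  then have "inv\<^bsub>Cyc\<^esub> u = inverse u" using inverse_unique[of u "inv\<^bsub>Cyc\<^esub> u"] by (simp add: mult.commute)
  then show ?thesis using inv_closed[OF u] by simp
qed

lemma Cyc_1: "1 \<in> carrier Cyc"
  using monoid.one_closed[of Cyc] comm_group_Cyc by (simp add: comm_group_def group_def)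

lemma Cyc_induct [consumes 1, case_names generator one inverse mult]:
  assumes "u \<in> carrier Cyc" "\<And>\<xi>. \<xi> \<in> \<mu> \<Longrightarrow> \<xi> \<noteq> 1 \<Longrightarrow> Pr (1 - \<xi>)" "Pr 1"
    "\<And>u. u \<in> carrier Cyc \<Longrightarrow> Pr u \<Longrightarrow> Pr (inverse u)"
    "\<And>u v. u \<in> carrier Cyc \<Longrightarrow> v \<in> carrier Cyc \<Longrightarrow> Pr u \<Longrightarrow> Pr v \<Longrightarrow> Pr (u * v)"
  shows "Pr u"
  using assms(1) unfolding Cyc_carrier
proof (induction rule: generate.induct)
  case (inv h)
  then obtain \<xi> where \<xi>: "h = 1 - \<xi>" "\<xi> \<in> \<mu>" "\<xi> \<noteq> 1" by blast
  then have "h \<in> carrier Cyc" by (simp add: Cyc_one_minus)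
  then show ?case using assms(2,4) \<xi> mult_of_inv[of h] Cyc_in_K[of h] by simp
qed (use assms in \<open>auto simp: Cyc_carrier\<close>)

sublocale CycHat: p_completion p Cyc
  using comm_group_Cyc p_prime by (simp add: p_completion_def p_completion_axioms_def)

lemma gal_0: "a \<in> UZ \<Longrightarrow> gal a 0 = 0"
  using gal_one_minus_root[of a 1 0] by simp

lemma gal_eq_0_iff: "a \<in> UZ \<Longrightarrow> x \<in> K \<Longrightarrow> gal a x = 0 \<longleftrightarrow> x = 0"
  using gal_inv[of a x] gal_0[of a] gal_0[OF iv_mem[of a]] by auto

lemma gal_inverse: "a \<in> UZ \<Longrightarrow> x \<in> K \<Longrightarrow> gal a (inverse x) = inverse (gal a x)"
proof (cases "x = 0")
  case False
  assume a: "a \<in> UZ" and x: "x \<in> K"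
  have "gal a x * gal a (inverse x) = 1"
    using gal_mult[OF a x K_inverse[OF x]] False by (simp add: gal_1[OF a])
  then show ?thesis by (simp add: inverse_unique)
qed (simp add: gal_0)

lemma mu_power: "\<xi> \<in> \<mu> \<Longrightarrow> \<xi> ^ k \<in> \<mu>"
  by (auto simp: mu_infty_def) (metis power_mult mult.commute power_one)

lemma gal_Cyc:
  assumes a: "a \<in> UZ" and u: "u \<in> carrier Cyc"
  shows "gal a u \<in> carrier Cyc"
  using u
proof (induction rule: Cyc_induct)
  case (generator \<xi>)
  then obtain r where r: "\<xi> ^ n r = 1" by (auto simp: mu_infty_def)
  have "1 - \<xi> ^ nat (a r) \<noteq> 0"
    using gal_eq_0_iff[OF a, of "1 - \<xi>"] K_diff[OF K_1 mu_subset_K] generator gal_one_minus_root[OF a r] by simp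
  then show ?case using generator r by (simp add: gal_one_minus_root[OF a r] Cyc_one_minus mu_power)
next
  case one
  show ?case by (simp add: gal_1[OF a] Cyc_1)
next
  case (inverse u)
  then show ?case using Cyc_in_K[of u] by (simp add: gal_inverse[OF a] Cyc_inverse)
next
  case (mult u v)
  then show ?case using Cyc_in_K[of u] Cyc_in_K[of v] by (simp add: gal_mult[OF a] Cyc_mult)
qed

lemma gal_hom_Cyc:
  assumes a: "a \<in> UZ"
  shows "gal a \<in> hom Cyc Cyc" "gal a ` carrier Cyc = carrier Cyc"
proof -
  show "gal a \<in> hom Cyc Cyc" by (rule homI) (use gal_Cyc[OF a] Cyc_in_K gal_mult[OF a] in auto)
  have "u \<in> gal a ` carrier Cyc" if "u \<in> carrier Cyc" for u
    using gal_inv'[OF a, of u] gal_Cyc[OF iv_mem[OF a] that] Cyc_in_K[OF that]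
    by (metis imageI)
  then show "gal a ` carrier Cyc = carrier Cyc" using gal_Cyc[OF a] by auto
qed

subsection \<open>Continuous homomorphisms\<close>

abbreviation unit_class :: "'a \<Rightarrow> 'a set \<Rightarrow> 'a set" where "unit_class \<equiv> CK_class p N"
abbreviation Cyc_hat :: "('a set \<Rightarrow> 'a set) monoid" where "Cyc_hat \<equiv> CK p N"
abbreviation Dual where "Dual \<equiv> CK_dual_carrier p N :: (('a set \<Rightarrow> 'a set) \<Rightarrow> nat \<Rightarrow> 'a) set"

lemma unit_class_mem: "u \<in> carrier Cyc \<Longrightarrow> unit_class u \<in> carrier Cyc_hat"
  by (simp add: CK_class_def CycHat.to_Ghat_mem)

lemma Dual_mem: "\<phi> \<in> Dual \<Longrightarrow> x \<in> carrier Cyc_hat \<Longrightarrow> \<phi> x \<in> carrier T"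
  by (auto simp: CK_dual_carrier_def hom_def)

lemma Dual_mult: "\<phi> \<in> Dual \<Longrightarrow> x \<in> carrier Cyc_hat \<Longrightarrow> y \<in> carrier Cyc_hat \<Longrightarrow>
    \<phi> (x \<otimes>\<^bsub>Cyc_hat\<^esub> y) = (\<lambda>r. \<phi> x r * \<phi> y r)"
  by (auto simp: CK_dual_carrier_def hom_def Tate_simps)

text \<open>
  The logarithm of \<open>\<phi>\<close> at a unit, with respect to the generator \<open>\<zeta>\<close> of the Tate module.
\<close>

definition dlog :: "(('a set \<Rightarrow> 'a set) \<Rightarrow> nat \<Rightarrow> 'a) \<Rightarrow> 'a \<Rightarrow> profint"
  where "dlog \<phi> u = (SOME c. c \<in> carrier (Zp p) \<and> \<phi> (unit_class u) = tate_point c)"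

lemma dlog:
  assumes "\<phi> \<in> Dual" "u \<in> carrier Cyc"
  shows "dlog \<phi> u \<in> carrier (Zp p)" "\<phi> (unit_class u) = tate_point (dlog \<phi> u)"
proof -
  have "\<exists>c. c \<in> carrier (Zp p) \<and> \<phi> (unit_class u) = tate_point c"
    using tate_point_surj[OF Dual_mem[OF assms(1) unit_class_mem[OF assms(2)]]] by blast
  then have "dlog \<phi> u \<in> carrier (Zp p) \<and> \<phi> (unit_class u) = tate_point (dlog \<phi> u)" unfolding dlog_def by (rule someI_ex)
  then show "dlog \<phi> u \<in> carrier (Zp p)" "\<phi> (unit_class u) = tate_point (dlog \<phi> u)" by auto
qed

lemma dlog_eqI: "\<phi> \<in> Dual \<Longrightarrow> u \<in> carrier Cyc \<Longrightarrow> c \<in> carrier (Zp p) \<Longrightarrow> \<phi> (unit_class u) = tate_point c \<Longrightarrow> dlog \<phi> u = c"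
  using dlog[of \<phi> u] tate_point_inj by auto

lemma dlog_mult:
  assumes "\<phi> \<in> Dual" "u \<in> carrier Cyc" "v \<in> carrier Cyc"
  shows "dlog \<phi> (u * v) = (\<lambda>m. (dlog \<phi> u m + dlog \<phi> v m) mod P m)"
proof (rule dlog_eqI)
  have "unit_class (u * v) = unit_class u \<otimes>\<^bsub>Cyc_hat\<^esub> unit_class v"
    using CycHat.to_Ghat_mult[of u v] assms by (simp add: CK_class_def)
  then show "\<phi> (unit_class (u * v)) = tate_point (\<lambda>m. (dlog \<phi> u m + dlog \<phi> v m) mod P m)"
    using Dual_mult[OF assms(1) unit_class_mem[OF assms(2)] unit_class_mem[OF assms(3)]]
    by (simp only: dlog(2)[OF assms(1,2)] dlog(2)[OF assms(1,3)] tate_point_add[OF dlog(1)[OF assms(1,2)] dlog(1)[OF assms(1,3)]])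
  show "\<phi> \<in> Dual" "u * v \<in> carrier Cyc" using assms by (simp_all add: Cyc_mult)
  show "(\<lambda>m. (dlog \<phi> u m + dlog \<phi> v m) mod P m) \<in> carrier (Zp p)"
    by (intro Zp_add_mem dlog assms)
qed

lemma dlog_one: "\<phi> \<in> Dual \<Longrightarrow> dlog \<phi> 1 = (\<lambda>m. 0)"
proof
  fix m assume \<phi>: "\<phi> \<in> Dual"
  have "dlog \<phi> 1 m = (dlog \<phi> 1 m + dlog \<phi> 1 m) mod P m" using fun_cong[OF dlog_mult[OF \<phi> Cyc_1 Cyc_1], of m] by simp
  then have "[dlog \<phi> 1 m + 0 = dlog \<phi> 1 m + dlog \<phi> 1 m] (mod P m)"
    using dlog(1)[OF \<phi> Cyc_1] by (simp add: cong_def)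
  then have "[0 = dlog \<phi> 1 m] (mod P m)" by (simp only: cong_add_lcancel)
  then show "dlog \<phi> 1 m = 0" using dlog(1)[OF \<phi> Cyc_1] by (simp add: cong_def)
qed

lemma continuous_Tate_iff:
  "continuous_map top (Tate_topology p N :: (nat \<Rightarrow> 'a) topology) \<phi> \<longleftrightarrow>
    (\<forall>x\<in>topspace top. \<phi> x \<in> carrier T) \<and> (\<forall>r. continuous_map top (discrete_topology UNIV) (\<lambda>x. \<phi> x r))"
  for top :: "'b topology"
  unfolding Tate_topology_def continuous_map_in_subtopology continuous_map_componentwise_UNIV by auto

lemma Dual_iff:
  "\<phi> \<in> Dual \<longleftrightarrow> \<phi> \<in> extensional (carrier Cyc_hat) \<and> (\<forall>x\<in>carrier Cyc_hat. \<phi> x \<in> carrier T) \<and>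
     (\<forall>x\<in>carrier Cyc_hat. \<forall>y\<in>carrier Cyc_hat. \<phi> (x \<otimes>\<^bsub>Cyc_hat\<^esub> y) = (\<lambda>r. \<phi> x r * \<phi> y r)) \<and>
     (\<forall>r. continuous_map (pro_p_topology p Cyc) (discrete_topology UNIV) (\<lambda>x. \<phi> x r))"
  unfolding CK_dual_carrier_def mem_Collect_eq continuous_Tate_iff CycHat.pro_p_topology_topspace hom_def
  by (auto simp: Tate_simps)

lemma Dual_eqI:
  assumes "\<phi> \<in> Dual" "\<psi> \<in> Dual" "\<And>u. u \<in> carrier Cyc \<Longrightarrow> dlog \<phi> u = dlog \<psi> u"
  shows "\<phi> = \<psi>"
proof (rule extensionalityI[of _ "carrier Cyc_hat"])
  fix x assume x: "x \<in> carrier Cyc_hat"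
  have "\<phi> x r = \<psi> x r" for r
  proof (rule CycHat.continuous_eqI[OF _ _ _ x])
    show "continuous_map (pro_p_topology p Cyc) (discrete_topology UNIV) (\<lambda>x. \<phi> x r)"
      "continuous_map (pro_p_topology p Cyc) (discrete_topology UNIV) (\<lambda>x. \<psi> x r)"
      using assms Dual_iff by blast+
    fix u assume "u \<in> carrier Cyc"
    then show "\<phi> (to_pro_p p Cyc u) r = \<psi> (to_pro_p p Cyc u) r"
      using assms dlog(2) by (simp add: CK_class_def)
  qed
  then show "\<phi> x = \<psi> x" by blast
qed (use assms Dual_iff in blast)+

text \<open>
  Units are products of the \<open>1 - \<xi>\<close> and their inverses, and units are dense in the completion.
\<close>

lemma Dual_eqI_generators:
  assumes \<phi>: "\<phi> \<in> Dual" and \<psi>: "\<psi> \<in> Dual" and eq: "\<And>\<xi>. \<xi> \<in> \<mu> \<Longrightarrow> \<xi> \<noteq> 1 \<Longrightarrow> dlog \<phi> (1 - \<xi>) = dlog \<psi> (1 - \<xi>)"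
  shows "\<phi> = \<psi>"
proof (rule Dual_eqI[OF \<phi> \<psi>])
  fix u assume "u \<in> carrier Cyc"
  then show "dlog \<phi> u = dlog \<psi> u"
  proof (induction rule: Cyc_induct)
    case (inverse u)
    have key: "[dlog \<rho> (inverse u) m + dlog \<rho> u m = 0] (mod P m)" if "\<rho> \<in> Dual" for \<rho> m
      using dlog_mult[OF that inverse(1) Cyc_inverse[OF inverse(1)]] dlog_one[OF that] Cyc_in_K[OF inverse(1)]
      by (auto simp: cong_def fun_eq_iff add.commute)
    have "[dlog \<phi> (inverse u) m + dlog \<phi> u m = dlog \<psi> (inverse u) m + dlog \<phi> u m] (mod P m)" for m
      using key[OF \<phi>, of m] key[OF \<psi>, of m] inverse(2) by (simp add: cong_def)
    then have "[dlog \<phi> (inverse u) m = dlog \<psi> (inverse u) m] (mod P m)" for m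
      by (simp only: cong_add_rcancel)
    then show ?case by (intro Zp_eqI dlog(1) \<phi> \<psi> Cyc_inverse inverse(1))
  qed (use eq dlog_one[OF \<phi>] dlog_one[OF \<psi>] dlog_mult[OF \<phi>] dlog_mult[OF \<psi>] in auto)
qed

text \<open>
  Modulo \<open>p^m\<close> the homomorphism \<open>f\<close> factors through \<open>C/B_m\<close> with a subgroup \<open>B_m\<close> of p-power index, so it
  can be evaluated at the component of a point of the completion at \<open>B_m\<close>.
\<close>

lemma Dual_extend:
  assumes f: "\<And>u. u \<in> carrier Cyc \<Longrightarrow> f u \<in> carrier (Zp p)"
    and f_mult: "\<And>u v. u \<in> carrier Cyc \<Longrightarrow> v \<in> carrier Cyc \<Longrightarrow> f (u * v) = (\<lambda>m. (f u m + f v m) mod P m)"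
  shows "\<exists>\<phi>\<in>Dual. \<forall>u\<in>carrier Cyc. dlog \<phi> u = f u"
proof -
  define B where "B = (\<lambda>m. kernel Cyc (integer_mod_group (p ^ m)) (\<lambda>u. f u m))"
  have B: "B m \<in> CycHat.pker" for m
    unfolding B_def
  proof (rule CycHat.kernel_in_pker)
    have "p ^ m \<noteq> 0" using p_pos by simp
    then show "order (integer_mod_group (p ^ m)) = p ^ m"
      by (simp add: order_def carrier_integer_mod_group)
    show "(\<lambda>u. f u m) \<in> hom Cyc (integer_mod_group (p ^ m))"
      by (rule homI) (use f f_mult Zp_nonneg Zp_less \<open>p ^ m \<noteq> 0\<close> in \<open>auto simp: carrier_integer_mod_group\<close>)
  qed simp
  have coset: "f h m = f g m" if x: "x \<in> carrier Cyc_hat" and "g \<in> x (B m)" "h \<in> x (B m)" for x g h m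
  proof -
    have g: "g \<in> carrier Cyc" using CycHat.Ghat_in_carrier[OF x B that(2)] .
    have "h \<in> B m #>\<^bsub>Cyc\<^esub> g" using CycHat.Ghat_eq_coset[OF x B that(2)] that(3) by simp
    then obtain b where b: "b \<in> B m" "h = b * g" by (auto simp: r_coset_def)
    then have "b \<in> carrier Cyc" "f b m = 0" by (auto simp: B_def kernel_def)
    then show ?thesis using f_mult[OF _ g, of b] f[OF g] b(2) by simp
  qed
  have B_mono: "B (Suc m) \<subseteq> B m" for m
  proof
    fix b assume "b \<in> B (Suc m)"
    then have b: "b \<in> carrier Cyc" "f b (Suc m) = 0" by (auto simp: B_def kernel_def)
    then have "f b m = 0" using Zp_cong[OF f[OF b(1)], of m "Suc m"] f[OF b(1)] by (auto simp: cong_def)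
    then show "b \<in> B m" using b by (simp add: B_def kernel_def)
  qed
  define e where "e = (\<lambda>x m. f (SOME g. g \<in> x (B m)) m)"
  have e: "e x m = f g m" if "x \<in> carrier Cyc_hat" "g \<in> x (B m)" for x g m
    unfolding e_def by (rule coset[OF that(1) that(2)]) (rule someI[of _ g], rule that(2))
  have e_mem: "e x \<in> carrier (Zp p)" if x: "x \<in> carrier Cyc_hat" for x
  proof -
    have red: "e x m mod P m = e x m" and "[e x (Suc m) = e x m] (mod P m)" for m
    proof -
      obtain g where g: "g \<in> carrier Cyc" "g \<in> x (B (Suc m))" using CycHat.Ghat_nonempty[OF x B] by blast
      moreover have "x (B (Suc m)) \<subseteq> x (B m)"
        using x B[of m] B[of "Suc m"] B_mono[of m] by (simp add: CycHat.Ghat_carrier)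
      ultimately have "g \<in> x (B m)" by blast
      then have em: "e x m = f g m" by (rule e[OF x])
      show "e x m mod P m = e x m" unfolding em using f[OF g(1)] by simp
      show "[e x (Suc m) = e x m] (mod P m)"
        unfolding em e[OF x g(2)] by (rule Zp_cong[OF f[OF g(1)]]) simp
    qed
    then have "(\<lambda>m. e x m mod P m) \<in> carrier (Zp p)" by (intro Zp_reduceI) 
    then show ?thesis by (simp add: red)
  qed
  define \<phi> where "\<phi> = (\<lambda>x\<in>carrier Cyc_hat. tate_point (e x))"
  have "\<phi> \<in> Dual"
    unfolding Dual_iff
  proof (intro conjI ballI allI)
    show "\<phi> \<in> extensional (carrier Cyc_hat)" by (simp add: \<phi>_def)
    fix x assume x: "x \<in> carrier Cyc_hat"
    then show "\<phi> x \<in> carrier T" by (simp add: \<phi>_def e_mem tate_point_mem)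
    fix y assume y: "y \<in> carrier Cyc_hat"
    have "e (x \<otimes>\<^bsub>Cyc_hat\<^esub> y) m = (e x m + e y m) mod P m" for m
    proof -
      obtain g where g: "g \<in> carrier Cyc" "g \<in> x (B m)" using CycHat.Ghat_nonempty[OF x B] by blast
      obtain h where h: "h \<in> carrier Cyc" "h \<in> y (B m)" using CycHat.Ghat_nonempty[OF y B] by blast
      have "g * h \<in> (x \<otimes>\<^bsub>Cyc_hat\<^esub> y) (B m)"
        using g h B by (force simp: CycHat.Ghat_mult set_mult_def)
      then have "e (x \<otimes>\<^bsub>Cyc_hat\<^esub> y) m = f (g * h) m" by (rule e[OF CycHat.Ghat_mult_closed[OF x y]])
      then show ?thesis using f_mult[OF g(1) h(1)] e[OF x g(2)] e[OF y h(2)] by simp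
    qed
    then show "\<phi> (x \<otimes>\<^bsub>Cyc_hat\<^esub> y) = (\<lambda>r. \<phi> x r * \<phi> y r)"
      using x y CycHat.Ghat_mult_closed[OF x y] tate_point_add[OF e_mem[OF x] e_mem[OF y]] by (simp add: \<phi>_def fun_eq_iff tate_point_def)
  next
    fix r
    have "continuous_map (pro_p_topology p Cyc) (discrete_topology UNIV) (\<lambda>x. \<zeta> (p ^ r) ^ nat (f (SOME g. g \<in> x (B r)) r))"
      by (rule CycHat.continuous_component[OF B])
    then show "continuous_map (pro_p_topology p Cyc) (discrete_topology UNIV) (\<lambda>x. \<phi> x r)"
      by (rule continuous_map_eq) (simp add: CycHat.pro_p_topology_topspace \<phi>_def tate_point_def e_def)
  qed
  moreover have "dlog \<phi> u = f u" if u: "u \<in> carrier Cyc" for u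
  proof (rule dlog_eqI[OF \<open>\<phi> \<in> Dual\<close> u f[OF u]])
    have "e (unit_class u) m = f u m" for m
      by (rule e[OF unit_class_mem[OF u]]) (simp add: CK_class_def CycHat.self_in_to_Ghat[OF u B])
    then show "\<phi> (unit_class u) = tate_point (f u)" by (simp add: \<phi>_def unit_class_mem[OF u] tate_point_def)
  qed
  ultimately show ?thesis by blast
qed

section \<open>The action of the Iwasawa algebra on the dual\<close>

lemma gal_iv_Cyc: "a \<in> UZ \<Longrightarrow> u \<in> carrier Cyc \<Longrightarrow> gal (iv a) u \<in> carrier Cyc"
  by (intro gal_Cyc iv_mem)

lemma CK_dual_galois_class:
  assumes a: "a \<in> UZ" and \<phi>: "\<phi> \<in> Dual" and u: "u \<in> carrier Cyc"
  shows "CK_dual_galois p N a \<phi> (unit_class u) = (\<lambda>m. \<zeta> (p ^ m) ^ nat (a m * dlog \<phi> (gal (iv a) u) m))"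
proof
  fix m
  let ?v = "gal (iv a) u"
  have v: "?v \<in> carrier Cyc" by (rule gal_iv_Cyc[OF a u])
  have "pro_p_aut p Cyc (gal (iv a)) (unit_class u) = unit_class ?v"
    unfolding CK_class_def by (rule CycHat.pro_p_aut_to_Ghat[OF gal_hom_Cyc[OF iv_mem[OF a]] u])
  then have "CK_dual_galois p N a \<phi> (unit_class u) m = gal a (\<zeta> (p ^ m) ^ nat (dlog \<phi> ?v m))"
    by (simp add: CK_dual_galois_def unit_class_mem[OF u] dlog(2)[OF \<phi> v] tate_point_def)
  also have "\<dots> = (\<zeta> (p ^ m) ^ nat (dlog \<phi> ?v m)) ^ nat (a m)"
  proof (rule gal_root[OF a])
    have "(\<zeta> (p ^ m) ^ nat (dlog \<phi> ?v m)) ^ n m = (\<zeta> (p ^ m) ^ (p ^ m)) ^ (nat (dlog \<phi> ?v m) * N)"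
      by (simp only: power_mult[symmetric] mult_ac)
    then show "(\<zeta> (p ^ m) ^ nat (dlog \<phi> ?v m)) ^ n m = 1" by (simp add: zeta_pow_1[OF pp])
  qed
  also have "\<dots> = \<zeta> (p ^ m) ^ nat (a m * dlog \<phi> ?v m)"
    using unit_nat[OF a, of m] by (simp add: nat_mult_distrib power_mult[symmetric] mult.commute)
  finally show "CK_dual_galois p N a \<phi> (unit_class u) m = \<zeta> (p ^ m) ^ nat (a m * dlog \<phi> ?v m)" .
qed

lemma CK_dual_galois_mem:
  assumes a: "a \<in> UZ" and \<phi>: "\<phi> \<in> Dual" and u: "u \<in> carrier Cyc"
  shows "CK_dual_galois p N a \<phi> (unit_class u) = tate_point (\<lambda>m. (a m * dlog \<phi> (gal (iv a) u) m) mod P m)"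
    "(\<lambda>m. (a m * dlog \<phi> (gal (iv a) u) m) mod P m) \<in> carrier (Zp p)"
proof -
  have d: "dlog \<phi> (gal (iv a) u) \<in> carrier (Zp p)" by (intro dlog(1) \<phi> gal_iv_Cyc a u)
  show "(\<lambda>m. (a m * dlog \<phi> (gal (iv a) u) m) mod P m) \<in> carrier (Zp p)"
  proof (rule Zp_reduceI, rule cong_mult)
    fix m
    show "[a (Suc m) = a m] (mod P m)"
      by (rule cong_dvd_modulus[OF Zlim_cong[OF UZ_carrier[OF a]]]) (simp_all add: P_dvd_M)
    show "[dlog \<phi> (gal (iv a) u) (Suc m) = dlog \<phi> (gal (iv a) u) m] (mod P m)"
      by (rule Zp_cong[OF d]) simp
  qed
  show "CK_dual_galois p N a \<phi> (unit_class u) = tate_point (\<lambda>m. (a m * dlog \<phi> (gal (iv a) u) m) mod P m)"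
    unfolding CK_dual_galois_class[OF assms] tate_point_def
  proof
    fix m
    show "\<zeta> (p ^ m) ^ nat (a m * dlog \<phi> (gal (iv a) u) m) = \<zeta> (p ^ m) ^ nat ((a m * dlog \<phi> (gal (iv a) u) m) mod P m)"
      using unit_nat[OF a, of m] Zp_nonneg[OF d, of m] P_pos[of m]
      by (subst zeta_p_pow_eq_iff) (simp_all add: cong_def)
  qed
qed

lemma iv_level:
  assumes a: "a \<in> UZ" and b: "b \<in> UZ" and eq: "a t = b t"
  shows "iv a t = iv b t"
proof -
  have "[a t * iv a t = a t * iv b t] (mod M t)"
    using Zlim_Units_inv(3)[OF p_pos N_pos a, of t] Zlim_Units_inv(3)[OF p_pos N_pos b, of t] eq
    by (metis cong_sym cong_trans)
  then have "[iv a t = iv b t] (mod M t)"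
    using Zlim_Units_coprime[OF p_pos N_pos a, of t] cong_mult_lcancel by blast
  then show ?thesis
    using Zlim_mod_self[OF UZ_carrier[OF iv_mem[OF a]]] Zlim_mod_self[OF UZ_carrier[OF iv_mem[OF b]]]
    unfolding cong_def by metis
qed

text \<open>
  A level \<open>r\<close> such that the action on \<open>u\<close> of the automorphism with character \<open>a\<close> depends on \<open>a\<close>
  modulo \<open>Np^r\<close> only.
\<close>

definition unit_level :: "'a \<Rightarrow> nat" where
  "unit_level u = (SOME t. \<forall>a b. a \<in> UZ \<longrightarrow> b \<in> UZ \<longrightarrow> a t = b t \<longrightarrow> gal a u = gal b u)"

lemma unit_level:
  assumes u: "u \<in> carrier Cyc" and a: "a \<in> UZ" and b: "b \<in> UZ" and eq: "a (unit_level u) = b (unit_level u)"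
  shows "gal a u = gal b u"
proof -
  have "\<exists>t. \<forall>a b. a \<in> UZ \<longrightarrow> b \<in> UZ \<longrightarrow> a t = b t \<longrightarrow> gal a u = gal b u"
    using gal_eq_of_level[of u] Cyc_in_K[OF u] by metis
  then have "\<forall>a b. a \<in> UZ \<longrightarrow> b \<in> UZ \<longrightarrow> a (unit_level u) = b (unit_level u) \<longrightarrow> gal a u = gal b u"
    unfolding unit_level_def by (rule someI_ex)
  then show ?thesis using assms by blast
qed

definition unit_lift :: "nat \<Rightarrow> int \<Rightarrow> profint" where "unit_lift s c = (SOME x. x \<in> UZ \<and> x s = c)"

lemma unit_lift: "c \<in> U s \<Longrightarrow> unit_lift s c \<in> UZ" "c \<in> U s \<Longrightarrow> unit_lift s c s = c"
proof -
  have "unit_lift s c \<in> UZ \<and> unit_lift s c s = c" if "c \<in> U s"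
    using someI_ex[of "\<lambda>x. x \<in> UZ \<and> x s = c"] lift_unit[OF that] unfolding unit_lift_def by blast
  then show "c \<in> U s \<Longrightarrow> unit_lift s c \<in> UZ" "c \<in> U s \<Longrightarrow> unit_lift s c s = c" by auto
qed

text \<open>
  The logarithm modulo \<open>p^m\<close> of the Riemann sum at level \<open>s\<close> with sample points \<open>x\<close>: the factor \<open>x c\<close> is
  the action of the automorphism on the value in the Tate module.
\<close>

definition Riemann_sum :: "(nat \<Rightarrow> int \<Rightarrow> profint) \<Rightarrow> (('a set \<Rightarrow> 'a set) \<Rightarrow> nat \<Rightarrow> 'a) \<Rightarrow> nat \<Rightarrow> (int \<Rightarrow> profint) \<Rightarrow> 'a \<Rightarrow> nat \<Rightarrow> int"
  where "Riemann_sum l \<phi> s x u m = (\<Sum>c\<in>U s. l s c m * (x c m * dlog \<phi> (gal (iv (x c)) u) m))"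

text \<open>
  From level \<open>unit_level u\<close> on the integrand is constant on residue classes at the given precision; so
  the sum neither depends on the level nor on the sample points.
\<close>

lemma Riemann_sum_stable:
  assumes l: "l \<in> L" and \<phi>: "\<phi> \<in> Dual" and u: "u \<in> carrier Cyc"
    and r: "unit_level u \<le> r" "m \<le> r" and rs: "r \<le> s"
    and x: "\<And>c. c \<in> U s \<Longrightarrow> x c \<in> UZ \<and> x c s = c" and y: "\<And>c. c \<in> U r \<Longrightarrow> y c \<in> UZ \<and> y c r = c"
  shows "[Riemann_sum l \<phi> s x u m = Riemann_sum l \<phi> r y u m] (mod P m)"
  unfolding Riemann_sum_def
proof (rule L_push[OF l rs])
  fix c assume c: "c \<in> U s"
  let ?b = "c mod M r"
  have b: "?b \<in> U r" by (rule U_mod[OF c rs])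
  have xr: "x c r = ?b" using Zlim_mod[OF UZ_carrier rs, of "x c"] x[OF c] by simp
  have down: "x c t = y ?b t" if "t \<le> r" for t
    using Zlim_mod[OF UZ_carrier that, of "x c"] Zlim_mod[OF UZ_carrier that, of "y ?b"] x[OF c] y[OF b] xr by simp
  have "gal (iv (x c)) u = gal (iv (y ?b)) u"
    by (rule unit_level[OF u]) (use x[OF c] y[OF b] iv_mem iv_level down[OF r(1)] in auto)
  then show "[x c m * dlog \<phi> (gal (iv (x c)) u) m = y ?b m * dlog \<phi> (gal (iv (y ?b)) u) m] (mod P m)"
    using down[OF r(2)] by simp
qed

text \<open>
  The stable values of the Riemann sums form a homomorphism on the units: for two units, compare at a
  level that is fine enough for both and for their product.
\<close>

lemma smult_exists:
  assumes l: "l \<in> L" and \<phi>: "\<phi> \<in> Dual"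
  shows "\<exists>\<psi>\<in>Dual. \<forall>u\<in>carrier Cyc. \<forall>m s x. unit_level u \<le> s \<longrightarrow> m \<le> s \<longrightarrow> (\<forall>c\<in>U s. x c \<in> UZ \<and> x c s = c) \<longrightarrow>
     [dlog \<psi> u m = Riemann_sum l \<phi> s x u m] (mod P m)"
proof -
  define f where "f = (\<lambda>u m. Riemann_sum l \<phi> (max (unit_level u) m) (unit_lift (max (unit_level u) m)) u m mod P m)"
  have f_cong: "[f u m = Riemann_sum l \<phi> s x u m] (mod P m)"
    if "u \<in> carrier Cyc" "unit_level u \<le> s" "m \<le> s" "\<And>c. c \<in> U s \<Longrightarrow> x c \<in> UZ \<and> x c s = c" for u m s x
  proof -
    have "[Riemann_sum l \<phi> s x u m = Riemann_sum l \<phi> (max (unit_level u) m) (unit_lift (max (unit_level u) m)) u m] (mod P m)"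
      by (rule Riemann_sum_stable[OF l \<phi> that(1)]) (use that unit_lift in auto)
    then show ?thesis by (simp add: f_def cong_def)
  qed
  have dlg: "dlog \<phi> (gal (iv (unit_lift s c)) u) \<in> carrier (Zp p)" if "u \<in> carrier Cyc" "c \<in> U s" for u s c
    by (intro dlog(1) \<phi> gal_iv_Cyc unit_lift that)
  have f_mem: "f u \<in> carrier (Zp p)" if u: "u \<in> carrier Cyc" for u
  proof -
    have "[f u (Suc m) = f u m] (mod P m)" for m
    proof -
      let ?s = "max (unit_level u) (Suc m)"
      have "[f u (Suc m) = Riemann_sum l \<phi> ?s (unit_lift ?s) u (Suc m)] (mod P (Suc m))"
        by (rule f_cong[OF u]) (use unit_lift in auto)
      then have "[f u (Suc m) = Riemann_sum l \<phi> ?s (unit_lift ?s) u (Suc m)] (mod P m)"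
        by (rule cong_dvd_modulus) (simp add: le_imp_power_dvd)
      moreover have "[Riemann_sum l \<phi> ?s (unit_lift ?s) u (Suc m) = Riemann_sum l \<phi> ?s (unit_lift ?s) u m] (mod P m)"
        unfolding Riemann_sum_def
      proof (intro cong_sum cong_mult)
        fix c assume c: "c \<in> U ?s"
        show "[l ?s c (Suc m) = l ?s c m] (mod P m)" by (rule Zp_cong[OF L_mem[OF l]]) simp
        show "[unit_lift ?s c (Suc m) = unit_lift ?s c m] (mod P m)"
          by (rule cong_dvd_modulus[OF Zlim_cong[OF UZ_carrier[OF unit_lift(1)[OF c]]]]) (simp_all add: P_dvd_M)
        show "[dlog \<phi> (gal (iv (unit_lift ?s c)) u) (Suc m) = dlog \<phi> (gal (iv (unit_lift ?s c)) u) m] (mod P m)"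
          by (rule Zp_cong[OF dlg[OF u c]]) simp
      qed
      moreover have "[Riemann_sum l \<phi> ?s (unit_lift ?s) u m = f u m] (mod P m)"
        by (rule cong_sym[OF f_cong[OF u]]) (use unit_lift in auto)
      ultimately show ?thesis by (meson cong_trans)
    qed
    then have "(\<lambda>m. f u m mod P m) \<in> carrier (Zp p)" by (rule Zp_reduceI)
    moreover have "f u m mod P m = f u m" for m by (simp add: f_def)
    ultimately show ?thesis by simp
  qed
  have f_mult: "f (u * v) = (\<lambda>m. (f u m + f v m) mod P m)" if u: "u \<in> carrier Cyc" and v: "v \<in> carrier Cyc" for u v
  proof
    fix m
    define s where "s = max (max (unit_level u) (unit_level v)) (max (unit_level (u * v)) m)"
    have "[f (u * v) m = Riemann_sum l \<phi> s (unit_lift s) (u * v) m] (mod P m)"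
      by (rule f_cong[OF Cyc_mult[OF u v]]) (use unit_lift in \<open>auto simp: s_def\<close>)
    moreover have "[Riemann_sum l \<phi> s (unit_lift s) (u * v) m = Riemann_sum l \<phi> s (unit_lift s) u m + Riemann_sum l \<phi> s (unit_lift s) v m] (mod P m)"
      unfolding Riemann_sum_def sum.distrib[symmetric]
    proof (rule cong_sum)
      fix c assume c: "c \<in> U s"
      have "gal (iv (unit_lift s c)) (u * v) = gal (iv (unit_lift s c)) u * gal (iv (unit_lift s c)) v"
        using Cyc_in_K u v by (intro gal_mult iv_mem unit_lift c) auto
      then have "dlog \<phi> (gal (iv (unit_lift s c)) (u * v)) m = (dlog \<phi> (gal (iv (unit_lift s c)) u) m + dlog \<phi> (gal (iv (unit_lift s c)) v) m) mod P m"
        using dlog_mult[OF \<phi>, of "gal (iv (unit_lift s c)) u" "gal (iv (unit_lift s c)) v"] gal_iv_Cyc[OF unit_lift(1)[OF c]] u v by simp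
      then have "[dlog \<phi> (gal (iv (unit_lift s c)) (u * v)) m = dlog \<phi> (gal (iv (unit_lift s c)) u) m + dlog \<phi> (gal (iv (unit_lift s c)) v) m] (mod P m)"
        by (simp add: cong_def)
      then have "[l s c m * (unit_lift s c m * dlog \<phi> (gal (iv (unit_lift s c)) (u * v)) m)
          = l s c m * (unit_lift s c m * (dlog \<phi> (gal (iv (unit_lift s c)) u) m + dlog \<phi> (gal (iv (unit_lift s c)) v) m))] (mod P m)"
        by (intro cong_mult cong_refl)
      then show "[l s c m * (unit_lift s c m * dlog \<phi> (gal (iv (unit_lift s c)) (u * v)) m)
          = l s c m * (unit_lift s c m * dlog \<phi> (gal (iv (unit_lift s c)) u) m) + l s c m * (unit_lift s c m * dlog \<phi> (gal (iv (unit_lift s c)) v) m)] (mod P m)"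
        by (simp only: distrib_left)
    qed
    moreover have "[Riemann_sum l \<phi> s (unit_lift s) u m + Riemann_sum l \<phi> s (unit_lift s) v m = f u m + f v m] (mod P m)"
      by (intro cong_add cong_sym[OF f_cong] u v) (use unit_lift in \<open>auto simp: s_def\<close>)
    ultimately have "[f (u * v) m = f u m + f v m] (mod P m)" by (meson cong_trans)
    then show "f (u * v) m = (f u m + f v m) mod P m" using f_mem[OF Cyc_mult[OF u v]] by (simp add: cong_def)
  qed
  obtain \<psi> where "\<psi> \<in> Dual" "\<forall>u\<in>carrier Cyc. dlog \<psi> u = f u" using Dual_extend[of f, OF f_mem f_mult] by blast
  then show ?thesis using f_cong by (intro bexI[of _ \<psi>]) auto
qed

lemma prod_zeta_p_pow:
  "finite A \<Longrightarrow> (\<Prod>c\<in>A. \<zeta> (p ^ m) ^ nat (k c mod P m)) = \<zeta> (p ^ m) ^ nat ((\<Sum>c\<in>A. k c) mod P m)"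
proof (induction A rule: finite_induct)
  case (insert c A)
  let ?a = "k c mod P m" and ?b = "(\<Sum>c\<in>A. k c) mod P m"
  have "\<zeta> (p ^ m) ^ nat ?a * \<zeta> (p ^ m) ^ nat ?b = \<zeta> (p ^ m) ^ nat (?a + ?b)"
    using P_pos[of m] by (simp add: nat_add_distrib power_add)
  also have "\<dots> = \<zeta> (p ^ m) ^ nat ((\<Sum>c\<in>insert c A. k c) mod P m)"
    using P_pos[of m] insert(1,2) by (subst zeta_p_pow_eq_iff) (simp_all add: cong_def mod_simps)
  finally show ?case using insert by simp
qed simp

lemma finsum_Riemann_sum:
  assumes l: "l \<in> L" and \<phi>: "\<phi> \<in> Dual" and u: "u \<in> carrier Cyc" and x: "\<And>c. c \<in> U s \<Longrightarrow> x c \<in> UZ"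
  shows "(\<Oplus>\<^bsub>T\<^esub>c\<in>U s. l s c \<odot>\<^bsub>T\<^esub> CK_dual_galois p N (x c) \<phi> (unit_class u)) \<in> carrier T"
    "(\<Oplus>\<^bsub>T\<^esub>c\<in>U s. l s c \<odot>\<^bsub>T\<^esub> CK_dual_galois p N (x c) \<phi> (unit_class u)) m = \<zeta> (p ^ m) ^ nat (Riemann_sum l \<phi> s x u m mod P m)"
proof -
  interpret T: abelian_group T by (rule abelian_group_Tate)
  let ?d = "\<lambda>c m. (x c m * dlog \<phi> (gal (iv (x c)) u) m) mod P m"
  let ?g = "\<lambda>c. l s c \<odot>\<^bsub>T\<^esub> CK_dual_galois p N (x c) \<phi> (unit_class u)"
  have g: "?g c = tate_point (\<lambda>m. (l s c m * ?d c m) mod P m)" "(\<lambda>m. (l s c m * ?d c m) mod P m) \<in> carrier (Zp p)" if "c \<in> U s" for c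
    unfolding CK_dual_galois_mem(1)[OF x[OF that] \<phi> u]
    by (rule tate_point_smult[OF L_mem[OF l] CK_dual_galois_mem(2)[OF x[OF that] \<phi> u]],
        rule Zp_mult_mem[OF L_mem[OF l] CK_dual_galois_mem(2)[OF x[OF that] \<phi> u]])
  have mem: "?g c \<in> carrier T" if "c \<in> U s" for c
    using tate_point_mem[OF g(2)[OF that]] g(1)[OF that] by simp
  show "finsum T ?g (U s) \<in> carrier T" using mem by (intro T.finsum_closed) auto
  have "(\<Prod>c\<in>U s. \<zeta> (p ^ m) ^ nat ((l s c m * ?d c m) mod P m)) = \<zeta> (p ^ m) ^ nat ((\<Sum>c\<in>U s. l s c m * ?d c m) mod P m)"
    by (rule prod_zeta_p_pow) simp
  moreover have "finsum T ?g (U s) m = (\<Prod>c\<in>U s. ?g c m)" using Tate_finsum[of "U s" ?g] mem by simp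
  moreover have "(\<Prod>c\<in>U s. ?g c m) = (\<Prod>c\<in>U s. \<zeta> (p ^ m) ^ nat ((l s c m * ?d c m) mod P m))"
    by (rule prod.cong[OF refl]) (simp only: g(1) tate_point_def)
  moreover have "[(\<Sum>c\<in>U s. l s c m * ?d c m) = Riemann_sum l \<phi> s x u m] (mod P m)"
    unfolding Riemann_sum_def by (rule cong_sum, rule cong_mult[OF cong_refl]) (simp add: cong_def)
  then have "(\<Sum>c\<in>U s. l s c m * ?d c m) mod P m = Riemann_sum l \<phi> s x u m mod P m" by (simp add: cong_def)
  ultimately show "finsum T ?g (U s) m = \<zeta> (p ^ m) ^ nat (Riemann_sum l \<phi> s x u m mod P m)" by simp
qed

text \<open>
  The stable Riemann sums converge to the homomorphism found above, and a limit is unique, already for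
  a single choice of sample points, because the topology is Hausdorff and the units are dense.
\<close>

theorem CK_dual_smult_spec:
  assumes l: "l \<in> L" and \<phi>: "\<phi> \<in> Dual"
  shows "CK_dual_smult p N l \<phi> \<in> Dual"
    and "u \<in> carrier Cyc \<Longrightarrow> unit_level u \<le> s \<Longrightarrow> m \<le> s \<Longrightarrow> (\<And>c. c \<in> U s \<Longrightarrow> x c \<in> UZ \<and> x c s = c) \<Longrightarrow>
      [dlog (CK_dual_smult p N l \<phi>) u m = Riemann_sum l \<phi> s x u m] (mod P m)"
proof -
  obtain \<psi> where \<psi>: "\<psi> \<in> Dual" and \<psi>_cong: "\<And>u m s x. u \<in> carrier Cyc \<Longrightarrow> unit_level u \<le> s \<Longrightarrow> m \<le> s \<Longrightarrow>
      (\<And>c. c \<in> U s \<Longrightarrow> x c \<in> UZ \<and> x c s = c) \<Longrightarrow> [dlog \<psi> u m = Riemann_sum l \<phi> s x u m] (mod P m)"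
    using smult_exists[OF l \<phi>] by blast
  let ?sum = "\<lambda>x u r. \<Oplus>\<^bsub>T\<^esub>c\<in>U r. l r c \<odot>\<^bsub>T\<^esub> CK_dual_galois p N (x r c) \<phi> (unit_class u)"
  have ev: "\<forall>\<^sub>F r in sequentially. ?sum x u r m = \<psi> (unit_class u) m"
    if u: "u \<in> carrier Cyc" and x: "\<forall>r. \<forall>c\<in>U r. x r c \<in> UZ \<and> x r c r = c" for u x m
  proof (rule eventually_sequentiallyI)
    fix r assume r: "max (unit_level u) m \<le> r"
    have "[dlog \<psi> u m = Riemann_sum l \<phi> r (x r) u m] (mod P m)" by (rule \<psi>_cong[OF u]) (use r x in auto)
    then have "dlog \<psi> u m = Riemann_sum l \<phi> r (x r) u m mod P m" using dlog(1)[OF \<psi> u] by (simp add: cong_def)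
    moreover have "?sum x u r m = \<zeta> (p ^ m) ^ nat (Riemann_sum l \<phi> r (x r) u m mod P m)"
      by (rule finsum_Riemann_sum(2)[OF l \<phi> u]) (use x in auto)
    ultimately show "?sum x u r m = \<psi> (unit_class u) m" by (simp add: dlog(2)[OF \<psi> u] tate_point_def)
  qed
  have lim: "limitin (Tate_topology p N) (?sum x u) (\<psi> (unit_class u)) sequentially"
    if u: "u \<in> carrier Cyc" and x: "\<forall>r. \<forall>c\<in>U r. x r c \<in> UZ \<and> x r c r = c" for u x
    unfolding limitin_Tate
  proof (intro conjI allI ev[OF u x])
    show "\<psi> (unit_class u) \<in> carrier T" by (rule Dual_mem[OF \<psi> unit_class_mem[OF u]])
    show "\<forall>\<^sub>F r in sequentially. ?sum x u r \<in> carrier T"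
      by (rule always_eventually, rule allI, rule finsum_Riemann_sum(1)[OF l \<phi> u]) (use x in auto)
  qed
  have "CK_dual_smult p N l \<phi> = \<psi>"
    unfolding CK_dual_smult_def
  proof (rule the_equality)
    show "\<psi> \<in> Dual \<and> (\<forall>u\<in>carrier Cyc. \<forall>x. (\<forall>r. \<forall>c\<in>U r. x r c \<in> UZ \<and> x r c r = c) \<longrightarrow>
        limitin (Tate_topology p N) (?sum x u) (\<psi> (unit_class u)) sequentially)"
      using \<psi> lim by blast
  next
    fix \<psi>' :: "('a set \<Rightarrow> 'a set) \<Rightarrow> nat \<Rightarrow> 'a"
    assume \<psi>': "\<psi>' \<in> Dual \<and> (\<forall>u\<in>carrier Cyc. \<forall>x. (\<forall>r. \<forall>c\<in>U r. x r c \<in> UZ \<and> x r c r = c) \<longrightarrow>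
        limitin (Tate_topology p N) (?sum x u) (\<psi>' (unit_class u)) sequentially)"
    show "\<psi>' = \<psi>"
    proof (rule Dual_eqI)
      fix u assume u: "u \<in> carrier Cyc"
      have x: "\<forall>r. \<forall>c\<in>U r. unit_lift r c \<in> UZ \<and> unit_lift r c r = c" using unit_lift by blast
      have "\<psi>' (unit_class u) m = \<psi> (unit_class u) m" for m
      proof -
        have "\<forall>\<^sub>F r in sequentially. ?sum unit_lift u r m = \<psi>' (unit_class u) m"
          using \<psi>' u x unfolding limitin_Tate by blast
        then have "\<forall>\<^sub>F r::nat in sequentially. \<psi>' (unit_class u) m = \<psi> (unit_class u) m"
          using ev[OF u x, of m] by eventually_elim simp
        then show ?thesis by simp
      qed
      then have "\<psi>' (unit_class u) = \<psi> (unit_class u)" by blast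
      then show "dlog \<psi>' u = dlog \<psi> u" by (simp add: dlog_def)
    qed (use \<psi> \<psi>' in auto)
  qed
  then show "CK_dual_smult p N l \<phi> \<in> Dual"
    and "u \<in> carrier Cyc \<Longrightarrow> unit_level u \<le> s \<Longrightarrow> m \<le> s \<Longrightarrow> (\<And>c. c \<in> U s \<Longrightarrow> x c \<in> UZ \<and> x c s = c) \<Longrightarrow>
      [dlog (CK_dual_smult p N l \<phi>) u m = Riemann_sum l \<phi> s x u m] (mod P m)"
    using \<psi> \<psi>_cong by simp_all
qed

end

section \<open>Tensor products\<close>

lemma abelian_group_cong:
  assumes "abelian_group A" "carrier B = carrier A" "(\<oplus>\<^bsub>B\<^esub>) = (\<oplus>\<^bsub>A\<^esub>)" "\<zero>\<^bsub>B\<^esub> = \<zero>\<^bsub>A\<^esub>"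
  shows "abelian_group B"
proof -
  interpret A: abelian_group A by fact
  show ?thesis
    by (rule abelian_groupI; unfold assms(2-4))
       (auto simp: A.a_assoc A.a_comm A.a_lcomm intro: A.l_neg)
qed

locale tensor_pair =
  fixes Rg :: "('r, 'x) ring_scheme" and Md :: "('r, 'm, 'y) module_scheme" and Ne :: "('r, 'n, 'z) module_scheme"
  assumes Md: "abelian_group Md" and Ne: "abelian_group Ne"
    and Md_smult: "\<And>c x. c \<in> carrier Rg \<Longrightarrow> x \<in> carrier Md \<Longrightarrow> c \<odot>\<^bsub>Md\<^esub> x \<in> carrier Md"
    and Ne_smult: "\<And>c x. c \<in> carrier Rg \<Longrightarrow> x \<in> carrier Ne \<Longrightarrow> c \<odot>\<^bsub>Ne\<^esub> x \<in> carrier Ne"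
begin

abbreviation Fr where "Fr \<equiv> free_Abelian_group (carrier Md \<times> carrier Ne)"
abbreviation pt where "pt \<equiv> pure_tensor Rg Md Ne"
abbreviation TT where "TT \<equiv> tensor Rg Md Ne"

lemma comm_group_Fr: "comm_group Fr" by (rule abelian_free_Abelian_group)

interpretation Md: abelian_group Md by (rule Md)
interpretation Ne: abelian_group Ne by (rule Ne)
interpretation Fr: comm_group Fr by (rule comm_group_Fr)

lemma diff_in_Fr: "a \<in> carrier Fr \<Longrightarrow> b \<in> carrier Fr \<Longrightarrow> a - b \<in> carrier Fr"
  using keys_diff[of a b] by auto

lemma frag_in_Fr: "x \<in> carrier Md \<Longrightarrow> y \<in> carrier Ne \<Longrightarrow> frag_of (x, y) \<in> carrier Fr"
  by simp

lemma tensor_rels_subset: "tensor_rels Rg Md Ne \<subseteq> carrier Fr"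
  unfolding tensor_rels_def
  by (safe; intro diff_in_Fr frag_in_Fr Md.a_closed Ne.a_closed Md_smult Ne_smult; assumption)

lemma tensor_kernel_normal: "tensor_kernel Rg Md Ne \<lhd> Fr"
  unfolding tensor_kernel_def Fr.normal_iff_subgroup
  by (rule Fr.generate_is_subgroup[OF tensor_rels_subset])

interpretation TK: normal "tensor_kernel Rg Md Ne" Fr by (rule tensor_kernel_normal)

lemma comm_group_tensor: "comm_group TT"
  unfolding tensor_def by (rule Fr.abelian_FactGroup) (rule TK.subgroup_axioms)

lemma pure_tensor_closed: "x \<in> carrier Md \<Longrightarrow> y \<in> carrier Ne \<Longrightarrow> pt x y \<in> carrier TT"
  unfolding pure_tensor_def tensor_def by (auto simp: FactGroup_def RCOSETS_def simp del: carrier_free_Abelian_group_iff)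

lemma tensor_coset_eq:
  assumes "a \<in> carrier Fr" "b \<in> carrier Fr" "a - b \<in> tensor_kernel Rg Md Ne"
  shows "tensor_kernel Rg Md Ne #>\<^bsub>Fr\<^esub> a = tensor_kernel Rg Md Ne #>\<^bsub>Fr\<^esub> b"
proof -
  have "a = (a - b) \<otimes>\<^bsub>Fr\<^esub> b" by simp
  then have "a \<in> tensor_kernel Rg Md Ne #>\<^bsub>Fr\<^esub> b" using assms(3) unfolding r_coset_def by blast
  then show ?thesis using Fr.repr_independence[OF _ assms(2) TK.subgroup_axioms] by simp
qed

lemma pure_tensor_add_left:
  assumes "x \<in> carrier Md" "x' \<in> carrier Md" "y \<in> carrier Ne"
  shows "pt (x \<oplus>\<^bsub>Md\<^esub> x') y = pt x y \<otimes>\<^bsub>TT\<^esub> pt x' y"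
proof -
  have "pt x y \<otimes>\<^bsub>TT\<^esub> pt x' y = tensor_kernel Rg Md Ne #>\<^bsub>Fr\<^esub> (frag_of (x, y) + frag_of (x', y))"
    using TK.rcos_sum[OF frag_in_Fr frag_in_Fr, of x y x' y] assms
    by (simp add: tensor_def FactGroup_def pure_tensor_def)
  also have "\<dots> = pt (x \<oplus>\<^bsub>Md\<^esub> x') y"
    unfolding pure_tensor_def
  proof (rule tensor_coset_eq[symmetric])
    show "frag_of (x \<oplus>\<^bsub>Md\<^esub> x', y) \<in> carrier Fr" using assms by simp
    show "frag_of (x, y) + frag_of (x', y) \<in> carrier Fr"
      using Fr.m_closed[OF frag_in_Fr frag_in_Fr, of x y x' y] assms by simp
    have "frag_of (x \<oplus>\<^bsub>Md\<^esub> x', y) - frag_of (x, y) - frag_of (x', y) \<in> tensor_rels Rg Md Ne"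
      using assms unfolding tensor_rels_def by blast
    then show "frag_of (x \<oplus>\<^bsub>Md\<^esub> x', y) - (frag_of (x, y) + frag_of (x', y)) \<in> tensor_kernel Rg Md Ne"
      unfolding tensor_kernel_def by (simp add: diff_diff_eq generate.incl)
  qed
  finally show ?thesis by simp
qed

lemma pure_tensor_smult:
  assumes "c \<in> carrier Rg" "x \<in> carrier Md" "y \<in> carrier Ne"
  shows "pt (c \<odot>\<^bsub>Md\<^esub> x) y = pt x (c \<odot>\<^bsub>Ne\<^esub> y)"
  unfolding pure_tensor_def
proof (rule tensor_coset_eq)
  have "frag_of (c \<odot>\<^bsub>Md\<^esub> x, y) - frag_of (x, c \<odot>\<^bsub>Ne\<^esub> y) \<in> tensor_rels Rg Md Ne"
    using assms unfolding tensor_rels_def by blast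
  then show "frag_of (c \<odot>\<^bsub>Md\<^esub> x, y) - frag_of (x, c \<odot>\<^bsub>Ne\<^esub> y) \<in> tensor_kernel Rg Md Ne"
    unfolding tensor_kernel_def by (rule generate.incl)
qed (use assms Md_smult Ne_smult in simp_all)

lemma pure_tensor_zero_left:
  assumes y: "y \<in> carrier Ne"
  shows "pt \<zero>\<^bsub>Md\<^esub> y = \<one>\<^bsub>TT\<^esub>"
proof -
  interpret TT: comm_group TT by (rule comm_group_tensor)
  have "pt \<zero>\<^bsub>Md\<^esub> y \<otimes>\<^bsub>TT\<^esub> pt \<zero>\<^bsub>Md\<^esub> y = pt \<zero>\<^bsub>Md\<^esub> y"
    using pure_tensor_add_left[of "\<zero>\<^bsub>Md\<^esub>" "\<zero>\<^bsub>Md\<^esub>" y] y by simp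
  then show ?thesis using TT.l_cancel_one[OF pure_tensor_closed pure_tensor_closed] y by simp
qed

text \<open>
  The map extends to the free abelian group on the pairs and kills the bilinearity relations.
\<close>

lemma bilinear_respects_pure_tensor:
  assumes A: "comm_group A"
    and \<beta>: "\<And>x y. x \<in> carrier Md \<Longrightarrow> y \<in> carrier Ne \<Longrightarrow> \<beta> x y \<in> carrier A"
    and add1: "\<And>x x' y. x \<in> carrier Md \<Longrightarrow> x' \<in> carrier Md \<Longrightarrow> y \<in> carrier Ne \<Longrightarrow> \<beta> (x \<oplus>\<^bsub>Md\<^esub> x') y = \<beta> x y \<otimes>\<^bsub>A\<^esub> \<beta> x' y"
    and add2: "\<And>x y y'. x \<in> carrier Md \<Longrightarrow> y \<in> carrier Ne \<Longrightarrow> y' \<in> carrier Ne \<Longrightarrow> \<beta> x (y \<oplus>\<^bsub>Ne\<^esub> y') = \<beta> x y \<otimes>\<^bsub>A\<^esub> \<beta> x y'"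
    and smult: "\<And>c x y. c \<in> carrier Rg \<Longrightarrow> x \<in> carrier Md \<Longrightarrow> y \<in> carrier Ne \<Longrightarrow> \<beta> (c \<odot>\<^bsub>Md\<^esub> x) y = \<beta> x (c \<odot>\<^bsub>Ne\<^esub> y)"
    and mem: "x \<in> carrier Md" "y \<in> carrier Ne" "x' \<in> carrier Md" "y' \<in> carrier Ne"
    and eq: "pt x y = pt x' y'"
  shows "\<beta> x y = \<beta> x' y'"
proof -
  interpret A: comm_group A by (rule A)
  have "(\<lambda>(x, y). \<beta> x y) ` (carrier Md \<times> carrier Ne) \<subseteq> carrier A" using \<beta> by auto
  then obtain h where h: "h \<in> hom Fr A" and hf: "\<And>v. v \<in> carrier Md \<times> carrier Ne \<Longrightarrow> h (frag_of v) = (\<lambda>(x, y). \<beta> x y) v"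
    using A.free_Abelian_group_universal[of "\<lambda>(x, y). \<beta> x y" "carrier Md \<times> carrier Ne"] by auto
  interpret h: group_hom Fr A h by (simp add: group_hom_def group_hom_axioms_def h A.is_group)
  have h_add: "h (a + b) = h a \<otimes>\<^bsub>A\<^esub> h b" if "a \<in> carrier Fr" "b \<in> carrier Fr" for a b
    using h.hom_mult[OF that] by simp
  have h_diff: "a - b \<in> carrier Fr \<and> h (a - b) = h a \<otimes>\<^bsub>A\<^esub> inv\<^bsub>A\<^esub> h b" if "a \<in> carrier Fr" "b \<in> carrier Fr" for a b
  proof
    show ab: "a - b \<in> carrier Fr" using that keys_diff[of a b] by auto
    have "h a = h (a - b) \<otimes>\<^bsub>A\<^esub> h b" using h_add[OF ab that(2)] by simp
    then show "h (a - b) = h a \<otimes>\<^bsub>A\<^esub> inv\<^bsub>A\<^esub> h b"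
      using h.hom_closed[OF ab] h.hom_closed[OF that(2)] by (simp add: A.m_assoc)
  qed
  note Frs = frag_in_Fr Md.a_closed Ne.a_closed Md_smult Ne_smult
  have "h v = \<one>\<^bsub>A\<^esub>" if "v \<in> tensor_rels Rg Md Ne" for v
    using that unfolding tensor_rels_def
  proof (elim UnE CollectE exE conjE)
    fix x x' y assume v: "v = frag_of (x \<oplus>\<^bsub>Md\<^esub> x', y) - frag_of (x, y) - frag_of (x', y)"
      and m: "x \<in> carrier Md" "x' \<in> carrier Md" "y \<in> carrier Ne"
    have "h v = (\<beta> (x \<oplus>\<^bsub>Md\<^esub> x') y \<otimes>\<^bsub>A\<^esub> inv\<^bsub>A\<^esub> \<beta> x y) \<otimes>\<^bsub>A\<^esub> inv\<^bsub>A\<^esub> \<beta> x' y"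
      unfolding v using h_diff[OF conjunct1[OF h_diff[OF Frs(1) Frs(1)]] Frs(1)] h_diff[OF Frs(1) Frs(1)] m hf by simp
    also have "\<dots> = \<one>\<^bsub>A\<^esub>"
      using m \<beta> by (simp add: add1 A.m_comm[of "\<beta> x y" "\<beta> x' y"] A.m_assoc)
    finally show ?thesis .
  next
    fix x y y' assume v: "v = frag_of (x, y \<oplus>\<^bsub>Ne\<^esub> y') - frag_of (x, y) - frag_of (x, y')"
      and m: "x \<in> carrier Md" "y \<in> carrier Ne" "y' \<in> carrier Ne"
    have "h v = (\<beta> x (y \<oplus>\<^bsub>Ne\<^esub> y') \<otimes>\<^bsub>A\<^esub> inv\<^bsub>A\<^esub> \<beta> x y) \<otimes>\<^bsub>A\<^esub> inv\<^bsub>A\<^esub> \<beta> x y'"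
      unfolding v using h_diff[OF conjunct1[OF h_diff[OF Frs(1) Frs(1)]] Frs(1)] h_diff[OF Frs(1) Frs(1)] m hf by simp
    also have "\<dots> = \<one>\<^bsub>A\<^esub>"
      using m \<beta> by (simp add: add2 A.m_comm[of "\<beta> x y" "\<beta> x y'"] A.m_assoc)
    finally show ?thesis .
  next
    fix c x y assume v: "v = frag_of (c \<odot>\<^bsub>Md\<^esub> x, y) - frag_of (x, c \<odot>\<^bsub>Ne\<^esub> y)"
      and m: "c \<in> carrier Rg" "x \<in> carrier Md" "y \<in> carrier Ne"
    have "h v = \<beta> (c \<odot>\<^bsub>Md\<^esub> x) y \<otimes>\<^bsub>A\<^esub> inv\<^bsub>A\<^esub> \<beta> x (c \<odot>\<^bsub>Ne\<^esub> y)"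
      unfolding v using h_diff[OF Frs(1) Frs(1)] m hf Md_smult Ne_smult by simp
    then show ?thesis using m \<beta> Ne_smult by (simp add: smult)
  qed
  then have "tensor_rels Rg Md Ne \<subseteq> kernel Fr A h" using tensor_rels_subset unfolding kernel_def by blast
  then have ker: "tensor_kernel Rg Md Ne \<subseteq> kernel Fr A h"
    unfolding tensor_kernel_def by (rule Fr.generate_subgroup_incl) (rule h.subgroup_kernel)
  have "frag_of (x, y) \<in> pt x' y'"
    using eq Fr.rcos_self[OF frag_in_Fr[OF mem(1,2)] TK.subgroup_axioms] by (simp add: pure_tensor_def)
  then obtain k where k: "k \<in> tensor_kernel Rg Md Ne" "frag_of (x, y) = k + frag_of (x', y')"
    by (auto simp: pure_tensor_def r_coset_def)
  then have "k \<in> carrier Fr" "h k = \<one>\<^bsub>A\<^esub>" using ker by (auto simp: kernel_def)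
  then have "h (frag_of (x, y)) = h (frag_of (x', y'))"
    using h_add[OF _ frag_in_Fr[OF mem(3,4)], of k] h.hom_closed[OF frag_in_Fr[OF mem(3,4)]] k(2) by simp
  then show ?thesis using hf mem by simp
qed

end

section \<open>Distribution relations and the measure of a homomorphism\<close>

context cyclotomic
begin

text \<open>
  The difference of the two sides is a polynomial in \<open>y\<close> of degree at most \<open>p\<close> that vanishes at the \<open>p\<close>
  different \<open>p\<close>-th roots of unity and also at \<open>y = 0\<close>, so it is zero.
\<close>

lemma prod_one_minus_zeta: "(\<Prod>k<p. 1 - y * \<zeta> p ^ k) = 1 - y ^ p"
proof -
  define D where "D = (\<Prod>k<p. [:1, - (\<zeta> p ^ k):]) - (1 - Polynomial.monom 1 p)"
  have ev: "poly D x = (\<Prod>k<p. 1 - x * \<zeta> p ^ k) - (1 - x ^ p)" for x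
    by (simp add: D_def poly_prod poly_monom)
  have zp: "\<zeta> p ^ p = 1" by (rule zeta_pow_1[OF p_pos])
  have "D = 0"
  proof (rule ccontr)
    assume "D \<noteq> 0"
    have "Polynomial.degree D \<le> p"
      unfolding D_def
    proof (rule degree_diff_le)
      have "Polynomial.degree (\<Prod>k<p. [:1, - (\<zeta> p ^ k):]) \<le> (\<Sum>k<p. Polynomial.degree [:1, - (\<zeta> p ^ k):])"
        by (rule degree_prod_sum_le[OF finite_lessThan, unfolded o_def])
      also have "\<dots> \<le> (\<Sum>k<p. 1)" by (rule sum_mono) simp
      finally show "Polynomial.degree (\<Prod>k<p. [:1, - (\<zeta> p ^ k):]) \<le> p" by simp
      show "Polynomial.degree (1 - Polynomial.monom 1 p :: 'a poly) \<le> p"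
        by (rule degree_diff_le) (auto simp: degree_monom_le)
    qed
    have "insert 0 ((\<lambda>k. \<zeta> p ^ k) ` {..<p}) \<subseteq> {x. poly D x = 0}"
    proof -
      have "poly D 0 = 0" using p_pos by (simp add: ev zero_power)
      moreover have "poly D (\<zeta> p ^ k) = 0" if "k < p" for k
      proof -
        have "(\<zeta> p ^ k) ^ p = 1" using zp by (metis power_mult mult.commute power_one)
        moreover have "(\<Prod>j<p. 1 - \<zeta> p ^ k * \<zeta> p ^ j) = 0"
        proof (rule prod_zero)
          let ?j = "if k = 0 then 0 else p - k"
          have "\<zeta> p ^ k * \<zeta> p ^ ?j = 1" using that zp by (simp add: power_add[symmetric])
          then show "\<exists>j\<in>{..<p}. 1 - \<zeta> p ^ k * \<zeta> p ^ j = 0"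
            using that by (intro bexI[of _ ?j]) auto
        qed simp
        ultimately show ?thesis by (simp add: ev)
      qed
      ultimately show ?thesis by auto
    qed
    then have "card (insert 0 ((\<lambda>k. \<zeta> p ^ k) ` {..<p})) \<le> card {x. poly D x = 0}"
      by (rule card_mono[OF poly_roots_finite[OF \<open>D \<noteq> 0\<close>]])
    also have "\<dots> \<le> p" using card_poly_roots_bound[OF \<open>D \<noteq> 0\<close>] \<open>Polynomial.degree D \<le> p\<close> by simp
    also have "card (insert 0 ((\<lambda>k. \<zeta> p ^ k) ` {..<p})) = Suc p"
    proof -
      have "inj_on (\<lambda>k. \<zeta> p ^ k) {..<p}"
        by (rule inj_onI) (use zeta_pow_eq_iff[OF p_pos] in \<open>auto simp: cong_def\<close>)
      moreover have "\<zeta> p ^ k \<noteq> 0" for k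
      proof
        assume "\<zeta> p ^ k = 0"
        then have "\<zeta> p = 0" by simp
        then show False using zp p_pos by (simp add: zero_power)
      qed
      then have "0 \<notin> (\<lambda>k. \<zeta> p ^ k) ` {..<p}" by force
      ultimately show ?thesis by (simp add: card_image)
    qed
    finally show False by simp
  qed
  then show ?thesis using ev[of y] by simp
qed

lemma dlog_prod:
  assumes \<phi>: "\<phi> \<in> Dual" and "finite A" "\<And>a. a \<in> A \<Longrightarrow> f a \<in> carrier Cyc"
  shows "(\<Prod>a\<in>A. f a) \<in> carrier Cyc \<and> [dlog \<phi> (\<Prod>a\<in>A. f a) m = (\<Sum>a\<in>A. dlog \<phi> (f a) m)] (mod P m)"
  using assms(2,3)
proof (induction A)
  case empty
  then show ?case by (simp add: dlog_one[OF \<phi>] Cyc_1)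
next
  case (insert a A)
  then have IH: "(\<Prod>a\<in>A. f a) \<in> carrier Cyc" "[dlog \<phi> (\<Prod>a\<in>A. f a) m = (\<Sum>a\<in>A. dlog \<phi> (f a) m)] (mod P m)" and a: "f a \<in> carrier Cyc"
    by auto
  have "[dlog \<phi> (f a * (\<Prod>a\<in>A. f a)) m = dlog \<phi> (f a) m + dlog \<phi> (\<Prod>a\<in>A. f a) m] (mod P m)"
    using dlog_mult[OF \<phi> a IH(1)] by (simp add: cong_def)
  also have "[dlog \<phi> (f a) m + dlog \<phi> (\<Prod>a\<in>A. f a) m = dlog \<phi> (f a) m + (\<Sum>a\<in>A. dlog \<phi> (f a) m)] (mod P m)"
    by (intro cong_add cong_refl IH)
  finally (cong_trans) show ?case using insert(1,2) Cyc_mult[OF a IH(1)] by simp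
qed

abbreviation cyc_unit :: "nat \<Rightarrow> int \<Rightarrow> 'a" where "cyc_unit r i \<equiv> 1 - z r ^ nat i"

lemma R_iff: "i \<in> R r \<longleftrightarrow> 0 \<le> i \<and> i < M r" by (auto simp: residues_mod_def)

lemma z_pow_eq_1_iff: "0 \<le> i \<Longrightarrow> z r ^ nat i = 1 \<longleftrightarrow> M r dvd i"
  using zeta_pow_eq_iff[OF n_pos, of r "nat i" 0]
  by (metis cong_0_iff dvd_nat_abs_iff int_dvd_int_iff int_nat_eq power_0)

lemma z_pow_in_mu: "z r ^ k \<in> \<mu>"
  by (rule mu_power) (rule root_in_mu[OF z_pow_n])

lemma cyc_unit_Cyc: "i \<in> R r \<Longrightarrow> i \<noteq> 0 \<Longrightarrow> cyc_unit r i \<in> carrier Cyc"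
proof -
  assume i: "i \<in> R r" "i \<noteq> 0"
  then have "\<not> M r dvd i" using zdvd_not_zless[of i "M r"] by (auto simp: R_iff)
  then show ?thesis using Cyc_one_minus[OF z_pow_in_mu, of r "nat i"] z_pow_eq_1_iff[of i r] i by (simp add: R_iff)
qed

lemma z_pow_mod: "0 \<le> i \<Longrightarrow> z r ^ nat (i mod M r) = z r ^ nat i"
  by (rule root_pow_int_cong[OF z_pow_n]) (use M_pos[of r] in \<open>auto simp: cong_def\<close>)

lemma distribution:
  assumes j: "j \<in> R r"
  shows "(\<Prod>i\<in>{i\<in>R (Suc r). i mod M r = j}. cyc_unit (Suc r) i) = cyc_unit r j"
proof -
  \<comment> \<open>The residues above \<open>j\<close> are the \<open>j + k M r\<close> with \<open>k < p\<close>, and \<open>\<zeta>_{Np^{r+1}}^{M r}\<close> is \<open>\<zeta>_p\<close>.\<close>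
  let ?e = "\<lambda>k. j + int k * M r"
  have MS: "M (Suc r) = M r * int p" by (simp add: power_Suc of_nat_mult mult_ac)
  have "(\<Prod>i\<in>{i\<in>R (Suc r). i mod M r = j}. cyc_unit (Suc r) i) = (\<Prod>k<p. cyc_unit (Suc r) (?e k))"
  proof (rule prod.reindex_bij_witness[of _ ?e "\<lambda>i. nat (i div M r)"])
    fix i assume i: "i \<in> {i\<in>R (Suc r). i mod M r = j}"
    then have i0: "0 \<le> i" "i < M r * int p" by (auto simp: residues_mod_def MS)
    then have "0 \<le> i div M r" using M_pos[of r] by (simp add: pos_imp_zdiv_nonneg_iff)
    moreover have "i div M r < int p"
    proof (rule ccontr)
      assume "\<not> i div M r < int p"
      then have "int p * M r \<le> (i div M r) * M r" using M_pos[of r] by (intro mult_right_mono) auto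
      also have "\<dots> \<le> i" using div_mult_mod_eq[of i "M r"] pos_mod_sign[OF M_pos[of r], of i] by linarith
      finally show False using i0 by (simp add: mult.commute)
    qed
    ultimately have d: "0 \<le> i div M r" "i div M r < int p" by auto
    have e: "?e (nat (i div M r)) = i" using i d(1) mod_div_mult_eq[of i "M r"] by auto
    show "?e (nat (i div M r)) = i" by (rule e)
    show "cyc_unit (Suc r) (?e (nat (i div M r))) = cyc_unit (Suc r) i" by (simp only: e)
    show "nat (i div M r) \<in> {..<p}" using d by auto
  next
    fix k assume k: "k \<in> {..<p}"
    have "?e k < M r + int k * M r" using j by (simp add: R_iff)
    also have "\<dots> = (int k + 1) * M r" by (simp add: algebra_simps)
    also have "\<dots> \<le> int p * M r" using k M_pos[of r] by (intro mult_right_mono) auto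
    finally have "?e k < M (Suc r)" by (simp add: MS mult.commute)
    then show "?e k \<in> {i\<in>R (Suc r). i mod M r = j}" using j M_pos[of r] by (auto simp: R_iff)
    show "nat (?e k div M r) = k" using j M_pos[of r] by (simp add: R_iff div_pos_pos_trivial)
  qed
  also have "\<dots> = (\<Prod>k<p. 1 - z (Suc r) ^ nat j * \<zeta> p ^ k)"
  proof (rule prod.cong[OF refl])
    fix k
    have "z (Suc r) ^ n r = \<zeta> p"
      using zeta_mult_pow[OF p_pos n_pos, of r] by (simp add: power_Suc mult_ac)
    moreover have "nat (?e k) = nat j + n r * k"
      using j by (simp add: R_iff nat_add_distrib nat_mult_distrib mult.commute)
    ultimately show "cyc_unit (Suc r) (?e k) = 1 - z (Suc r) ^ nat j * \<zeta> p ^ k"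
      by (simp add: power_add power_mult)
  qed
  also have "\<dots> = 1 - (z (Suc r) ^ nat j) ^ p" by (rule prod_one_minus_zeta)
  also have "(z (Suc r) ^ nat j) ^ p = (z (Suc r) ^ p) ^ nat j" by (simp only: power_mult[symmetric] mult.commute)
  also have "z (Suc r) ^ p = z r" using zeta_mult_pow[OF n_pos p_pos, of r] by (simp add: power_Suc mult_ac)
  finally show ?thesis .
qed

text \<open>
  The mass of the class \<open>0\<close> at level \<open>r\<close>. Starting from mass \<open>0\<close> at level \<open>0\<close>, the masses of the nonzero
  classes at level \<open>r + 1\<close> that reduce to \<open>0\<close> are subtracted, as additivity demands.
\<close>

primrec zero_coeff :: "(('a set \<Rightarrow> 'a set) \<Rightarrow> nat \<Rightarrow> 'a) \<Rightarrow> nat \<Rightarrow> nat \<Rightarrow> int" where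
  "zero_coeff \<phi> 0 = (\<lambda>m. 0)"
| "zero_coeff \<phi> (Suc r) = (\<lambda>m. zero_coeff \<phi> r m - (\<Sum>i\<in>{i\<in>R (Suc r). i mod M r = 0 \<and> i \<noteq> 0}. dlog \<phi> (cyc_unit (Suc r) i) m))"

text \<open>
  Representatives of the masses, not yet reduced modulo \<open>p^m\<close>.
\<close>

definition coeffs_of :: "(('a set \<Rightarrow> 'a set) \<Rightarrow> nat \<Rightarrow> 'a) \<Rightarrow> nat \<Rightarrow> int \<Rightarrow> nat \<Rightarrow> int" where
  "coeffs_of \<phi> r i m = (if i = 0 then zero_coeff \<phi> r m else if i \<in> R r then dlog \<phi> (cyc_unit r i) m else 0)"

definition dual_measure :: "(('a set \<Rightarrow> 'a set) \<Rightarrow> nat \<Rightarrow> 'a) \<Rightarrow> nat \<Rightarrow> int \<Rightarrow> profint" where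
  "dual_measure \<phi> = (\<lambda>r i m. coeffs_of \<phi> r i m mod P m)"

lemma dual_measure_apply: "\<phi> \<in> Dual \<Longrightarrow> i \<in> R r \<Longrightarrow> i \<noteq> 0 \<Longrightarrow> dual_measure \<phi> r i = dlog \<phi> (cyc_unit r i)"
  using dlog(1)[OF _ cyc_unit_Cyc] by (simp add: dual_measure_def coeffs_of_def)

text \<open>
  Additivity holds at the nonzero classes by the distribution relation and at \<open>0\<close> by construction.
\<close>

lemma dual_measure_mem:
  assumes \<phi>: "\<phi> \<in> Dual"
  shows "dual_measure \<phi> \<in> Q"
  unfolding dual_measure_def
proof (rule Q_reduceI)
  fix r i assume i: "i \<in> R r"
  show "(\<lambda>m. coeffs_of \<phi> r i m mod P m) \<in> carrier (Zp p)"
  proof (cases "i = 0")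
    case True
    have "[zero_coeff \<phi> r (Suc m) = zero_coeff \<phi> r m] (mod P m)" for m
    proof (induction r)
      case (Suc r)
      have "[(\<Sum>i\<in>{i\<in>R (Suc r). i mod M r = 0 \<and> i \<noteq> 0}. dlog \<phi> (cyc_unit (Suc r) i) (Suc m))
          = (\<Sum>i\<in>{i\<in>R (Suc r). i mod M r = 0 \<and> i \<noteq> 0}. dlog \<phi> (cyc_unit (Suc r) i) m)] (mod P m)"
        by (rule cong_sum, rule Zp_cong, rule dlog(1)[OF \<phi>], rule cyc_unit_Cyc) auto
      then show ?case using Suc by (simp add: cong_diff)
    qed simp
    then show ?thesis using True by (simp add: coeffs_of_def Zp_reduceI)
  next
    case False
    then show ?thesis using i dlog(1)[OF \<phi> cyc_unit_Cyc[OF i False]] by (simp add: coeffs_of_def)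
  qed
next
  fix r i m assume "i \<notin> R r"
  then show "coeffs_of \<phi> r i m mod P m = 0" using zero_mem_R by (auto simp: coeffs_of_def)
next
  fix r j m assume j: "j \<in> R r"
  let ?A = "{i\<in>R (Suc r). i mod M r = j}"
  show "[coeffs_of \<phi> r j m = (\<Sum>i\<in>?A. coeffs_of \<phi> (Suc r) i m)] (mod P m)"
  proof (cases "j = 0")
    case False
    then have ne: "i \<noteq> 0" if "i \<in> ?A" for i using that by auto
    have "[dlog \<phi> (\<Prod>i\<in>?A. cyc_unit (Suc r) i) m = (\<Sum>i\<in>?A. dlog \<phi> (cyc_unit (Suc r) i) m)] (mod P m)"
      using dlog_prod[OF \<phi>, of ?A "cyc_unit (Suc r)" m] cyc_unit_Cyc ne by simp
    moreover have "(\<Sum>i\<in>?A. dlog \<phi> (cyc_unit (Suc r) i) m) = (\<Sum>i\<in>?A. coeffs_of \<phi> (Suc r) i m)"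
      by (rule sum.cong[OF refl]) (use ne in \<open>simp add: coeffs_of_def\<close>)
    ultimately show ?thesis using False j by (simp add: distribution[OF j] coeffs_of_def)
  next
    case True
    let ?B = "{i\<in>R (Suc r). i mod M r = 0 \<and> i \<noteq> 0}"
    have A: "?A = insert 0 ?B" using True zero_mem_R by auto
    have "(\<Sum>i\<in>?A. coeffs_of \<phi> (Suc r) i m) = coeffs_of \<phi> (Suc r) 0 m + (\<Sum>i\<in>?B. coeffs_of \<phi> (Suc r) i m)"
      unfolding A by (rule sum.insert) auto
    also have "(\<Sum>i\<in>?B. coeffs_of \<phi> (Suc r) i m) = (\<Sum>i\<in>?B. dlog \<phi> (cyc_unit (Suc r) i) m)"
      by (rule sum.cong) (auto simp: coeffs_of_def)
    finally show ?thesis using True by (simp add: coeffs_of_def)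
  qed
qed

lemma Dual_eqI_measure:
  assumes \<phi>: "\<phi> \<in> Dual" and \<psi>: "\<psi> \<in> Dual" and eq: "\<And>r i. i \<noteq> 0 \<Longrightarrow> dual_measure \<phi> r i = dual_measure \<psi> r i"
  shows "\<phi> = \<psi>"
proof (rule Dual_eqI_generators[OF \<phi> \<psi>])
  fix \<xi> assume \<xi>: "\<xi> \<in> \<mu>" "\<xi> \<noteq> 1"
  then obtain r where "\<xi> ^ n r = 1" by (auto simp: mu_infty_def)
  then obtain k where k: "k < n r" "\<xi> = z r ^ k" using root_of_unity_zeta_pow[OF n_pos] by blast
  then have "k \<noteq> 0" using \<xi> by (metis power_0)
  moreover have "int k \<in> R r" using k by (simp add: R_iff)
  ultimately show "dlog \<phi> (1 - \<xi>) = dlog \<psi> (1 - \<xi>)"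
    using eq[of "int k" r] dual_measure_apply[OF \<phi>, of "int k" r] dual_measure_apply[OF \<psi>, of "int k" r] k(2) by simp
qed

text \<open>
  The inverse Galois element permutes the units \<open>1 - \<zeta>_{Np^r}^i\<close> of a fixed level.
\<close>

lemma inverse_residue:
  assumes a: "a \<in> UZ" and i: "i \<in> R r" "i \<noteq> 0"
  shows "i * iv a r mod M r \<in> R r" "i * iv a r mod M r \<noteq> 0"
    "gal (iv a) (cyc_unit r i) = cyc_unit r (i * iv a r mod M r)"
proof -
  show "i * iv a r mod M r \<in> R r" by (rule R_mod)
  show "i * iv a r mod M r \<noteq> 0"
  proof
    assume "i * iv a r mod M r = 0"
    then have "M r dvd i" using Zlim_Units_coprime[OF p_pos N_pos iv_mem[OF a], of r]
      by (simp add: coprime_commute coprime_dvd_mult_left_iff mod_eq_0_iff_dvd)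
    then show False using i zdvd_not_zless[of i "M r"] by (auto simp: R_iff)
  qed
  have i0: "0 \<le> i" using i by (simp add: R_iff)
  have "(z r ^ nat i) ^ n r = 1" using z_pow_n[of r] by (metis power_mult mult.commute power_one)
  then have "gal (iv a) (cyc_unit r i) = 1 - (z r ^ nat i) ^ nat (iv a r)"
    by (rule gal_one_minus_root[OF iv_mem[OF a]])
  also have "(z r ^ nat i) ^ nat (iv a r) = z r ^ nat (i * iv a r)"
    using i0 by (simp add: power_mult[symmetric] nat_mult_distrib)
  also have "\<dots> = z r ^ nat (i * iv a r mod M r)"
    by (rule z_pow_mod[symmetric]) (use i0 unit_nat[OF iv_mem[OF a]] in simp)
  finally show "gal (iv a) (cyc_unit r i) = cyc_unit r (i * iv a r mod M r)" .
qed

text \<open>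
  The linearity of the construction. At a sufficiently fine level \<open>s\<close> the value on the left is a Riemann
  sum over the units \<open>c\<close> modulo \<open>Np^s\<close>, with weight \<open>l(c) c\<close> and the value of the measure of \<open>\<phi>\<close> at
  \<open>i/c\<close>. Collecting the \<open>c\<close> with the same residue \<open>a\<close> modulo \<open>Np^r\<close> gives the weight
  \<open>twist_Lambda p N l r a\<close> and hence the convolution.
\<close>

lemma dual_measure_smult:
  assumes l: "l \<in> L" and \<phi>: "\<phi> \<in> Dual" and i: "i \<in> R r" "i \<noteq> 0"
  shows "dual_measure (CK_dual_smult p N l \<phi>) r i = conv p (M r) (U r) (R r) (twist_Lambda p N l r) (dual_measure \<phi> r) i"
proof
  fix m
  let ?l' = "twist_Lambda p N l" and ?\<psi> = "CK_dual_smult p N l \<phi>" and ?u = "cyc_unit r i"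
  have u: "?u \<in> carrier Cyc" by (rule cyc_unit_Cyc[OF i])
  define s where "s = max (max (unit_level ?u) m) r"
  have s: "unit_level ?u \<le> s" "m \<le> s" "r \<le> s" by (auto simp: s_def)
  \<comment> \<open>Only \<open>j = i/a\<close> contributes to \<open>S a\<close>.\<close>
  define S where "S = (\<lambda>a. \<Sum>j\<in>R r. dual_measure \<phi> r j m * of_bool (a * j mod M r = i))"
  have "[dlog ?\<psi> ?u m = Riemann_sum l \<phi> s (unit_lift s) ?u m] (mod P m)"
    by (rule CK_dual_smult_spec(2)[OF l \<phi> u s(1,2)]) (use unit_lift in auto)
  also have "[Riemann_sum l \<phi> s (unit_lift s) ?u m = (\<Sum>c\<in>U s. l s c m * c * S (c mod M r))] (mod P m)"
    unfolding Riemann_sum_def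
  proof (rule cong_sum)
    fix c assume c: "c \<in> U s"
    let ?a = "unit_lift s c" and ?j = "i * iv (unit_lift s c) r mod M r"
    note a = unit_lift(1)[OF c]
    have ar: "?a r = c mod M r" using Zlim_mod[OF UZ_carrier[OF a] s(3)] unit_lift(2)[OF c] by simp
    have inv: "[c mod M r * iv ?a r = 1] (mod M r)" using Zlim_Units_inv(3)[OF p_pos N_pos a, of r] by (simp add: ar)
    have "(c mod M r) * j mod M r = i \<longleftrightarrow> j = ?j" if j: "j \<in> R r" for j
    proof
      assume "(c mod M r) * j mod M r = i"
      then have "?j = ((c mod M r) * iv ?a r) * j mod M r"
        by (metis (no_types, opaque_lifting) mod_mult_left_eq mult.assoc mult.commute)
      also have "\<dots> = j mod M r" using cong_scalar_right[OF inv, of j] by (simp add: cong_def)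
      also have "\<dots> = j" using j by (simp add: R_iff)
      finally show "j = ?j" by simp
    next
      assume "j = ?j"
      then have "(c mod M r) * j mod M r = ((c mod M r) * iv ?a r) * i mod M r"
        by (metis (no_types, opaque_lifting) mod_mult_right_eq mult.assoc mult.commute)
      also have "\<dots> = i mod M r" using cong_scalar_right[OF inv, of i] by (simp add: cong_def)
      also have "\<dots> = i" using i by (simp add: R_iff)
      finally show "(c mod M r) * j mod M r = i" .
    qed
    then have "S (c mod M r) = (\<Sum>j\<in>R r. if j = ?j then dual_measure \<phi> r j m else 0)"
      unfolding S_def by (intro sum.cong refl) auto
    also have "\<dots> = dual_measure \<phi> r ?j m" using inverse_residue(1)[OF a i] by simp
    also have "\<dots> = dlog \<phi> (gal (iv ?a) ?u) m"
      using dual_measure_apply[OF \<phi> inverse_residue(1,2)[OF a i]] by (simp only: inverse_residue(3)[OF a i])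
    finally have Sc: "S (c mod M r) = dlog \<phi> (gal (iv ?a) ?u) m" .
    have "[?a s = ?a m] (mod P m)"
      by (rule cong_dvd_modulus[OF Zlim_cong[OF UZ_carrier[OF a] s(2)]]) (rule P_dvd_M, simp)
    then have "[?a m = c] (mod P m)" using unit_lift(2)[OF c] by (simp add: cong_sym)
    then show "[l s c m * (?a m * dlog \<phi> (gal (iv ?a) ?u) m) = l s c m * c * S (c mod M r)] (mod P m)"
      unfolding Sc mult.assoc by (intro cong_mult cong_refl)
  qed
  also have "(\<Sum>c\<in>U s. l s c m * c * S (c mod M r)) = (\<Sum>a\<in>U r. \<Sum>c\<in>{c\<in>U s. c mod M r = a}. l s c m * c * S (c mod M r))"
    by (rule sum.group[symmetric]) (use U_mod[OF _ s(3)] in auto)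
  also have "\<dots> = (\<Sum>a\<in>U r. (\<Sum>c\<in>{c\<in>U s. c mod M r = a}. l s c m * c) * S a)"
    unfolding sum_distrib_right by (intro sum.cong refl) auto
  also have "[(\<Sum>a\<in>U r. (\<Sum>c\<in>{c\<in>U s. c mod M r = a}. l s c m * c) * S a) = (\<Sum>a\<in>U r. ?l' r a m * S a)] (mod P m)"
    by (intro cong_sum cong_mult cong_refl cong_sym[OF twist_cong[OF l s(3,2)]])
  finally (cong_trans) have "dlog ?\<psi> ?u m = (\<Sum>a\<in>U r. ?l' r a m * S a) mod P m"
    using dlog(1)[OF CK_dual_smult_spec(1)[OF l \<phi>] u] by (simp add: cong_def)
  then show "dual_measure ?\<psi> r i m = conv p (M r) (U r) (R r) (?l' r) (dual_measure \<phi> r) i m"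
    using conv_apply[OF twist_mem[OF l] dual_measure_mem[OF \<phi>], of r i m]
    by (simp only: dual_measure_apply[OF CK_dual_smult_spec(1)[OF l \<phi>] i] S_def)
qed

end

section \<open>The dual as a module and the map to the star module\<close>

lemma continuous_map_discrete_combine:
  assumes "continuous_map tp (discrete_topology UNIV) f" "continuous_map tp (discrete_topology UNIV) f'"
  shows "continuous_map tp (discrete_topology UNIV) (\<lambda>x. h (f x) (f' x))"
proof -
  have "continuous_map tp (prod_topology (discrete_topology UNIV) (discrete_topology UNIV)) (\<lambda>x. (f x, f' x))"
    using assms by (simp add: continuous_map_paired)
  then have "continuous_map tp (discrete_topology UNIV) (\<lambda>x. (f x, f' x))"
    by (simp add: prod_topology_discrete_topology[symmetric])
  moreover have "continuous_map (discrete_topology UNIV) (discrete_topology UNIV) (\<lambda>(a, b). h a b)" by simp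
  ultimately have "continuous_map tp (discrete_topology UNIV) ((\<lambda>(a, b). h a b) \<circ> (\<lambda>x. (f x, f' x)))"
    by (rule continuous_map_compose)
  then show ?thesis by (simp add: o_def)
qed

context cyclotomic
begin

abbreviation DualM where "DualM \<equiv> CK_dual p N :: (nat \<Rightarrow> int \<Rightarrow> profint, ('a set \<Rightarrow> 'a set) \<Rightarrow> nat \<Rightarrow> 'a) module"

lemma DualM_simps:
  "carrier DualM = Dual"
  "\<phi> \<oplus>\<^bsub>DualM\<^esub> \<psi> = (\<lambda>x\<in>carrier Cyc_hat. \<lambda>r. \<phi> x r * \<psi> x r)"
  "\<zero>\<^bsub>DualM\<^esub> = (\<lambda>x\<in>carrier Cyc_hat. \<lambda>r. 1)"
  "l \<odot>\<^bsub>DualM\<^esub> \<phi> = CK_dual_smult p N l \<phi>"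
  by (simp_all add: CK_dual_def Tate_simps)

lemma Dual_continuous: "\<phi> \<in> Dual \<Longrightarrow> continuous_map (pro_p_topology p Cyc) (discrete_topology UNIV) (\<lambda>x. \<phi> x r)"
  using Dual_iff by blast

lemma Dual_restrictI:
  assumes "\<And>x. x \<in> carrier Cyc_hat \<Longrightarrow> f x \<in> carrier T"
    "\<And>x y r. x \<in> carrier Cyc_hat \<Longrightarrow> y \<in> carrier Cyc_hat \<Longrightarrow> f (x \<otimes>\<^bsub>Cyc_hat\<^esub> y) r = f x r * f y r"
    "\<And>r. continuous_map (pro_p_topology p Cyc) (discrete_topology UNIV) (\<lambda>x. f x r)"
  shows "restrict f (carrier Cyc_hat) \<in> Dual"
  unfolding Dual_iff
proof (intro conjI ballI allI)
  fix x y assume "x \<in> carrier Cyc_hat" "y \<in> carrier Cyc_hat"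
  then show "restrict f (carrier Cyc_hat) (x \<otimes>\<^bsub>Cyc_hat\<^esub> y) = (\<lambda>r. restrict f (carrier Cyc_hat) x r * restrict f (carrier Cyc_hat) y r)"
    using CycHat.Ghat_mult_closed[of x y] assms(2) by (simp add: fun_eq_iff)
next
  fix r show "continuous_map (pro_p_topology p Cyc) (discrete_topology UNIV) (\<lambda>x. restrict f (carrier Cyc_hat) x r)"
    by (rule continuous_map_eq[OF assms(3)[of r]]) (simp add: CycHat.pro_p_topology_topspace)
qed (use assms(1) in auto)

lemma Dual_add: "\<phi> \<in> Dual \<Longrightarrow> \<psi> \<in> Dual \<Longrightarrow> \<phi> \<oplus>\<^bsub>DualM\<^esub> \<psi> \<in> Dual"
  unfolding DualM_simps
proof (rule Dual_restrictI)
  fix x assume "\<phi> \<in> Dual" "\<psi> \<in> Dual" "x \<in> carrier Cyc_hat"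
  then show "(\<lambda>r. \<phi> x r * \<psi> x r) \<in> carrier T"
    using abelian_monoid.a_closed[OF abelian_group.axioms(1)[OF abelian_group_Tate] Dual_mem[of \<phi> x] Dual_mem[of \<psi> x]]
    by (simp add: Tate_simps)
qed (auto simp: Dual_mult intro: continuous_map_discrete_combine[where h = "(*)"] Dual_continuous)

lemma Dual_uminus: "\<phi> \<in> Dual \<Longrightarrow> (\<lambda>x\<in>carrier Cyc_hat. \<lambda>r. inverse (\<phi> x r)) \<in> Dual"
proof (rule Dual_restrictI)
  fix x assume "\<phi> \<in> Dual" "x \<in> carrier Cyc_hat"
  then have "\<phi> x \<in> carrier T" by (rule Dual_mem)
  then show "(\<lambda>r. inverse (\<phi> x r)) \<in> carrier T" by (simp add: Tate_carrier power_inverse)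
next
  fix r assume "\<phi> \<in> Dual"
  from continuous_map_discrete_combine[OF Dual_continuous[OF this] Dual_continuous[OF this], where h = "\<lambda>a b. inverse a"]
  show "continuous_map (pro_p_topology p Cyc) (discrete_topology UNIV) (\<lambda>x. inverse (\<phi> x r))" .
qed (simp add: Dual_mult)

lemma Tate_nonzero: "w \<in> carrier T \<Longrightarrow> w r \<noteq> 0"
  using pp[of r] zero_power[OF pp, of r, where ?'a = 'a] by (metis Tate_carrier zero_neq_one)

lemma abelian_group_DualM: "abelian_group DualM"
proof (rule abelian_groupI, unfold DualM_simps(1))
  show "\<zero>\<^bsub>DualM\<^esub> \<in> Dual" unfolding DualM_simps
    by (rule Dual_restrictI) (simp_all add: Tate_carrier)
next
  fix \<phi> assume \<phi>: "\<phi> \<in> Dual"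
  then have ext: "\<phi> \<in> extensional (carrier Cyc_hat)" using Dual_iff by blast
  show "\<zero>\<^bsub>DualM\<^esub> \<oplus>\<^bsub>DualM\<^esub> \<phi> = \<phi>"
    using ext by (auto simp: DualM_simps fun_eq_iff extensional_def)
  show "\<exists>\<psi>\<in>Dual. \<psi> \<oplus>\<^bsub>DualM\<^esub> \<phi> = \<zero>\<^bsub>DualM\<^esub>"
    by (rule bexI[OF _ Dual_uminus[OF \<phi>]])
       (use Tate_nonzero[OF Dual_mem[OF \<phi>]] in \<open>auto simp: DualM_simps fun_eq_iff\<close>)
qed (auto simp: Dual_add, auto simp: DualM_simps fun_eq_iff mult_ac)

lemma dlog_add:
  assumes "\<phi> \<in> Dual" "\<psi> \<in> Dual" "u \<in> carrier Cyc"
  shows "dlog (\<phi> \<oplus>\<^bsub>DualM\<^esub> \<psi>) u = (\<lambda>m. (dlog \<phi> u m + dlog \<psi> u m) mod P m)"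
proof (rule dlog_eqI[OF Dual_add[OF assms(1,2)] assms(3)])
  note d = dlog[OF assms(1,3)] dlog[OF assms(2,3)]
  show "(\<lambda>m. (dlog \<phi> u m + dlog \<psi> u m) mod P m) \<in> carrier (Zp p)" by (intro Zp_add_mem d)
  show "(\<phi> \<oplus>\<^bsub>DualM\<^esub> \<psi>) (unit_class u) = tate_point (\<lambda>m. (dlog \<phi> u m + dlog \<psi> u m) mod P m)"
    unfolding tate_point_add[OF d(1,3)] using unit_class_mem[OF assms(3)] by (simp only: DualM_simps d(2,4)[symmetric] restrict_apply')
qed

lemma dual_measure_add:
  assumes "\<phi> \<in> Dual" "\<psi> \<in> Dual" "i \<noteq> 0"
  shows "dual_measure (\<phi> \<oplus>\<^bsub>DualM\<^esub> \<psi>) r i = (\<lambda>m. (dual_measure \<phi> r i m + dual_measure \<psi> r i m) mod P m)"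
proof (cases "i \<in> R r")
  case True
  then show ?thesis
    using dual_measure_apply[OF Dual_add[OF assms(1,2)]] dual_measure_apply[OF assms(1)] dual_measure_apply[OF assms(2)] assms(3)
      dlog_add[OF assms(1,2) cyc_unit_Cyc] by simp
next
  case False
  then show ?thesis using Q_outside[OF dual_measure_mem] Dual_add assms by simp
qed

lemma dual_measure_uminus:
  assumes \<phi>: "\<phi> \<in> Dual" and i: "i \<noteq> 0"
  shows "dual_measure (\<ominus>\<^bsub>DualM\<^esub> \<phi>) r i = (\<lambda>m. (- dual_measure \<phi> r i m) mod P m)"
proof
  fix m
  interpret DualM: abelian_group DualM by (rule abelian_group_DualM)
  have m': "\<ominus>\<^bsub>DualM\<^esub> \<phi> \<in> Dual" using DualM.a_inv_closed[of \<phi>] \<phi> by (simp add: DualM_simps(1))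
  have zero: "\<zero>\<^bsub>DualM\<^esub> \<in> Dual" using DualM.zero_closed by (simp add: DualM_simps(1))
  have mz: "dual_measure \<zero>\<^bsub>DualM\<^esub> r i m = 0"
  proof -
    have "dual_measure \<zero>\<^bsub>DualM\<^esub> r i m = (dual_measure \<zero>\<^bsub>DualM\<^esub> r i m + dual_measure \<zero>\<^bsub>DualM\<^esub> r i m) mod P m"
      using fun_cong[OF dual_measure_add[OF zero zero i, of r], of m] by simp
    then have "[dual_measure \<zero>\<^bsub>DualM\<^esub> r i m + 0 = dual_measure \<zero>\<^bsub>DualM\<^esub> r i m + dual_measure \<zero>\<^bsub>DualM\<^esub> r i m] (mod P m)"
      using Q_mem[OF dual_measure_mem[OF zero], of r i] by (simp add: cong_def)
    then have "[0 = dual_measure \<zero>\<^bsub>DualM\<^esub> r i m] (mod P m)" by (simp only: cong_add_lcancel)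
    then show ?thesis using Q_mem[OF dual_measure_mem[OF zero], of r i] by (simp add: cong_def)
  qed
  have "\<ominus>\<^bsub>DualM\<^esub> \<phi> \<oplus>\<^bsub>DualM\<^esub> \<phi> = \<zero>\<^bsub>DualM\<^esub>" using DualM.l_neg[of \<phi>] \<phi> by (simp add: DualM_simps(1))
  then have "(dual_measure (\<ominus>\<^bsub>DualM\<^esub> \<phi>) r i m + dual_measure \<phi> r i m) mod P m = 0"
    using dual_measure_add[OF m' \<phi> i, of r] mz by (metis (mono_tags, lifting))
  then have "[dual_measure (\<ominus>\<^bsub>DualM\<^esub> \<phi>) r i m = - dual_measure \<phi> r i m] (mod P m)"
    by (simp add: cong_iff_dvd_diff mod_eq_0_iff_dvd)
  then show "dual_measure (\<ominus>\<^bsub>DualM\<^esub> \<phi>) r i m = (- dual_measure \<phi> r i m) mod P m"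
    using Q_mem[OF dual_measure_mem[OF m'], of r i] by (simp add: cong_def)
qed

subsection \<open>The minus parts\<close>

definition minus_one_elt where "minus_one_elt = group_elt p (\<ominus>\<^bsub>Zlim p N\<^esub> \<one>\<^bsub>Zlim p N\<^esub>)"

lemma minus_part_carrier:
  "x \<in> carrier (minus_part p N V) \<longleftrightarrow> x \<in> carrier V \<and> minus_one_elt \<odot>\<^bsub>V\<^esub> x = \<ominus>\<^bsub>V\<^esub> x"
  by (simp add: minus_part_def minus_one_elt_def)

lemma minus_part_ops: "(\<oplus>\<^bsub>minus_part p N V\<^esub>) = (\<oplus>\<^bsub>V\<^esub>)" "(\<odot>\<^bsub>minus_part p N V\<^esub>) = (\<odot>\<^bsub>V\<^esub>)"
  by (simp_all add: minus_part_def)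

lemma minus_one_eq: "\<ominus>\<^bsub>Zlim p N\<^esub> \<one>\<^bsub>Zlim p N\<^esub> = (\<lambda>r. (- 1) mod M r)"
  using Zlim_a_inv[OF p_pos N_pos Zlim_one_mem] by (simp add: mod_simps)

lemma minus_one_U: "(- 1) mod M r \<in> U r"
  using M_pos[of r] by (simp add: unit_residues_def)

lemma minus_one_carrier: "(\<lambda>r. (- 1) mod M r) \<in> carrier (Zlim p N)"
  using cring.cring_simprules(3)[OF Zlim_cring[OF p_pos N_pos] Zlim_one_mem] minus_one_eq by simp

lemma minus_one_elt_apply: "minus_one_elt s c m = (if c = (- 1) mod M s then 1 mod P m else 0)"
  unfolding minus_one_elt_def group_elt_def minus_one_eq scaled_single_apply by simp

lemma minus_one_elt_L: "minus_one_elt \<in> L"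
  unfolding minus_one_elt_def group_elt_def minus_one_eq
  by (rule measure_scaled_point[OF _ minus_one_carrier minus_one_U]) (simp_all add: Zp_one_mem)

lemma twist_minus_one: "[twist_Lambda p N minus_one_elt r a m = - of_bool (a = (- 1) mod M r)] (mod P m)"
proof -
  let ?s = "max r m"
  let ?e = "(- 1) mod M ?s"
  have "[twist_Lambda p N minus_one_elt r a m = (\<Sum>c\<in>{c\<in>U ?s. c mod M r = a}. minus_one_elt ?s c m * c)] (mod P m)"
    by (rule twist_cong[OF minus_one_elt_L]) auto
  also have "(\<Sum>c\<in>{c\<in>U ?s. c mod M r = a}. minus_one_elt ?s c m * c) = (\<Sum>c\<in>U ?s. if c mod M r = a then minus_one_elt ?s c m * c else 0)"
    by (rule sum.inter_filter) simp
  also have "\<dots> = (\<Sum>c\<in>U ?s. if c = ?e then of_bool (c mod M r = a) * (1 mod P m) * c else 0)"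
    by (intro sum.cong refl) (simp add: minus_one_elt_apply)
  also have "\<dots> = of_bool (?e mod M r = a) * (1 mod P m) * ?e"
    using minus_one_U[of ?s] by simp
  also have "?e mod M r = (- 1) mod M r" by (rule mod_mod_cancel) (rule lvl_dvd, simp)
  also have "[of_bool ((- 1) mod M r = a) * (1 mod P m) * ?e = of_bool ((- 1) mod M r = a) * 1 * (- 1)] (mod P m)"
  proof (intro cong_mult cong_refl)
    show "[1 mod P m = 1] (mod P m)" by (simp add: cong_def)
    show "[?e = - 1] (mod P m)" using cong_mod_left[OF P_dvd_M, of m ?s "-1" "-1"] by simp
  qed
  finally (cong_trans) show ?thesis by (simp add: eq_commute[of a])
qed

text \<open>
  In the twist \<open>[-1]\<close> acts as \<open>-[-1]\<close>, that is, by reflecting the measure and changing its sign.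
\<close>

lemma conv_twist_minus_one:
  assumes \<nu>: "\<nu> \<in> Q" and i: "i \<in> R r"
  shows "conv p (M r) (U r) (R r) (twist_Lambda p N minus_one_elt r) (\<nu> r) i m = (- \<nu> r ((- i) mod M r) m) mod P m"
proof -
  define S where "S = (\<lambda>a. \<Sum>j\<in>R r. \<nu> r j m * of_bool (a * j mod M r = i))"
  let ?e = "(- 1) mod M r"
  have "[(\<Sum>a\<in>U r. twist_Lambda p N minus_one_elt r a m * S a) = (\<Sum>a\<in>U r. - of_bool (a = ?e) * S a)] (mod P m)"
    by (intro cong_sum cong_mult cong_refl twist_minus_one)
  also have "(\<Sum>a\<in>U r. - of_bool (a = ?e) * S a) = (\<Sum>a\<in>U r. if a = ?e then - S a else 0)"
    by (intro sum.cong refl) auto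
  also have "\<dots> = - S ?e" using minus_one_U by simp
  also have "S ?e = (\<Sum>j\<in>R r. if j = (- i) mod M r then \<nu> r j m else 0)"
    unfolding S_def
  proof (intro sum.cong refl)
    fix j assume j: "j \<in> R r"
    have "?e * j mod M r = i \<longleftrightarrow> [- j = i] (mod M r)"
      using i by (simp add: mod_mult_left_eq cong_def R_iff)
    also have "\<dots> \<longleftrightarrow> [j = - i] (mod M r)" by (metis cong_minus_minus_iff minus_minus)
    also have "\<dots> \<longleftrightarrow> j = (- i) mod M r" using j by (simp add: cong_def R_iff)
    finally show "\<nu> r j m * of_bool (?e * j mod M r = i) = (if j = (- i) mod M r then \<nu> r j m else 0)" by simp
  qed
  also have "\<dots> = \<nu> r ((- i) mod M r) m" using R_mod by simp
  finally have "[(\<Sum>a\<in>U r. twist_Lambda p N minus_one_elt r a m * S a) = - \<nu> r ((- i) mod M r) m] (mod P m)" .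
  then show ?thesis using conv_apply[OF twist_mem[OF minus_one_elt_L] \<nu>, of r i m] by (simp add: cong_def S_def)
qed

definition even_off_zero :: "(nat \<Rightarrow> int \<Rightarrow> profint) \<Rightarrow> bool" where
  "even_off_zero \<nu> \<longleftrightarrow> (\<forall>r. \<forall>i\<in>R r. i \<noteq> 0 \<longrightarrow> \<nu> r ((- i) mod M r) = \<nu> r i)"

text \<open>
  Substitute \<open>-j\<close> for \<open>j\<close> in the inner sum of the convolution.
\<close>

lemma conv_even:
  assumes l: "l \<in> L" and \<nu>: "\<nu> \<in> Q" and ev: "even_off_zero \<nu>"
  shows "even_off_zero (\<lambda>r. conv p (M r) (U r) (R r) (l r) (\<nu> r))"
  unfolding even_off_zero_def
proof (intro allI ballI impI ext)
  fix r i m assume i: "i \<in> R r"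
  have neg: "(- ((- j) mod M r)) mod M r = j" if "j \<in> R r" for j
    using that by (simp add: mod_minus_eq R_iff)
  have "(\<Sum>j\<in>R r. \<nu> r j m * of_bool (a * j mod M r = (- i) mod M r)) = (\<Sum>j\<in>R r. \<nu> r j m * of_bool (a * j mod M r = i))" for a
  proof (rule sum.reindex_bij_witness[of _ "\<lambda>j. (- j) mod M r" "\<lambda>j. (- j) mod M r"])
    fix j assume j: "j \<in> R r"
    have "\<nu> r ((- j) mod M r) = \<nu> r j" using ev j by (cases "j = 0") (auto simp: even_off_zero_def)
    moreover have "a * ((- j) mod M r) mod M r = i \<longleftrightarrow> a * j mod M r = (- i) mod M r"
    proof -
      have "a * ((- j) mod M r) mod M r = i \<longleftrightarrow> [- (a * j) = i] (mod M r)"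
        using i by (simp add: mod_mult_right_eq cong_def R_iff)
      also have "\<dots> \<longleftrightarrow> [a * j = - i] (mod M r)" by (metis cong_minus_minus_iff minus_minus)
      finally show ?thesis by (simp add: cong_def)
    qed
    ultimately show "\<nu> r ((- j) mod M r) m * of_bool (a * ((- j) mod M r) mod M r = i) = \<nu> r j m * of_bool (a * j mod M r = (- i) mod M r)"
      by simp
  qed (use neg R_mod in auto)
  then show "conv p (M r) (U r) (R r) (l r) (\<nu> r) ((- i) mod M r) m = conv p (M r) (U r) (R r) (l r) (\<nu> r) i m"
    unfolding conv_apply[OF l \<nu>] by simp
qed

lemma minus_residue: "i \<in> R r \<Longrightarrow> i \<noteq> 0 \<Longrightarrow> (- i) mod M r \<in> R r \<and> (- i) mod M r \<noteq> 0"
  using R_mod zdvd_not_zless[of i "M r"] by (auto simp: R_iff mod_eq_0_iff_dvd)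

text \<open>
  On measures \<open>[-1]\<close> acts by reflection and sign, so \<open>[-1]\<phi> = -\<phi>\<close> says that the measure of
  \<open>\<phi>\<close> is even away from \<open>0\<close>.
\<close>

lemma DualM_minus_iff:
  assumes \<phi>: "\<phi> \<in> Dual"
  shows "minus_one_elt \<odot>\<^bsub>DualM\<^esub> \<phi> = \<ominus>\<^bsub>DualM\<^esub> \<phi> \<longleftrightarrow> even_off_zero (dual_measure \<phi>)"
proof -
  interpret DualM: abelian_group DualM by (rule abelian_group_DualM)
  have m': "\<ominus>\<^bsub>DualM\<^esub> \<phi> \<in> Dual" using DualM.a_inv_closed[of \<phi>] \<phi> by (simp add: DualM_simps(1))
  have s': "minus_one_elt \<odot>\<^bsub>DualM\<^esub> \<phi> \<in> Dual" unfolding DualM_simps by (rule CK_dual_smult_spec(1)[OF minus_one_elt_L \<phi>])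
  have meas_s: "dual_measure (minus_one_elt \<odot>\<^bsub>DualM\<^esub> \<phi>) r i m = (- dual_measure \<phi> r ((- i) mod M r) m) mod P m" if "i \<in> R r" "i \<noteq> 0" for r i m
    unfolding DualM_simps dual_measure_smult[OF minus_one_elt_L \<phi> that] conv_twist_minus_one[OF dual_measure_mem[OF \<phi>] that(1)] by simp
  have key: "(- dual_measure \<phi> r j m) mod P m = (- dual_measure \<phi> r i m) mod P m \<longleftrightarrow> dual_measure \<phi> r j m = dual_measure \<phi> r i m" for r i j m
    using Q_mem[OF dual_measure_mem[OF \<phi>]] cong_minus_minus_iff[of "dual_measure \<phi> r j m" "dual_measure \<phi> r i m" "P m"] by (simp add: cong_def)
  show ?thesis
  proof
    assume eq: "minus_one_elt \<odot>\<^bsub>DualM\<^esub> \<phi> = \<ominus>\<^bsub>DualM\<^esub> \<phi>"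
    show "even_off_zero (dual_measure \<phi>)"
      unfolding even_off_zero_def
    proof (intro allI ballI impI ext)
      fix r i m assume "i \<in> R r" "i \<noteq> 0"
      then show "dual_measure \<phi> r ((- i) mod M r) m = dual_measure \<phi> r i m"
        using meas_s[of i r m] dual_measure_uminus[OF \<phi>, of i r] key unfolding eq by simp
    qed
  next
    assume ev: "even_off_zero (dual_measure \<phi>)"
    show "minus_one_elt \<odot>\<^bsub>DualM\<^esub> \<phi> = \<ominus>\<^bsub>DualM\<^esub> \<phi>"
    proof (rule Dual_eqI_measure[OF s' m'])
      fix r and i :: int assume i: "i \<noteq> 0"
      show "dual_measure (minus_one_elt \<odot>\<^bsub>DualM\<^esub> \<phi>) r i = dual_measure (\<ominus>\<^bsub>DualM\<^esub> \<phi>) r i"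
      proof (cases "i \<in> R r")
        case True
        then have "dual_measure \<phi> r ((- i) mod M r) = dual_measure \<phi> r i" using ev i by (simp add: even_off_zero_def)
        then show ?thesis using meas_s[OF True i] dual_measure_uminus[OF \<phi> i, of r] by (simp add: fun_eq_iff)
      next
        case False
        then show ?thesis using Q_outside[OF dual_measure_mem[OF s']] Q_outside[OF dual_measure_mem[OF m']] by simp
      qed
    qed
  qed
qed

abbreviation TwistM where "TwistM \<equiv> Tate_twist p N (Lambda_star p N)"

lemma TwistM_simps:
  "carrier TwistM = star_cls ` Q" "S \<oplus>\<^bsub>TwistM\<^esub> S' = S \<oplus>\<^bsub>Lambda_star p N\<^esub> S'" "\<zero>\<^bsub>TwistM\<^esub> = \<zero>\<^bsub>Lambda_star p N\<^esub>"
  "l \<odot>\<^bsub>TwistM\<^esub> S = twist_Lambda p N l \<odot>\<^bsub>Lambda_star p N\<^esub> S"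
  by (simp_all add: Tate_twist_def restrict_scalars_def Lambda_star_carrier)

lemma abelian_group_TwistM: "abelian_group TwistM"
  by (rule abelian_group_cong[OF abelian_group_Lambda_star]) (simp_all add: Tate_twist_def restrict_scalars_def)

lemma TwistM_uminus:
  assumes \<nu>: "\<nu> \<in> Q"
  shows "\<ominus>\<^bsub>TwistM\<^esub> star_cls \<nu> = star_cls (\<lambda>r i m. (- \<nu> r i m) mod P m)"
proof -
  interpret TwistM: abelian_group TwistM by (rule abelian_group_TwistM)
  have z: "\<zero>\<^bsub>TwistM\<^esub> = star_cls (\<lambda>r i m. 0)"
  proof -
    interpret abelian_subgroup "star_kernel p N" "completed_module p N" by (rule star_kernel_subgroup)
    have "star_cls \<zero>\<^bsub>completed_module p N\<^esub> = star_kernel p N" by (rule a_coset_add_zero[OF a_subset])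
    moreover have "\<zero>\<^bsub>Lambda_star p N\<^esub> = star_kernel p N" by (simp add: Lambda_star_def quot_module_zero)
    ultimately show ?thesis using TwistM_simps(3) by (simp only: completed_module_simps(3))
  qed
  have "(\<lambda>r i m. ((- \<nu> r i m) mod P m + \<nu> r i m) mod P m) = (\<lambda>r i m. 0)" by (simp add: mod_simps)
  then have "star_cls (\<lambda>r i m. (- \<nu> r i m) mod P m) \<oplus>\<^bsub>TwistM\<^esub> star_cls \<nu> = \<zero>\<^bsub>TwistM\<^esub>"
    unfolding TwistM_simps(2) Lambda_star_add[OF Q_uminus[OF \<nu>] \<nu>] z by (simp only:)
  then show ?thesis by (rule TwistM.minus_equality) (use \<nu> Q_uminus in \<open>auto simp: TwistM_simps(1)\<close>)
qed

lemma TwistM_minusI: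
  assumes \<nu>: "\<nu> \<in> Q" and ev: "even_off_zero \<nu>"
  shows "star_cls \<nu> \<in> carrier (minus_part p N TwistM)"
proof -
  have "minus_one_elt \<odot>\<^bsub>TwistM\<^esub> star_cls \<nu> = star_cls (\<lambda>r. conv p (M r) (U r) (R r) (twist_Lambda p N minus_one_elt r) (\<nu> r))"
    unfolding TwistM_simps by (rule Lambda_star_smult[OF twist_mem[OF minus_one_elt_L] \<nu>])
  also have "\<dots> = star_cls (\<lambda>r i m. (- \<nu> r i m) mod P m)"
  proof (subst star_cls_eq_iff)
    note c = conv_mem_Q[OF twist_mem[OF minus_one_elt_L] \<nu>]
    show "(\<lambda>r. conv p (M r) (U r) (R r) (twist_Lambda p N minus_one_elt r) (\<nu> r)) \<in> Q" "(\<lambda>r i m. (- \<nu> r i m) mod P m) \<in> Q"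
      by (rule c, rule Q_uminus[OF \<nu>])
    show "\<forall>r i. i \<noteq> 0 \<longrightarrow> conv p (M r) (U r) (R r) (twist_Lambda p N minus_one_elt r) (\<nu> r) i = (\<lambda>m. (- \<nu> r i m) mod P m)"
    proof (intro allI impI)
      fix r and i :: int assume i: "i \<noteq> 0"
      show "conv p (M r) (U r) (R r) (twist_Lambda p N minus_one_elt r) (\<nu> r) i = (\<lambda>m. (- \<nu> r i m) mod P m)"
      proof (cases "i \<in> R r")
        case True
        then show ?thesis using ev i conv_twist_minus_one[OF \<nu> True] by (simp add: even_off_zero_def fun_eq_iff)
      next
        case False
        then show ?thesis using Q_outside[OF c] Q_outside[OF \<nu>] by simp
      qed
    qed
  qed
  finally show ?thesis using \<nu> by (simp add: minus_part_carrier TwistM_uminus TwistM_simps(1))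
qed

definition Theta :: "(('a set \<Rightarrow> 'a set) \<Rightarrow> nat \<Rightarrow> 'a) \<Rightarrow> (nat \<Rightarrow> int \<Rightarrow> profint) set" where
  "Theta = (\<lambda>\<phi>\<in>carrier (minus_part p N DualM). star_cls (dual_measure \<phi>))"

lemma minus_DualM_carrier: "\<phi> \<in> carrier (minus_part p N DualM) \<longleftrightarrow> \<phi> \<in> Dual \<and> even_off_zero (dual_measure \<phi>)"
  using DualM_minus_iff by (auto simp: minus_part_carrier DualM_simps(1))

lemma even_cong:
  assumes "\<nu> \<in> Q" "\<nu>' \<in> Q" "\<And>r i. i \<in> R r \<Longrightarrow> i \<noteq> 0 \<Longrightarrow> \<nu> r i = \<nu>' r i" "even_off_zero \<nu>"
  shows "even_off_zero \<nu>'"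
  using assms(3,4) minus_residue unfolding even_off_zero_def by metis

lemma Theta_module_hom:
  "Theta \<in> module_homs (Lambda p N) (minus_part p N DualM) (minus_part p N TwistM)"
  unfolding module_homs_def mem_Collect_eq
proof (intro conjI ballI)
  show "Theta \<in> carrier (minus_part p N DualM) \<rightarrow>\<^sub>E carrier (minus_part p N TwistM)"
    unfolding Theta_def using TwistM_minusI[OF dual_measure_mem] by (auto simp: minus_DualM_carrier)
next
  fix \<phi> \<psi> assume "\<phi> \<in> carrier (minus_part p N DualM)" "\<psi> \<in> carrier (minus_part p N DualM)"
  then have \<phi>: "\<phi> \<in> Dual" "even_off_zero (dual_measure \<phi>)" and \<psi>: "\<psi> \<in> Dual" "even_off_zero (dual_measure \<psi>)"
    by (simp_all add: minus_DualM_carrier)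
  have "even_off_zero (dual_measure (\<phi> \<oplus>\<^bsub>DualM\<^esub> \<psi>))"
    unfolding even_off_zero_def
    using \<phi> \<psi> minus_residue by (auto simp: dual_measure_add even_off_zero_def)
  then have sum: "\<phi> \<oplus>\<^bsub>DualM\<^esub> \<psi> \<in> carrier (minus_part p N DualM)" using \<phi> \<psi> Dual_add by (simp add: minus_DualM_carrier)
  have "star_cls (dual_measure (\<phi> \<oplus>\<^bsub>DualM\<^esub> \<psi>)) = star_cls (\<lambda>r i m. (dual_measure \<phi> r i m + dual_measure \<psi> r i m) mod P m)"
    by (subst star_cls_eq_iff) (use \<phi> \<psi> in \<open>auto simp: dual_measure_mem Dual_add Q_add dual_measure_add\<close>)
  also have "\<dots> = star_cls (dual_measure \<phi>) \<oplus>\<^bsub>TwistM\<^esub> star_cls (dual_measure \<psi>)"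
    unfolding TwistM_simps(2) using \<phi> \<psi> by (simp add: Lambda_star_add dual_measure_mem)
  finally show "Theta (\<phi> \<oplus>\<^bsub>minus_part p N DualM\<^esub> \<psi>) = Theta \<phi> \<oplus>\<^bsub>minus_part p N TwistM\<^esub> Theta \<psi>"
    using sum \<phi> \<psi> by (simp add: Theta_def minus_DualM_carrier minus_part_ops)
next
  fix l \<phi> assume "l \<in> carrier (Lambda p N)" "\<phi> \<in> carrier (minus_part p N DualM)"
  then have l: "l \<in> L" and \<phi>: "\<phi> \<in> Dual" "even_off_zero (dual_measure \<phi>)"
    by (simp_all add: Lambda_carrier minus_DualM_carrier)
  let ?\<psi> = "l \<odot>\<^bsub>DualM\<^esub> \<phi>" and ?c = "\<lambda>r. conv p (M r) (U r) (R r) (twist_Lambda p N l r) (dual_measure \<phi> r)"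
  have \<psi>: "?\<psi> \<in> Dual" unfolding DualM_simps by (rule CK_dual_smult_spec(1)[OF l \<phi>(1)])
  have c: "?c \<in> Q" by (rule conv_mem_Q[OF twist_mem[OF l] dual_measure_mem[OF \<phi>(1)]])
  have eq: "dual_measure ?\<psi> r i = ?c r i" if "i \<in> R r" "i \<noteq> 0" for r i
    unfolding DualM_simps by (rule dual_measure_smult[OF l \<phi>(1) that])
  have "even_off_zero ?c" by (rule conv_even[OF twist_mem[OF l] dual_measure_mem[OF \<phi>(1)] \<phi>(2)])
  from even_cong[OF c dual_measure_mem[OF \<psi>] eq[symmetric] this] have "even_off_zero (dual_measure ?\<psi>)" .
  then have smult: "?\<psi> \<in> carrier (minus_part p N DualM)" using \<psi> by (simp add: minus_DualM_carrier)
  have "star_cls (dual_measure ?\<psi>) = star_cls ?c"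
  proof (subst star_cls_eq_iff[OF dual_measure_mem[OF \<psi>] c], intro allI impI)
    fix r and i :: int assume "i \<noteq> 0"
    then show "dual_measure ?\<psi> r i = ?c r i"
      using eq[of i r] Q_outside[OF dual_measure_mem[OF \<psi>], of i r] Q_outside[OF c, of i r] by (cases "i \<in> R r") auto
  qed
  also have "\<dots> = l \<odot>\<^bsub>TwistM\<^esub> star_cls (dual_measure \<phi>)"
    unfolding TwistM_simps by (rule Lambda_star_smult[OF twist_mem[OF l] dual_measure_mem[OF \<phi>(1)], symmetric])
  finally show "Theta (l \<odot>\<^bsub>minus_part p N DualM\<^esub> \<phi>) = l \<odot>\<^bsub>minus_part p N TwistM\<^esub> Theta \<phi>"
    using smult \<phi> by (simp add: Theta_def minus_DualM_carrier minus_part_ops)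
qed

lemma Theta_inj: "inj_on Theta (carrier (minus_part p N DualM))"
proof (rule inj_onI)
  fix \<phi> \<psi> assume \<phi>: "\<phi> \<in> carrier (minus_part p N DualM)" and \<psi>: "\<psi> \<in> carrier (minus_part p N DualM)" and eq: "Theta \<phi> = Theta \<psi>"
  then have "star_cls (dual_measure \<phi>) = star_cls (dual_measure \<psi>)" by (simp add: Theta_def)
  then show "\<phi> = \<psi>"
    using \<phi> \<psi> Dual_eqI_measure[of \<phi> \<psi>] by (auto simp: minus_DualM_carrier star_cls_eq_iff dual_measure_mem)
qed

subsection \<open>The formula in the tensor product\<close>

abbreviation FS where "FS r \<equiv> fin_star_Zp p (M r)"
abbreviation gen where "gen \<equiv> Tate_generator \<iota> p"
abbreviation ptt where "ptt r \<equiv> pure_tensor (Zp p) (FS r) T"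

lemma abelian_group_FS: "abelian_group (FS r)"
  by (rule abelian_group_cong[OF abelian_group_fin_star[OF M_pos]]) (simp_all add: fin_star_Zp_def restrict_scalars_def)

lemma gen_mem: "gen \<in> carrier T" using tate_point_mem[OF Zp_one_mem] tate_point_one by simp

lemma free_Zp_smult: "c \<in> carrier (Zp p) \<Longrightarrow> f \<in> free_Zp p S \<Longrightarrow> (\<lambda>i m. (c m * f i m) mod P m) \<in> free_Zp p S"
  using Zp_mult_mem by (auto simp: free_Zp_def)

lemma free_Zp_add: "f \<in> free_Zp p S \<Longrightarrow> h \<in> free_Zp p S \<Longrightarrow> (\<lambda>i m. (f i m + h i m) mod P m) \<in> free_Zp p S"
  using Zp_add_mem by (auto simp: free_Zp_def)

lemma FS_smult_closed: "c \<in> carrier (Zp p) \<Longrightarrow> S \<in> carrier (FS r) \<Longrightarrow> c \<odot>\<^bsub>FS r\<^esub> S \<in> carrier (FS r)"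
  unfolding fin_star_Zp_carrier using fin_star_Zp_smult[OF M_pos] free_Zp_smult by auto

lemma Tate_smult_closed: "c \<in> carrier (Zp p) \<Longrightarrow> w \<in> carrier T \<Longrightarrow> c \<odot>\<^bsub>T\<^esub> w \<in> carrier T"
  using tate_point_surj[of w] tate_point_smult[of c] tate_point_mem[OF Zp_mult_mem] by auto

lemma tensor_pair_FS: "tensor_pair (Zp p) (FS r) T"
  by (rule tensor_pair.intro) (use abelian_group_FS abelian_group_Tate FS_smult_closed Tate_smult_closed in auto)

lemma tate_point_eq_smult: "c \<in> carrier (Zp p) \<Longrightarrow> tate_point c = c \<odot>\<^bsub>T\<^esub> gen"
  unfolding tate_point_one[symmetric] using tate_point_smult[OF _ Zp_one_mem, of c] by (simp add: mod_simps)

text \<open>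
  The bilinear map \<open>(S, c\<zeta>) \<mapsto> cS\<close> sends \<open>(S, \<zeta>)\<close> to \<open>S\<close>.
\<close>

lemma tensor_gen_cancel:
  assumes S: "S \<in> carrier (FS r)" "S' \<in> carrier (FS r)" and eq: "ptt r S gen = ptt r S' gen"
  shows "S = S'"
proof -
  interpret FS: abelian_group "FS r" by (rule abelian_group_FS)
  define \<beta> where "\<beta> = (\<lambda>S w. (THE c. c \<in> carrier (Zp p) \<and> w = tate_point c) \<odot>\<^bsub>FS r\<^esub> S)"
  have \<beta>: "\<beta> S (tate_point c) = c \<odot>\<^bsub>FS r\<^esub> S" if "c \<in> carrier (Zp p)" for S c
  proof -
    have "(THE c'. c' \<in> carrier (Zp p) \<and> tate_point c = tate_point c') = c"
      by (rule the_equality) (use that tate_point_inj in auto)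
    then show ?thesis by (simp add: \<beta>_def)
  qed
  have one: "(\<lambda>m. 1 mod P m) \<odot>\<^bsub>FS r\<^esub> S = S" if S: "S \<in> carrier (FS r)" for S
  proof -
    obtain f where f: "f \<in> free_Zp p (R r)" "S = fin_cls (M r) f" using S by (auto simp: fin_star_Zp_carrier)
    have "(\<lambda>i m. ((1 mod P m) * f i m) mod P m) = f"
      using free_Zp_mem[OF f(1)] by (simp add: mod_simps fun_eq_iff)
    then show ?thesis by (simp add: f fin_star_Zp_smult[OF M_pos f(1) Zp_one_mem])
  qed
  have "\<beta> S gen = \<beta> S' gen"
  proof (rule tensor_pair.bilinear_respects_pure_tensor[OF tensor_pair_FS[of r], where A = "add_monoid (FS r)" and \<beta> = \<beta>])
    show "comm_group (add_monoid (FS r))" by (rule FS.a_comm_group)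
    fix A w assume A: "A \<in> carrier (FS r)" and w: "w \<in> carrier T"
    obtain c where c: "c \<in> carrier (Zp p)" "w = tate_point c" using tate_point_surj[OF w] by blast
    obtain f where f: "f \<in> free_Zp p (R r)" "A = fin_cls (M r) f" using A by (auto simp: fin_star_Zp_carrier)
    show "\<beta> A w \<in> carrier (add_monoid (FS r))" using FS_smult_closed[OF c(1) A] by (simp add: c \<beta>)
    {
      fix A' assume A': "A' \<in> carrier (FS r)"
      obtain f' where f': "f' \<in> free_Zp p (R r)" "A' = fin_cls (M r) f'" using A' by (auto simp: fin_star_Zp_carrier)
      have "\<beta> (A \<oplus>\<^bsub>FS r\<^esub> A') w = fin_cls (M r) (\<lambda>i m. (c m * ((f i m + f' i m) mod P m)) mod P m)"
        by (simp add: c \<beta> f f' fin_star_Zp_add[OF M_pos] fin_star_Zp_smult[OF M_pos free_Zp_add])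
      also have "\<dots> = fin_cls (M r) (\<lambda>i m. ((c m * f i m) mod P m + (c m * f' i m) mod P m) mod P m)"
        by (simp add: mod_simps distrib_left)
      also have "\<dots> = \<beta> A w \<oplus>\<^bsub>FS r\<^esub> \<beta> A' w"
        by (simp add: c \<beta> f f' fin_star_Zp_smult[OF M_pos] fin_star_Zp_add[OF M_pos free_Zp_smult free_Zp_smult])
      finally show "\<beta> (A \<oplus>\<^bsub>FS r\<^esub> A') w = \<beta> A w \<otimes>\<^bsub>add_monoid (FS r)\<^esub> \<beta> A' w" by simp
    next
      fix w' assume w': "w' \<in> carrier T"
      obtain c' where c': "c' \<in> carrier (Zp p)" "w' = tate_point c'" using tate_point_surj[OF w'] by blast
      have "w \<oplus>\<^bsub>T\<^esub> w' = tate_point (\<lambda>m. (c m + c' m) mod P m)" by (simp add: c c' Tate_simps tate_point_add)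
      then have "\<beta> A (w \<oplus>\<^bsub>T\<^esub> w') = fin_cls (M r) (\<lambda>i m. (((c m + c' m) mod P m) * f i m) mod P m)"
        by (simp add: \<beta> Zp_add_mem[OF c(1) c'(1)] f fin_star_Zp_smult[OF M_pos f(1) Zp_add_mem[OF c(1) c'(1)]])
      also have "\<dots> = fin_cls (M r) (\<lambda>i m. ((c m * f i m) mod P m + (c' m * f i m) mod P m) mod P m)"
        by (simp add: mod_simps distrib_right)
      also have "\<dots> = \<beta> A w \<oplus>\<^bsub>FS r\<^esub> \<beta> A w'"
        by (simp add: c c' \<beta> f fin_star_Zp_smult[OF M_pos] fin_star_Zp_add[OF M_pos free_Zp_smult free_Zp_smult])
      finally show "\<beta> A (w \<oplus>\<^bsub>T\<^esub> w') = \<beta> A w \<otimes>\<^bsub>add_monoid (FS r)\<^esub> \<beta> A w'" by simp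
    next
      fix d assume d: "d \<in> carrier (Zp p)"
      have "\<beta> (d \<odot>\<^bsub>FS r\<^esub> A) w = fin_cls (M r) (\<lambda>i m. (c m * ((d m * f i m) mod P m)) mod P m)"
        by (simp add: c \<beta> f fin_star_Zp_smult[OF M_pos] d free_Zp_smult)
      also have "\<dots> = fin_cls (M r) (\<lambda>i m. (((d m * c m) mod P m) * f i m) mod P m)"
        by (simp add: mod_simps mult_ac)
      also have "\<dots> = \<beta> A (d \<odot>\<^bsub>T\<^esub> w)"
        by (simp add: c tate_point_smult[OF d c(1)] \<beta> Zp_mult_mem[OF d c(1)] f fin_star_Zp_smult[OF M_pos f(1) Zp_mult_mem[OF d c(1)]])
      finally show "\<beta> (d \<odot>\<^bsub>FS r\<^esub> A) w = \<beta> A (d \<odot>\<^bsub>T\<^esub> w)" .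
    }
  qed (use S eq gen_mem in auto)
  then show ?thesis using \<beta>[OF Zp_one_mem] one S by (simp add: tate_point_one)
qed

text \<open>
  Moving the coefficients across the tensor sign turns \<open>\<Sum> [i] \<otimes> f(i)\<zeta>\<close> into \<open>(\<Sum> f(i)[i]) \<otimes> \<zeta>\<close>; the term
  at \<open>0\<close>, absent on one side, vanishes in the star module.
\<close>

lemma tensor_sum_formula:
  assumes f: "f \<in> free_Zp p (R r)"
  shows "ptt r (fin_cls (M r) f) gen =
    (\<Otimes>\<^bsub>tensor (Zp p) (FS r) T\<^esub>i\<in>{1..N * p ^ r - 1}. ptt r (fin_cls (M r) (single p (int i))) (tate_point (f (int i))))"
proof -
  interpret TT: comm_group "tensor (Zp p) (FS r) T" by (rule tensor_pair.comm_group_tensor[OF tensor_pair_FS])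
  interpret FS: abelian_group "FS r" by (rule abelian_group_FS)
  let ?f = "\<lambda>A i. if \<exists>k\<in>A. i = int k then f i else (\<lambda>m. 0)"
  let ?t = "\<lambda>i. ptt r (fin_cls (M r) (single p (int i))) (tate_point (f (int i)))"
  have fA: "?f A \<in> free_Zp p (R r)" for A using f Zp_zero_mem by (auto simp: free_Zp_def)
  have fc: "fin_cls (M r) h \<in> carrier (FS r)" if "h \<in> free_Zp p (R r)" for h using that by (simp add: fin_star_Zp_carrier)
  have iR: "int i \<in> R r" if "i \<in> {1..N * p ^ r - 1}" for i using that n_pos[of r] by (auto simp: R_iff)
  have sm: "single p (int i) \<in> free_Zp p (R r)" if "i \<in> {1..N * p ^ r - 1}" for i
    using scaled_single_mem[OF _ iR[OF that]] Zp_one_mem by simp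
  have tm: "?t i = ptt r (fin_cls (M r) (scaled_single p (f (int i)) (int i))) gen \<and> ?t i \<in> carrier (tensor (Zp p) (FS r) T)"
    if i: "i \<in> {1..N * p ^ r - 1}" for i
  proof
    note c = free_Zp_mem[OF f, of "int i"]
    show "?t i \<in> carrier (tensor (Zp p) (FS r) T)"
      by (rule tensor_pair.pure_tensor_closed[OF tensor_pair_FS fc[OF sm[OF i]] tate_point_mem[OF c]])
    have "?t i = ptt r (f (int i) \<odot>\<^bsub>FS r\<^esub> fin_cls (M r) (single p (int i))) gen"
      unfolding tate_point_eq_smult[OF c] by (rule tensor_pair.pure_tensor_smult[OF tensor_pair_FS c fc[OF sm[OF i]] gen_mem, symmetric])
    also have "f (int i) \<odot>\<^bsub>FS r\<^esub> fin_cls (M r) (single p (int i)) = fin_cls (M r) (\<lambda>k m. (f (int i) m * single p (int i) k m) mod P m)"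
      by (rule fin_star_Zp_smult[OF M_pos sm[OF i] c])
    also have "(\<lambda>k m. (f (int i) m * single p (int i) k m) mod P m) = scaled_single p (f (int i)) (int i)"
      using c by (auto simp: fun_eq_iff scaled_single_apply mod_simps)
    finally show "?t i = ptt r (fin_cls (M r) (scaled_single p (f (int i)) (int i))) gen" .
  qed
  have "ptt r (fin_cls (M r) (?f A)) gen = (\<Otimes>\<^bsub>tensor (Zp p) (FS r) T\<^esub>i\<in>A. ?t i)"
    if "finite A" "A \<subseteq> {1..N * p ^ r - 1}" for A
    using that
  proof (induction A)
    case empty
    have "fin_cls (M r) (?f {}) = \<zero>\<^bsub>FS r\<^esub>"
    proof -
      interpret abelian_subgroup "fin_star_kernel p (M r)" "fin_residue_module p (M r)"
        by (rule fin_star_kernel_subgroup[OF M_pos])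
      have "fin_cls (M r) \<zero>\<^bsub>fin_residue_module p (M r)\<^esub> = fin_star_kernel p (M r)" by (rule a_coset_add_zero[OF a_subset])
      then show ?thesis
        by (simp add: fin_star_Zp_def restrict_scalars_def fin_star_def quot_module_zero fin_residue_module_simps)
    qed
    then show ?case using tensor_pair.pure_tensor_zero_left[OF tensor_pair_FS gen_mem] by simp
  next
    case (insert i A)
    then have i: "i \<in> {1..N * p ^ r - 1}" by simp
    note c = free_Zp_mem[OF f, of "int i"]
    have ss: "scaled_single p (f (int i)) (int i) \<in> free_Zp p (R r)" by (rule scaled_single_mem[OF c iR[OF i]])
    have "?f (insert i A) = (\<lambda>k m. (scaled_single p (f (int i)) (int i) k m + ?f A k m) mod P m)"
      using insert(2) free_Zp_mem[OF f] by (auto simp: fun_eq_iff scaled_single_apply)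
    then have "fin_cls (M r) (?f (insert i A)) = fin_cls (M r) (scaled_single p (f (int i)) (int i)) \<oplus>\<^bsub>FS r\<^esub> fin_cls (M r) (?f A)"
      using fin_star_Zp_add[OF M_pos ss fA[of A]] by simp
    then have "ptt r (fin_cls (M r) (?f (insert i A))) gen = ?t i \<otimes>\<^bsub>tensor (Zp p) (FS r) T\<^esub> ptt r (fin_cls (M r) (?f A)) gen"
      using tensor_pair.pure_tensor_add_left[OF tensor_pair_FS fc[OF ss] fc[OF fA[of A]] gen_mem] tm[OF i] by simp
    also have "ptt r (fin_cls (M r) (?f A)) gen = (\<Otimes>\<^bsub>tensor (Zp p) (FS r) T\<^esub>i\<in>A. ?t i)" using insert by simp
    also have "?t i \<otimes>\<^bsub>tensor (Zp p) (FS r) T\<^esub> (\<Otimes>\<^bsub>tensor (Zp p) (FS r) T\<^esub>i\<in>A. ?t i) = (\<Otimes>\<^bsub>tensor (Zp p) (FS r) T\<^esub>i\<in>insert i A. ?t i)"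
    proof (rule TT.finprod_insert[symmetric])
      show "?t \<in> A \<rightarrow> carrier (tensor (Zp p) (FS r) T)" using insert.prems tm by blast
      show "?t i \<in> carrier (tensor (Zp p) (FS r) T)" using tm[OF i] by blast
    qed (use insert in auto)
    finally show ?case .
  qed
  from this[of "{1..N * p ^ r - 1}"]
  have "ptt r (fin_cls (M r) (?f {1..N * p ^ r - 1})) gen = (\<Otimes>\<^bsub>tensor (Zp p) (FS r) T\<^esub>i\<in>{1..N * p ^ r - 1}. ?t i)" by simp
  moreover have "fin_cls (M r) (?f {1..N * p ^ r - 1}) = fin_cls (M r) f"
  proof (subst fin_cls_eq_iff[OF M_pos fA f], intro allI impI)
    fix i :: int assume i: "i \<noteq> 0"
    show "?f {1..N * p ^ r - 1} i = f i"
    proof (cases "i \<in> R r")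
      case True
      then have "\<exists>k\<in>{1..N * p ^ r - 1}. i = int k" using i n_pos[of r] by (intro bexI[of _ "nat i"]) (auto simp: R_iff)
      then show ?thesis by simp
    next
      case False
      then show ?thesis using f by (simp add: free_Zp_def)
    qed
  qed
  ultimately show ?thesis by simp
qed

lemma Theta_formula:
  assumes "\<phi> \<in> carrier (minus_part p N DualM)"
  shows "ptt r (star_proj p N r (Theta \<phi>)) gen =
       (\<Otimes>\<^bsub>tensor (Zp p) (FS r) T\<^esub>i\<in>{1..N * p ^ r - 1}.
          ptt r (fin_star_class p (M r) (int i)) (\<phi> (unit_class (1 - z r ^ i))))"
proof -
  interpret TT: comm_group "tensor (Zp p) (FS r) T" by (rule tensor_pair.comm_group_tensor[OF tensor_pair_FS])
  have \<phi>: "\<phi> \<in> Dual" using assms by (simp add: minus_DualM_carrier)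
  have "ptt r (star_proj p N r (Theta \<phi>)) gen = ptt r (fin_cls (M r) (dual_measure \<phi> r)) gen"
    using assms by (simp add: Theta_def star_proj_star_cls[OF dual_measure_mem[OF \<phi>]])
  also have "\<dots> = (\<Otimes>\<^bsub>tensor (Zp p) (FS r) T\<^esub>i\<in>{1..N * p ^ r - 1}. ptt r (fin_cls (M r) (single p (int i))) (tate_point (dual_measure \<phi> r (int i))))"
    by (rule tensor_sum_formula[OF Q_free[OF dual_measure_mem[OF \<phi>]]])
  also have "\<dots> = (\<Otimes>\<^bsub>tensor (Zp p) (FS r) T\<^esub>i\<in>{1..N * p ^ r - 1}.
          ptt r (fin_star_class p (M r) (int i)) (\<phi> (unit_class (1 - z r ^ i))))"
  proof (rule TT.finprod_cong')
    fix i assume i: "i \<in> {1..N * p ^ r - 1}"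
    then have iR: "int i \<in> R r" "int i \<noteq> 0" using n_pos[of r] by (auto simp: R_iff)
    then have "\<phi> (unit_class (1 - z r ^ i)) = tate_point (dual_measure \<phi> r (int i))"
      using dlog(2)[OF \<phi> cyc_unit_Cyc[OF iR]] dual_measure_apply[OF \<phi> iR] by simp
    then show "ptt r (fin_cls (M r) (single p (int i))) (tate_point (dual_measure \<phi> r (int i))) = ptt r (fin_star_class p (M r) (int i)) (\<phi> (unit_class (1 - z r ^ i)))"
      by (simp add: fin_star_class_def)
  next
    show "(\<lambda>i. ptt r (fin_star_class p (M r) (int i)) (\<phi> (unit_class (1 - z r ^ i)))) \<in> {1..N * p ^ r - 1} \<rightarrow> carrier (tensor (Zp p) (FS r) T)"
    proof
      fix i assume i: "i \<in> {1..N * p ^ r - 1}"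
      then have iR: "int i \<in> R r" "int i \<noteq> 0" using n_pos[of r] by (auto simp: R_iff)
      have "single p (int i) \<in> free_Zp p (R r)" using scaled_single_mem[OF _ iR(1)] Zp_one_mem by simp
      then have "fin_star_class p (M r) (int i) \<in> carrier (FS r)" unfolding fin_star_class_def fin_star_Zp_carrier by blast
      moreover have "\<phi> (unit_class (1 - z r ^ i)) \<in> carrier T" using Dual_mem[OF \<phi> unit_class_mem[OF cyc_unit_Cyc[OF iR]]] by simp
      ultimately show "ptt r (fin_star_class p (M r) (int i)) (\<phi> (unit_class (1 - z r ^ i))) \<in> carrier (tensor (Zp p) (FS r) T)"
        by (rule tensor_pair.pure_tensor_closed[OF tensor_pair_FS])
    qed
  qed simp
  finally show ?thesis .
qed

lemma Theta_unique:
  assumes hom: "\<Theta> \<in> module_homs (Lambda p N) (minus_part p N DualM) (minus_part p N TwistM)"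
    and formula: "\<And>\<phi> r. \<phi> \<in> carrier (minus_part p N DualM) \<Longrightarrow>
      ptt r (star_proj p N r (\<Theta> \<phi>)) gen = ptt r (star_proj p N r (Theta \<phi>)) gen"
  shows "\<Theta> = Theta"
proof (rule extensionalityI[of _ "carrier (minus_part p N DualM)"])
  show "\<Theta> \<in> extensional (carrier (minus_part p N DualM))" using hom by (simp add: module_homs_def PiE_def)
  show "Theta \<in> extensional (carrier (minus_part p N DualM))" by (simp add: Theta_def)
  fix \<phi> assume \<phi>: "\<phi> \<in> carrier (minus_part p N DualM)"
  then have \<phi>K: "\<phi> \<in> Dual" by (simp add: minus_DualM_carrier)
  have "\<Theta> \<phi> \<in> carrier (minus_part p N TwistM)" using hom \<phi> by (auto simp: module_homs_def)
  then obtain \<nu> where \<nu>: "\<nu> \<in> Q" "\<Theta> \<phi> = star_cls \<nu>" by (auto simp: minus_part_carrier TwistM_simps(1))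
  have "fin_cls (M r) (\<nu> r) = fin_cls (M r) (dual_measure \<phi> r)" for r
    by (rule tensor_gen_cancel)
       (use formula[OF \<phi>, of r] \<phi> in \<open>simp_all add: fin_star_Zp_carrier Q_free[OF \<nu>(1)] Q_free[OF dual_measure_mem[OF \<phi>K]] \<nu>(2) Theta_def star_proj_star_cls[OF \<nu>(1)] star_proj_star_cls[OF dual_measure_mem[OF \<phi>K]]\<close>)
  then have "\<forall>r i. i \<noteq> 0 \<longrightarrow> \<nu> r i = dual_measure \<phi> r i"
    using fin_cls_eq_iff[OF M_pos Q_free[OF \<nu>(1)] Q_free[OF dual_measure_mem[OF \<phi>K]]] by blast
  then have "star_cls \<nu> = star_cls (dual_measure \<phi>)" by (subst star_cls_eq_iff[OF \<nu>(1) dual_measure_mem[OF \<phi>K]])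
  then show "\<Theta> \<phi> = Theta \<phi>" using \<nu>(2) \<phi> by (simp add: Theta_def)
qed

end

theorem proposition6p2:
  fixes p N :: nat
    and \<iota> :: "'a::{alg_closed_field, field_char_0} \<Rightarrow> complex"
  assumes "Factorial_Ring.prime p" and "p \<ge> 5" and "N \<ge> 1" and "coprime N p" and "\<not> p dvd totient N"
    and Qbar: "\<And>x::'a. Polynomial.algebraic x"
    and embedding: "\<iota> \<in> ring_hom ring_of_type_algebra ring_of_type_algebra"
  shows "\<exists>!\<Theta>.
    \<Theta> \<in> module_homs (Lambda p N)
          (minus_part p N (CK_dual p N))
          (minus_part p N (Tate_twist p N (Lambda_star p N))) \<and>
    inj_on \<Theta> (carrier (minus_part p N (CK_dual p N))) \<and>
    (\<forall>\<phi>\<in>carrier (minus_part p N (CK_dual p N)). \<forall>r.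
       pure_tensor (Zp p) (fin_star_Zp p (lvl p N r)) (Tate p N)
         (star_proj p N r (\<Theta> \<phi>)) (Tate_generator \<iota> p) =
       (\<Otimes>\<^bsub>tensor (Zp p) (fin_star_Zp p (lvl p N r)) (Tate p N)\<^esub>i\<in>{1..N * p ^ r - 1}.
          pure_tensor (Zp p) (fin_star_Zp p (lvl p N r)) (Tate p N)
            (fin_star_class p (lvl p N r) (int i))
            (\<phi> (CK_class p N (1 - zeta \<iota> (N * p ^ r) ^ i)))))"
proof -
  interpret cyclotomic p N \<iota>
    by unfold_locales (use assms in auto)
  show ?thesis
    by (rule ex1I[of _ Theta]) (simp_all add: Theta_module_hom Theta_inj Theta_formula Theta_unique)
qed

end
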